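(* Let $\mathcal V$ be a complex vector space, $\Omega\subseteq\mathcal V_{\mathrm{nc}}$ a finitely open nc set, $\mathcal W$ a complex Banach space with an admissible system of matrix norms, and $f:\Omega\to\mathcal W_{\mathrm{nc}}$ a nc function which is locally bounded on slices. Then: (1) $f$ is G-differentiable. (2) For every $n$, $Y\in\Omega_n$, $Z\in\mathcal V^{n\times n}$ and $N\in\mathbb N$, $t\mapsto f(Y+tZ)$ is $N$ times differentiable at $t=0$ and $\frac1{N!}\frac{d^N}{dt^N}f(Y+tZ)\big|_{t=0}=\Delta_R^Nf(Y,\dots,Y)(Z,\dots,Z)$ ($N+1$ copies of $Y$, $N$ copies of $Z$). (3) For $n\in\mathbb N$ and $Y\in\Omega_n$, let $\Upsilon(Y)=\{X\in\Omega_n:Y+t(X-Y)\in\Omega_n\text{ for all }t\in\mathbb C,|t|\le1\}$. Then $\Upsilon(Y)$ is the maximal complete circular set about $Y$ contained in $\Omega_n$ and is finitely open, and for every $X\in\Upsilon(Y)$, $$f(X)=\sum_{\ell=0}^\infty\Delta_R^\ell f(\underbrace{Y,\dots,Y}_{\ell+1})(\underbrace{X-Y,\dots,X-Y}_{\ell}),$$ with the series converging absolutely. (4) This series converges uniformly on compact subsets of $\mathcal U\cap\Upsilon(Y)$ for every finite-dimensional subspace $\mathcal U$ of $\mathcal V^{n\times n}$; moreover for every such compact set $K$ there exists a finitely open complete circular set $\Upsilon_K$ about $Y$ with $K\subseteq\Upsilon_K\subseteq\Upsilon(Y)$ and $\sum_{\ell=0}^\infty\sup_{X\in\Upsilon_K}\|\Delta_R^\ell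 f(Y,\dots,Y)(X-Y,\dots,X-Y)\|_n<\infty$.
   Context: $\mathcal V_{\mathrm{nc}}=\coprod_n\mathcal V^{n\times n}$; complex matrices act on matrices over $\mathcal V,\mathcal W$ by multiplication; $X\oplus Y=\begin{bmatrix}X&0\\0&Y\end{bmatrix}$. A nc set is a subset closed under direct sums, $\Omega_n=\Omega\cap\mathcal V^{n\times n}$; a nc function $f$ satisfies $f(\Omega_n)\subseteq\mathcal W^{n\times n}$, $f(X\oplus Y)=f(X)\oplus f(Y)$, $f(SXS^{-1})=Sf(X)S^{-1}$ for invertible $S\in\mathbb C^{n\times n}$ with $X,SXS^{-1}\in\Omega_n$. $\Omega$ is finitely open if each $\Omega_n$ meets every finite-dimensional subspace $\mathcal U\subseteq\mathcal V^{n\times n}$ in a Euclidean-open subset of $\mathcal U$. An admissible system of matrix norms over $\mathcal W$ is a sequence of norms $\|\cdot\|_n$ on $\mathcal W^{n\times n}$ such that there are constants $C_1(n,m),C_1'(n,m),C_2(n)>0$ with $C_1(n,m)^{-1}\max\{\|X\|_n,\|Y\|_m\}\le\|X\oplus Y\|_{n+m}\le C_1'(n,m)\max\{\|X\|_n,\|Y\|_m\}$ and $\|SXT\|_n\le C_2(n)\|S\|\|X\|_n\|T\|$ for $S,T\in\mathbb C^{n\times n}$ (operator norms). $f$ is locally bounded on slices if for every $n$, $X\in\Omega_n$, $Z\in\mathcal V^{n\times n}$ there is $\epsilon>0$ with $f(X+tZ)$ bounded for $|t|<\epsilon$; $f$ is G-differentiable if for all $n$, $X\in\Omega_n$, $Z\in\mathcal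 V^{n\times n}$ the limit $\lim_{t\to0}(f(X+tZ)-f(X))/t$ exists in $\mathcal W^{n\times n}$. A set $\Upsilon$ in a vector space is complete circular about $Y$ if $X\in\Upsilon$ implies $Y+t(X-Y)\in\Upsilon$ for all $|t|\le1$. A finitely open nc set is right admissible, so higher order operators are defined: with $\tilde\Omega=\{SXS^{-1}\}$ and $\tilde f(SXS^{-1})=Sf(X)S^{-1}$ the unique nc extension, for $X^j\in\Omega_{n_j}$ and $Z^j\in\mathcal V^{n_{j-1}\times n_j}$ the block upper bidiagonal matrix $B$ with diagonal $X^0,\dots,X^\ell$ and superdiagonal $Z^1,\dots,Z^\ell$ lies in $\tilde\Omega$, and $\Delta_R^\ell f(X^0,\dots,X^\ell)(Z^1,\dots,Z^\ell)$ is the $(1,\ell+1)$ block of $\tilde f(B)$ (multilinear; $\Delta_R^0f=f$). *)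

theory Defs
  imports "HOL-Analysis.Analysis" "HOL-Library.Function_Algebras"
begin

text \<open>Matrices over a space are represented as functions nat => nat => 'a; an
  n x m matrix is one whose entries outside the index range vanish.
  Matrix addition / subtraction / sums are the pointwise operations.\<close>

type_synonym 'a mat = "nat \<Rightarrow> nat \<Rightarrow> 'a"

definition mat_dim :: "nat \<Rightarrow> nat \<Rightarrow> ('a::zero) mat set" where
  "mat_dim p q = {X. \<forall>i j. \<not> (i < p \<and> j < q) \<longrightarrow> X i j = 0}"

definition mscale :: "(complex \<Rightarrow> 'a \<Rightarrow> 'a) \<Rightarrow> complex \<Rightarrow> 'a mat \<Rightarrow> 'a mat" where
  "mscale s c X = (\<lambda>i j. s c (X i j))"

definition cmat_mult :: "nat \<Rightarrow> complex mat \<Rightarrow> complex mat \<Rightarrow> complex mat" where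
  "cmat_mult m S T = (\<lambda>i j. if i < m \<and> j < m then \<Sum>k<m. S i k * T k j else 0)"

definition cmat_id :: "nat \<Rightarrow> complex mat" where
  "cmat_id m = (\<lambda>i j. if i < m \<and> j = i then 1 else 0)"

definition cinv_pair :: "nat \<Rightarrow> complex mat \<Rightarrow> complex mat \<Rightarrow> bool" where
  "cinv_pair m S T \<longleftrightarrow> S \<in> mat_dim m m \<and> T \<in> mat_dim m m \<and>
     cmat_mult m S T = cmat_id m \<and> cmat_mult m T S = cmat_id m"

definition sandwich :: "(complex \<Rightarrow> 'a \<Rightarrow> 'a) \<Rightarrow> nat \<Rightarrow> complex mat \<Rightarrow> ('a::comm_monoid_add) mat
    \<Rightarrow> complex mat \<Rightarrow> 'a mat" where
  "sandwich s m S X T = (\<lambda>i j. if i < m \<and> j < m then (\<Sum>k<m. \<Sum>l<m. s (S i k * T l j) (X k l)) else 0)"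

definition dsum :: "nat \<Rightarrow> ('a::zero) mat \<Rightarrow> 'a mat \<Rightarrow> 'a mat" where
  "dsum n X Y = (\<lambda>i j. if i < n \<and> j < n then X i j
                       else if n \<le> i \<and> n \<le> j then Y (i - n) (j - n) else 0)"

definition cop_norm :: "nat \<Rightarrow> complex mat \<Rightarrow> real" where
  "cop_norm n S = Sup {sqrt (\<Sum>i<n. (cmod (\<Sum>k<n. S i k * v k))\<^sup>2) | v. (\<Sum>k<n. (cmod (v k))\<^sup>2) \<le> 1}"

definition complex_banach :: "(complex \<Rightarrow> 'w::banach \<Rightarrow> 'w) \<Rightarrow> bool" where
  "complex_banach s \<longleftrightarrow> vector_space s \<and> (\<forall>r x. s (complex_of_real r) x = scaleR r x)
     \<and> (\<forall>c x. norm (s c x) = cmod c * norm x)"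

definition cnorm_on :: "(complex \<Rightarrow> 'w::ab_group_add \<Rightarrow> 'w) \<Rightarrow> nat \<Rightarrow> ('w mat \<Rightarrow> real) \<Rightarrow> bool" where
  "cnorm_on s n N \<longleftrightarrow> (\<forall>X\<in>mat_dim n n. 0 \<le> N X \<and> (N X = 0 \<longleftrightarrow> X = 0)
      \<and> (\<forall>c. N (mscale s c X) = cmod c * N X)
      \<and> (\<forall>Y\<in>mat_dim n n. N (X + Y) \<le> N X + N Y))"

definition admissible_norms :: "(complex \<Rightarrow> 'w::banach \<Rightarrow> 'w) \<Rightarrow> (nat \<Rightarrow> 'w mat \<Rightarrow> real) \<Rightarrow> bool" where
  "admissible_norms s nrm \<longleftrightarrow>
     (\<forall>n>0. cnorm_on s n (nrm n)) \<and>
     (\<forall>X\<in>mat_dim 1 1. nrm 1 X = norm (X 0 0)) \<and>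
     (\<exists>C1 C1' :: nat \<Rightarrow> nat \<Rightarrow> real. \<exists>C2 :: nat \<Rightarrow> real.
        (\<forall>n m. 0 < n \<longrightarrow> 0 < m \<longrightarrow> 0 < C1 n m \<and> 0 < C1' n m \<and>
           (\<forall>X\<in>mat_dim n n. \<forall>Y\<in>mat_dim m m.
              max (nrm n X) (nrm m Y) / C1 n m \<le> nrm (n + m) (dsum n X Y) \<and>
              nrm (n + m) (dsum n X Y) \<le> C1' n m * max (nrm n X) (nrm m Y))) \<and>
        (\<forall>n>0. 0 < C2 n \<and> (\<forall>S\<in>mat_dim n n. \<forall>T\<in>mat_dim n n. \<forall>X\<in>mat_dim n n.
           nrm n (sandwich s n S X T) \<le> C2 n * cop_norm n S * nrm n X * cop_norm n T)))"

definition nc_set :: "(nat \<Rightarrow> ('v::zero) mat set) \<Rightarrow> bool" where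
  "nc_set \<Omega> \<longleftrightarrow> (\<forall>n. \<Omega> n \<subseteq> mat_dim n n) \<and>
     (\<forall>n m X Y. 0 < n \<longrightarrow> 0 < m \<longrightarrow> X \<in> \<Omega> n \<longrightarrow> Y \<in> \<Omega> m \<longrightarrow> dsum n X Y \<in> \<Omega> (n + m))"

definition nc_function :: "(complex \<Rightarrow> 'v \<Rightarrow> 'v) \<Rightarrow> (complex \<Rightarrow> 'w \<Rightarrow> 'w) \<Rightarrow>
    (nat \<Rightarrow> ('v::comm_monoid_add) mat set) \<Rightarrow> (nat \<Rightarrow> 'v mat \<Rightarrow> ('w::comm_monoid_add) mat) \<Rightarrow> bool" where
  "nc_function sV sW \<Omega> f \<longleftrightarrow>
     (\<forall>n>0. \<forall>X\<in>\<Omega> n. f n X \<in> mat_dim n n) \<and>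
     (\<forall>n m X Y. 0 < n \<longrightarrow> 0 < m \<longrightarrow> X \<in> \<Omega> n \<longrightarrow> Y \<in> \<Omega> m \<longrightarrow>
        f (n + m) (dsum n X Y) = dsum n (f n X) (f m Y)) \<and>
     (\<forall>n>0. \<forall>S T X. cinv_pair n S T \<longrightarrow> X \<in> \<Omega> n \<longrightarrow> sandwich sV n S X T \<in> \<Omega> n \<longrightarrow>
        f n (sandwich sV n S X T) = sandwich sW n S (f n X) T)"

definition mlincomb :: "(complex \<Rightarrow> 'v \<Rightarrow> 'v) \<Rightarrow> nat \<Rightarrow> (nat \<Rightarrow> complex) \<Rightarrow> (nat \<Rightarrow> ('v::comm_monoid_add) mat)
    \<Rightarrow> 'v mat" where
  "mlincomb s k c E = (\<Sum>i<k. mscale s (c i) (E i))"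

text \<open>E 0, ..., E (k-1) is a basis (linearly independent family) of a subspace of the n x n
  matrices; every finite-dimensional subspace U arises as the span of such a family.\<close>
definition fd_basis :: "(complex \<Rightarrow> 'v \<Rightarrow> 'v) \<Rightarrow> nat \<Rightarrow> nat \<Rightarrow> (nat \<Rightarrow> ('v::comm_monoid_add) mat) \<Rightarrow> bool" where
  "fd_basis s n k E \<longleftrightarrow> (\<forall>i<k. E i \<in> mat_dim n n) \<and>
     (\<forall>c. mlincomb s k c E = 0 \<longrightarrow> (\<forall>i<k. c i = 0))"

text \<open>Coordinate space C^k, embedded in nat => complex (product topology).\<close>
definition coords :: "nat \<Rightarrow> (nat \<Rightarrow> complex) set" where
  "coords k = {c. \<forall>i\<ge>k. c i = 0}"

definition fd_span :: "(complex \<Rightarrow> 'v \<Rightarrow> 'v) \<Rightarrow> nat \<Rightarrow> (nat \<Rightarrow> ('v::comm_monoid_add) mat) \<Rightarrow> 'v mat set" where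
  "fd_span s k E = (\<lambda>c. mlincomb s k c E) ` coords k"

text \<open>A subset A of V^{n x n} is finitely open: its intersection with every finite-dimensional
  subspace U is open in the Euclidean topology of U (transported through coordinates).\<close>
definition fin_open_level :: "(complex \<Rightarrow> 'v \<Rightarrow> 'v) \<Rightarrow> nat \<Rightarrow> ('v::comm_monoid_add) mat set \<Rightarrow> bool" where
  "fin_open_level s n A \<longleftrightarrow> (\<forall>k E. fd_basis s n k E \<longrightarrow>
      openin (top_of_set (coords k)) {c \<in> coords k. mlincomb s k c E \<in> A})"

definition finitely_open :: "(complex \<Rightarrow> 'v \<Rightarrow> 'v) \<Rightarrow> (nat \<Rightarrow> ('v::comm_monoid_add) mat set) \<Rightarrow> bool" where
  "finitely_open s \<Omega> \<longleftrightarrow> (\<forall>n>0. fin_open_level s n (\<Omega> n))"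

definition fd_compact :: "(complex \<Rightarrow> 'v \<Rightarrow> 'v) \<Rightarrow> nat \<Rightarrow> (nat \<Rightarrow> ('v::comm_monoid_add) mat) \<Rightarrow> 'v mat set \<Rightarrow> bool" where
  "fd_compact s k E K \<longleftrightarrow> K \<subseteq> fd_span s k E \<and> compact {c \<in> coords k. mlincomb s k c E \<in> K}"

definition complete_circular :: "(complex \<Rightarrow> 'v \<Rightarrow> 'v) \<Rightarrow> ('v::ab_group_add) mat \<Rightarrow> 'v mat set \<Rightarrow> bool" where
  "complete_circular s Y A \<longleftrightarrow> (\<forall>X\<in>A. \<forall>t. cmod t \<le> 1 \<longrightarrow> Y + mscale s t (X - Y) \<in> A)"

definition Upsilon :: "(complex \<Rightarrow> 'v \<Rightarrow> 'v) \<Rightarrow> (nat \<Rightarrow> ('v::ab_group_add) mat set) \<Rightarrow> nat \<Rightarrow> 'v mat \<Rightarrow> 'v mat set" where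
  "Upsilon s \<Omega> n Y = {X \<in> \<Omega> n. \<forall>t. cmod t \<le> 1 \<longrightarrow> Y + mscale s t (X - Y) \<in> \<Omega> n}"

definition locally_bounded_on_slices :: "(complex \<Rightarrow> 'v \<Rightarrow> 'v) \<Rightarrow> (nat \<Rightarrow> 'w mat \<Rightarrow> real) \<Rightarrow>
    (nat \<Rightarrow> ('v::comm_monoid_add) mat set) \<Rightarrow> (nat \<Rightarrow> 'v mat \<Rightarrow> 'w mat) \<Rightarrow> bool" where
  "locally_bounded_on_slices s nrm \<Omega> f \<longleftrightarrow>
     (\<forall>n>0. \<forall>X\<in>\<Omega> n. \<forall>Z\<in>mat_dim n n. \<exists>\<epsilon>>0. \<exists>M. \<forall>t. cmod t < \<epsilon> \<longrightarrow>
        X + mscale s t Z \<in> \<Omega> n \<longrightarrow> nrm n (f n (X + mscale s t Z)) \<le> M)"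

definition G_differentiable :: "(complex \<Rightarrow> 'v \<Rightarrow> 'v) \<Rightarrow> (complex \<Rightarrow> 'w \<Rightarrow> 'w) \<Rightarrow> (nat \<Rightarrow> 'w mat \<Rightarrow> real) \<Rightarrow>
    (nat \<Rightarrow> ('v::comm_monoid_add) mat set) \<Rightarrow> (nat \<Rightarrow> 'v mat \<Rightarrow> ('w::ab_group_add) mat) \<Rightarrow> bool" where
  "G_differentiable sV sW nrm \<Omega> f \<longleftrightarrow>
     (\<forall>n>0. \<forall>X\<in>\<Omega> n. \<forall>Z\<in>mat_dim n n. \<exists>D\<in>mat_dim n n.
        ((\<lambda>t. nrm n (mscale sW (1 / t) (f n (X + mscale sV t Z) - f n X) - D)) \<longlongrightarrow> 0) (at 0))"

definition has_mderiv :: "(complex \<Rightarrow> 'w \<Rightarrow> 'w) \<Rightarrow> ('w mat \<Rightarrow> real) \<Rightarrow> (complex \<Rightarrow> ('w::ab_group_add) mat)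
    \<Rightarrow> 'w mat \<Rightarrow> complex \<Rightarrow> bool" where
  "has_mderiv s N g D t0 \<longleftrightarrow> ((\<lambda>h. N (mscale s (1 / h) (g (t0 + h) - g t0) - D)) \<longlongrightarrow> 0) (at 0)"

definition nth_deriv_at :: "(complex \<Rightarrow> 'w \<Rightarrow> 'w) \<Rightarrow> nat \<Rightarrow> ('w mat \<Rightarrow> real) \<Rightarrow>
    (complex \<Rightarrow> ('w::ab_group_add) mat) \<Rightarrow> nat \<Rightarrow> 'w mat \<Rightarrow> bool" where
  "nth_deriv_at s n N g K V \<longleftrightarrow> (\<exists>r>0. \<exists>Ds :: nat \<Rightarrow> complex \<Rightarrow> 'w mat.
      (\<forall>t\<in>ball 0 r. Ds 0 t = g t) \<and>
      (\<forall>k\<le>K. \<forall>t\<in>ball 0 r. Ds k t \<in> mat_dim n n) \<and>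
      (\<forall>k. Suc k < K \<longrightarrow> (\<forall>t\<in>ball 0 r. has_mderiv s N (Ds k) (Ds (Suc k) t) t)) \<and>
      (0 < K \<longrightarrow> has_mderiv s N (Ds (K - 1)) (Ds K 0) 0) \<and>
      Ds K 0 = V)"

definition offs :: "nat list \<Rightarrow> nat \<Rightarrow> nat" where
  "offs ns a = sum_list (take a ns)"

definition blk :: "nat list \<Rightarrow> nat \<Rightarrow> nat" where
  "blk ns i = (LEAST a. i < offs ns (Suc a))"

text \<open>Block upper bidiagonal matrix with diagonal blocks Xs!0..Xs!l (sizes ns) and
  superdiagonal blocks Zs!0..Zs!(l-1) (= Z^1..Z^l).\<close>
definition bidiag :: "nat list \<Rightarrow> ('a::zero) mat list \<Rightarrow> 'a mat list \<Rightarrow> 'a mat" where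
  "bidiag ns Xs Zs = (\<lambda>i j. if i < sum_list ns \<and> j < sum_list ns then
      (let a = blk ns i; b = blk ns j; i' = i - offs ns a; j' = j - offs ns b in
        if b = a then (Xs ! a) i' j' else if b = Suc a then (Zs ! a) i' j' else 0)
    else 0)"

text \<open>The unique nc extension of f to the similarity envelope of Omega.\<close>
definition nc_ext :: "(complex \<Rightarrow> 'v \<Rightarrow> 'v) \<Rightarrow> (complex \<Rightarrow> 'w \<Rightarrow> 'w) \<Rightarrow> (nat \<Rightarrow> ('v::comm_monoid_add) mat set)
    \<Rightarrow> (nat \<Rightarrow> 'v mat \<Rightarrow> ('w::comm_monoid_add) mat) \<Rightarrow> nat \<Rightarrow> 'v mat \<Rightarrow> 'w mat" where
  "nc_ext sV sW \<Omega> f m B = (SOME W. \<exists>S T X. cinv_pair m S T \<and> X \<in> \<Omega> m \<and>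
      B = sandwich sV m S X T \<and> W = sandwich sW m S (f m X) T)"

text \<open>DeltaR^l f (X^0,...,X^l)(Z^1,...,Z^l), with ns = [n_0,...,n_l], Xs = [X^0,...,X^l],
  Zs = [Z^1,...,Z^l]: the (1, l+1) block of the nc extension applied to the bidiagonal matrix.\<close>
definition DeltaR :: "(complex \<Rightarrow> 'v \<Rightarrow> 'v) \<Rightarrow> (complex \<Rightarrow> 'w \<Rightarrow> 'w) \<Rightarrow> (nat \<Rightarrow> ('v::comm_monoid_add) mat set)
    \<Rightarrow> (nat \<Rightarrow> 'v mat \<Rightarrow> ('w::comm_monoid_add) mat) \<Rightarrow> nat list \<Rightarrow> 'v mat list \<Rightarrow> 'v mat list \<Rightarrow> 'w mat" where
  "DeltaR sV sW \<Omega> f ns Xs Zs =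
     (let m = sum_list ns; l = length ns - 1; B = nc_ext sV sW \<Omega> f m (bidiag ns Xs Zs) in
      (\<lambda>i j. if i < hd ns \<and> j < last ns then B i (j + offs ns l) else 0))"

end

theory Submission
  imports Defs
begin

text \<open>
  A nc function respects intertwinings: $XT = TX'$ implies $f(X)T = Tf(X')$. Applied to the amplifications
  $Y \otimes 1 + Z \otimes A$ with $A$ bidiagonal, this yields
  $f(Y+tZ) = \sum_{l<N} t^l \Delta_R^l f(Y,\dots,Y)(Z,\dots,Z) + t^N R_N(t)$, where $R_N(t)$ is a corner of $f$ on a
  slice of matrices of size $(N+1)n$ and hence bounded near $0$. For $N = 2$ this is differentiability along slices; the
  derivative is again a corner of $f$ on a slice, so slices are $C^1$, and Cauchy's formula for Banach space
  valued functions gives convergent Taylor series, whose coefficients are identified by uniqueness of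
  asymptotic expansions.

  For the uniform statements one needs $f$ to be continuous on finite-dimensional subspaces. Each
  $Z \mapsto \Delta_R^l f(Y,\dots,Y)(Z,\dots,Z)$ is entire and $O(|t|^l)$ on complex lines, hence separately
  polynomial and therefore continuous in finitely many coordinates. By Baire's theorem these homogeneous polynomials are
  uniformly geometrically bounded on some open set, and by the maximum principle near the origin.
\<close>

section \<open>Vector-valued Cauchy theory\<close>

text \<open>Two constraints shape the argument. The bidiagonal matrix with superdiagonal Z need not
  lie in \<Omega>; only direct sums of copies of Y do, together with what finite openness provides
  near them. So a small factor \<epsilon> is put in front of the superdiagonal and undone by a
  diagonal similarity, which multiplies the corner by \<epsilon>^(-l). Secondly, boundedness on
  slices is one-dimensional information: its radius and bound depend on the direction, and in the
  finite expansion the constants depend on N as well. Convergence therefore has to come from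
  Cauchy's estimates, and uniformity in the direction from category. Baire's theorem yields a bound
  about an uncontrolled centre only; homogeneity carries it to 0, because Delta(H + sA) = s^l
  Delta(A + H/s) exchanges the roles of centre and direction. All estimates are made entry by entry,
  which is legitimate since at each fixed size an admissible norm is equivalent to the sum of the
  entry norms.\<close>

locale cbanach =
  fixes s :: "complex \<Rightarrow> 'w::banach \<Rightarrow> 'w"
  assumes complex_banach: "complex_banach s"
begin

sublocale vector_space s
  using complex_banach by (simp add: complex_banach_def)

lemma scale_of_real: "s (complex_of_real r) x = r *\<^sub>R x"
  using complex_banach by (simp add: complex_banach_def)

lemma norm_scale [simp]: "norm (s c x) = cmod c * norm x"
  using complex_banach by (simp add: complex_banach_def)

sublocale sc: bounded_bilinear s
proof
  show "s (r *\<^sub>R a) b = r *\<^sub>R s a b" for r a b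
    by (metis scale_of_real scale_scale scaleR_conv_of_real)
  show "s a (r *\<^sub>R b) = r *\<^sub>R s a b" for r a b
    by (metis scale_of_real scale_left_commute)
  show "\<exists>K. \<forall>a b. norm (s a b) \<le> norm a * norm b * K"
    by (rule exI[of _ 1]) simp
qed (auto simp: scale_left_distrib scale_right_distrib)

section \<open>Continuously complex differentiable functions with values in a Banach space\<close>

text \<open>The derivative is the real Frechet derivative, required to be multiplication by the
  scalar h, which is complex differentiability for the explicit action \<open>s\<close>. Continuity
  of g' is part of the notion because the Cauchy argument differentiates under the integral
  sign.\<close>

definition C1_on :: "complex set \<Rightarrow> (complex \<Rightarrow> 'w) \<Rightarrow> bool" where
  "C1_on S g \<longleftrightarrow> (\<exists>g'. (\<forall>t\<in>S. (g has_derivative (\<lambda>h. s h (g' t))) (at t)) \<and> continuous_on S g')"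

lemma C1_on_imp_continuous_on: "C1_on S g \<Longrightarrow> continuous_on S g"
  unfolding C1_on_def continuous_on_eq_continuous_within
  by (blast intro: continuous_at_imp_continuous_at_within has_derivative_continuous)

lemma C1_on_subset: "C1_on S g \<Longrightarrow> T \<subseteq> S \<Longrightarrow> C1_on T g"
  unfolding C1_on_def by (meson continuous_on_subset subset_iff)

text \<open>Frechet derivatives are unique, and evaluating h \<mapsto> \<open>s h D\<close> at 1
  recovers D; hence the locally given derivatives agree and glue. This is needed because
  amplifications describe \<open>Delta\<close> only near one parameter at a time.\<close>

lemma C1_on_locally:
  assumes "\<And>t. t \<in> S \<Longrightarrow> \<exists>r>0. C1_on (ball t r) g"
  shows "C1_on S g"
proof -
  define g' where "g' t = (THE D. (g has_derivative (\<lambda>h. s h D)) (at t))" for t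
  have g'I: "g' t = D" if "(g has_derivative (\<lambda>h. s h D)) (at t)" for t D
    unfolding g'_def
  proof (rule the_equality)
    fix D' assume "(g has_derivative (\<lambda>h. s h D')) (at t)"
    then have "(\<lambda>h. s h D') = (\<lambda>h. s h D)"
      using that has_derivative_unique by blast
    then have "s 1 D' = s 1 D" by metis
    then show "D' = D" by simp
  qed fact
  show ?thesis
    unfolding C1_on_def
  proof (intro exI conjI ballI)
    show "(g has_derivative (\<lambda>h. s h (g' t))) (at t)" if "t \<in> S" for t
    proof -
      obtain r D where "r > 0" "\<forall>u\<in>ball t r. (g has_derivative (\<lambda>h. s h (D u))) (at u)"
        using assms[OF \<open>t \<in> S\<close>] unfolding C1_on_def by blast
      then have "(g has_derivative (\<lambda>h. s h (D t))) (at t)" by simp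
      with g'I[OF this] show ?thesis by simp
    qed
    show "continuous_on S g'"
      unfolding continuous_on_eq_continuous_within
    proof
      fix t assume "t \<in> S"
      then obtain r D where r: "r > 0" "\<And>u. u \<in> ball t r \<Longrightarrow> (g has_derivative (\<lambda>h. s h (D u))) (at u)"
        "continuous_on (ball t r) D"
        using assms[OF \<open>t \<in> S\<close>] unfolding C1_on_def by blast
      have "continuous_on (ball t r) g'"
        using r(3) by (rule continuous_on_eq) (rule g'I[symmetric, OF r(2)])
      then show "continuous (at t within S) g'"
        using \<open>r > 0\<close> by (metis centre_in_ball continuous_at_imp_continuous_within continuous_on_eq_continuous_at open_ball)
    qed
  qed
qed

lemma C1_on_cong:
  assumes "C1_on S g" "open S" "\<And>t. t \<in> S \<Longrightarrow> h t = g t"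
  shows "C1_on S h"
proof -
  obtain g' where g': "\<And>t. t\<in>S \<Longrightarrow> (g has_derivative (\<lambda>h. s h (g' t))) (at t)" "continuous_on S g'"
    using assms unfolding C1_on_def by blast
  have "(h has_derivative (\<lambda>h. s h (g' t))) (at t)" if "t \<in> S" for t
    by (rule has_derivative_transform_within_open[OF g'(1)[OF that] \<open>open S\<close> that]) (use assms in auto)
  then show ?thesis using g' unfolding C1_on_def by blast
qed

lemma C1_on_scale: "C1_on S g \<Longrightarrow> C1_on S (\<lambda>t. s c (g t))"
proof -
  assume "C1_on S g"
  then obtain g' where g': "\<And>t. t\<in>S \<Longrightarrow> (g has_derivative (\<lambda>h. s h (g' t))) (at t)" "continuous_on S g'"
    unfolding C1_on_def by blast
  have "((\<lambda>t. s c (g t)) has_derivative (\<lambda>h. s h (s c (g' t)))) (at t)" if "t \<in> S" for t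
    using sc.bounded_linear_right[of c, THEN bounded_linear.has_derivative, OF g'(1)[OF that]]
    by (simp add: mult.commute)
  then show ?thesis
    unfolding C1_on_def using g'(2)
    by (intro exI[of _ "\<lambda>t. s c (g' t)"]) (auto intro!: sc.continuous_on continuous_intros)
qed

section \<open>Cauchy's integral formula and coefficients on circles\<close>

text \<open>The circle is contracted radially onto z: F(u) integrates the kernel against g(z +
  u(\<gamma> - z)). In F'(u) the factor \<gamma> - z from the chain rule cancels the denominator of
  the kernel, and what remains is a \<theta>-derivative over a closed curve. So F is constant, and
  its values at u = 1 and u = 0 are the two sides.\<close>

lemma cauchy_deformation:
  fixes r R :: real
  defines "\<gamma> \<equiv> \<lambda>\<theta>. complex_of_real r * cis \<theta>"
  assumes C1: "C1_on (ball 0 R) g" and r: "0 < r" "r < R" and z: "cmod z < r"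
  shows "integral {0..2*pi} (\<lambda>\<theta>. s (\<gamma> \<theta> / (\<gamma> \<theta> - z)) (g (\<gamma> \<theta>)))
       = integral {0..2*pi} (\<lambda>\<theta>. s (\<gamma> \<theta> / (\<gamma> \<theta> - z)) (g z))"
proof -
  obtain g' where g': "\<And>t. t\<in>ball 0 R \<Longrightarrow> (g has_derivative (\<lambda>h. s h (g' t))) (at t)" "continuous_on (ball 0 R) g'"
    using C1 unfolding C1_on_def by blast
  have contg: "continuous_on (ball 0 R) g" by (rule C1_on_imp_continuous_on) fact
  have norm\<gamma>: "cmod (\<gamma> \<theta>) = r" for \<theta> using r by (simp add: \<gamma>_def norm_mult)
  have ne: "\<gamma> \<theta> \<noteq> z" for \<theta> using norm\<gamma>[of \<theta>] z by auto
  have cont\<gamma> [continuous_intros]: "continuous_on A (\<lambda>x. \<gamma> (h x))" if "continuous_on A h" for A and h :: "'b::topological_space \<Rightarrow> real"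
    unfolding \<gamma>_def by (intro continuous_intros that)
  have inb: "z + complex_of_real u * (\<gamma> \<theta> - z) \<in> ball 0 R" if "u \<in> {0..1}" for u \<theta>
  proof -
    have "z + complex_of_real u * (\<gamma> \<theta> - z) = complex_of_real (1-u) * z + complex_of_real u * \<gamma> \<theta>"
      by (simp add: algebra_simps)
    also have "cmod \<dots> \<le> (1-u) * cmod z + u * r"
      using that by (intro order.trans[OF norm_triangle_ineq]) (simp add: norm_mult norm\<gamma> del: of_real_diff)
    also have "\<dots> \<le> (1-u) * r + u * r" using that z by (intro add_mono mult_left_mono) auto
    also have "\<dots> < R" using r by (simp add: algebra_simps)
    finally show ?thesis by simp
  qed
  define F where "F u = integral (cbox 0 (2*pi)) (\<lambda>\<theta>. s (\<gamma> \<theta> / (\<gamma> \<theta> - z)) (g (z + complex_of_real u * (\<gamma> \<theta> - z))))" for u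
  have der: "(F has_vector_derivative integral (cbox 0 (2*pi)) (\<lambda>\<theta>. s (\<gamma> \<theta>) (g' (z + complex_of_real u * (\<gamma> \<theta> - z))))) (at u within {0..1})"
    if u: "u \<in> {0..1}" for u
    unfolding F_def
  proof (rule leibniz_rule_vector_derivative[OF _ _ _ u])
    fix x \<theta> assume x: "x \<in> {0..1::real}"
    have "((\<lambda>x. z + complex_of_real x * (\<gamma> \<theta> - z)) has_derivative (\<lambda>h. complex_of_real h * (\<gamma> \<theta> - z))) (at x within {0..1})"
      by (auto intro!: derivative_eq_intros)
    from has_derivative_compose[OF this g'(1)[OF inb[OF x]]]
    have "((\<lambda>x. g (z + complex_of_real x * (\<gamma> \<theta> - z))) has_derivative
       (\<lambda>h. s (complex_of_real h * (\<gamma> \<theta> - z)) (g' (z + complex_of_real x * (\<gamma> \<theta> - z))))) (at x within {0..1})" .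
    from sc.bounded_linear_right[THEN bounded_linear.has_derivative, OF this, of "\<gamma> \<theta> / (\<gamma> \<theta> - z)"]
    show "((\<lambda>x. s (\<gamma> \<theta> / (\<gamma> \<theta> - z)) (g (z + complex_of_real x * (\<gamma> \<theta> - z)))) has_vector_derivative
        s (\<gamma> \<theta>) (g' (z + complex_of_real x * (\<gamma> \<theta> - z)))) (at x within {0..1})"
      unfolding has_vector_derivative_def
      by (rule has_derivative_eq_rhs) (use ne in \<open>auto simp flip: scale_of_real\<close>)
  next
    fix x assume x: "x \<in> {0..1::real}"
    show "(\<lambda>\<theta>. s (\<gamma> \<theta> / (\<gamma> \<theta> - z)) (g (z + complex_of_real x * (\<gamma> \<theta> - z)))) integrable_on cbox 0 (2 * pi)"
      by (intro integrable_continuous sc.continuous_on continuous_on_compose2[OF contg] continuous_intros)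
         (use ne inb x in auto)
  next
    show "continuous_on ({0..1} \<times> cbox 0 (2 * pi)) (\<lambda>(x, \<theta>). s (\<gamma> \<theta>) (g' (z + complex_of_real x * (\<gamma> \<theta> - z))))"
      unfolding split_beta
      by (intro sc.continuous_on continuous_on_compose2[OF g'(2)] continuous_intros)
         (use ne inb in auto)
  qed auto
  \<comment> \<open>Since the derivative of \<gamma> is i times \<gamma>, the integrand is the
    \<theta>-derivative of g(z + u(\<gamma> - z)) / (iu). At u = 0 this primitive degenerates, but
    there g' is evaluated at the constant point z and \<gamma>/i serves instead.\<close>
  have zero: "integral (cbox 0 (2*pi)) (\<lambda>\<theta>. s (\<gamma> \<theta>) (g' (z + complex_of_real u * (\<gamma> \<theta> - z)))) = 0"
    if u: "u \<in> {0..1}" for u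
  proof -
    define h where "h \<theta> = (if u = 0 then s (\<gamma> \<theta>/\<i>) (g' z) else s (1 / (\<i> * u)) (g (z + complex_of_real u * (\<gamma> \<theta> - z))))" for \<theta>
    have "((\<lambda>\<theta>. s (\<gamma> \<theta>) (g' (z + complex_of_real u * (\<gamma> \<theta> - z)))) has_integral (h (2*pi) - h 0)) {0..2*pi}"
    proof (rule fundamental_theorem_of_calculus)
      fix \<theta> :: real
      have d\<gamma>: "(\<gamma> has_derivative (\<lambda>k. of_real k * (\<i> * \<gamma> \<theta>))) (at \<theta> within {0..2*pi})"
        unfolding \<gamma>_def by (auto intro!: derivative_eq_intros simp: scaleR_conv_of_real)
      show "(h has_vector_derivative s (\<gamma> \<theta>) (g' (z + complex_of_real u * (\<gamma> \<theta> - z)))) (at \<theta> within {0..2*pi})"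
      proof (cases "u = 0")
        case True
        have "((\<lambda>\<theta>. \<gamma> \<theta>/\<i>) has_derivative (\<lambda>k. of_real k * \<gamma> \<theta>)) (at \<theta> within {0..2*pi})"
          unfolding divide_inverse
          by (rule has_derivative_eq_rhs[OF has_derivative_mult_left[OF d\<gamma>]]) (auto simp: mult_ac)
        from sc.bounded_linear_left[THEN bounded_linear.has_derivative, OF this, of "g' z"]
        show ?thesis
          unfolding has_vector_derivative_def h_def using True
          by (auto simp flip: scale_of_real)
      next
        case False
        have "((\<lambda>\<theta>. z + complex_of_real u * (\<gamma> \<theta> - z)) has_derivative (\<lambda>k. u * (of_real k * (\<i> * \<gamma> \<theta>)))) (at \<theta> within {0..2*pi})"
          by (auto intro!: derivative_eq_intros d\<gamma>)
        from has_derivative_compose[OF this g'(1)[OF inb[OF u]]]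
        have "((\<lambda>\<theta>. g (z + complex_of_real u * (\<gamma> \<theta> - z))) has_derivative
          (\<lambda>k. s (u * (of_real k * (\<i> * \<gamma> \<theta>))) (g' (z + complex_of_real u * (\<gamma> \<theta> - z))))) (at \<theta> within {0..2*pi})" .
        from sc.bounded_linear_right[THEN bounded_linear.has_derivative, OF this, of "1/(\<i>*u)"]
        show ?thesis
          unfolding has_vector_derivative_def h_def using False
          by (auto simp: mult_ac simp flip: scale_of_real)
      qed
    qed auto
    moreover have "\<gamma> (2*pi) = \<gamma> 0" by (simp add: \<gamma>_def)
    ultimately show ?thesis by (auto simp: h_def dest!: integral_unique)
  qed
  have der0: "(F has_vector_derivative 0) (at u within {0..1})" if "u \<in> {0..1}" for u
    using der[OF that] zero[OF that] by simp
  obtain c where "\<And>u. u \<in> {0..1} \<Longrightarrow> F u = c"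
    using has_vector_derivative_zero_constant[of "{0..1::real}" F] der0 by auto
  then have "F 1 = F 0" by simp
  then show ?thesis by (simp add: F_def)
qed

text \<open>Truncated geometric expansion of the Cauchy kernel, with N kept finite so that the error
  is explicit. The factor \<phi> is arbitrary because it is used twice: constant, to evaluate the
  integral of the kernel, and as g on the circle, to produce Taylor coefficients.\<close>

lemma circle_geometric_remainder:
  fixes r :: real
  defines "\<gamma> \<equiv> \<lambda>\<theta>. complex_of_real r * cis \<theta>"
  assumes r: "0 < r" and z: "cmod z < r" and \<phi>: "continuous_on {0..2*pi} \<phi>"
    and M: "\<And>\<theta>. norm (\<phi> \<theta>) \<le> M"
  shows "norm (integral {0..2*pi} (\<lambda>\<theta>. s (\<gamma> \<theta> / (\<gamma> \<theta> - z)) (\<phi> \<theta>))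
       - (\<Sum>l<N. s (z^l) (integral {0..2*pi} (\<lambda>\<theta>. s (1 / \<gamma> \<theta> ^ l) (\<phi> \<theta>)))))
       \<le> 2*pi * (M * (cmod z / r)^N / (1 - cmod z / r))"
proof -
  have norm\<gamma>: "cmod (\<gamma> \<theta>) = r" for \<theta> using r by (simp add: \<gamma>_def norm_mult)
  have ne: "\<gamma> \<theta> \<noteq> z" "\<gamma> \<theta> \<noteq> 0" for \<theta> using norm\<gamma>[of \<theta>] z r by auto
  have cont\<gamma> [continuous_intros]: "continuous_on A \<gamma>" for A
    unfolding \<gamma>_def by (intro continuous_intros)
  have int: "(\<lambda>\<theta>. s (h \<theta>) (\<phi> \<theta>)) integrable_on {0..2*pi}" if "continuous_on {0..2*pi} h" for h
    by (intro integrable_continuous_real sc.continuous_on that \<phi>)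
  have "(\<Sum>l<N. s (z^l) (integral {0..2*pi} (\<lambda>\<theta>. s (1 / \<gamma> \<theta> ^ l) (\<phi> \<theta>))))
      = (\<Sum>l<N. integral {0..2*pi} (\<lambda>\<theta>. s (z^l) (s (1 / \<gamma> \<theta> ^ l) (\<phi> \<theta>))))"
    by (intro sum.cong refl, subst integral_linear[OF int sc.bounded_linear_right, symmetric])
       (use ne in \<open>auto intro!: continuous_intros simp: o_def\<close>)
  also have "\<dots> = integral {0..2*pi} (\<lambda>\<theta>. \<Sum>l<N. s (z^l) (s (1 / \<gamma> \<theta> ^ l) (\<phi> \<theta>)))"
    by (subst integral_sum) (use ne in \<open>auto intro!: int continuous_intros\<close>)
  also have "integral {0..2*pi} (\<lambda>\<theta>. s (\<gamma> \<theta> / (\<gamma> \<theta> - z)) (\<phi> \<theta>)) - \<dots>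
     = integral {0..2*pi} (\<lambda>\<theta>. s (\<gamma> \<theta> / (\<gamma> \<theta> - z)) (\<phi> \<theta>) - (\<Sum>l<N. s (z^l) (s (1 / \<gamma> \<theta> ^ l) (\<phi> \<theta>))))"
    by (subst integral_diff) (use ne in \<open>auto intro!: int integrable_sum continuous_intros\<close>)
  also have "\<dots> = integral {0..2*pi} (\<lambda>\<theta>. s ((z/\<gamma> \<theta>)^N * (\<gamma> \<theta> / (\<gamma> \<theta> - z))) (\<phi> \<theta>))"
  proof (rule integral_cong)
    fix \<theta>
    have "z / \<gamma> \<theta> \<noteq> 1" using ne[of \<theta>] by auto
    then have "(\<Sum>l<N. (z / \<gamma> \<theta>)^l) = ((z / \<gamma> \<theta>)^N - 1) / (z / \<gamma> \<theta> - 1)"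
      by (rule geometric_sum)
    also have "\<dots> = \<gamma> \<theta> / (\<gamma> \<theta> - z) - (z / \<gamma> \<theta>)^N * (\<gamma> \<theta> / (\<gamma> \<theta> - z))"
      using ne[of \<theta>] by (simp add: divide_simps) (simp add: algebra_simps)
    finally have "\<gamma> \<theta> / (\<gamma> \<theta> - z) = (\<Sum>l<N. (z / \<gamma> \<theta>)^l) + (z / \<gamma> \<theta>)^N * (\<gamma> \<theta> / (\<gamma> \<theta> - z))"
      by simp
    then have "s (\<gamma> \<theta> / (\<gamma> \<theta> - z)) (\<phi> \<theta>) = (\<Sum>l<N. s ((z / \<gamma> \<theta>)^l) (\<phi> \<theta>)) + s ((z / \<gamma> \<theta>)^N * (\<gamma> \<theta> / (\<gamma> \<theta> - z))) (\<phi> \<theta>)"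
      by (metis scale_left_distrib scale_sum_left)
    then show "s (\<gamma> \<theta> / (\<gamma> \<theta> - z)) (\<phi> \<theta>) - (\<Sum>l<N. s (z^l) (s (1 / \<gamma> \<theta> ^ l) (\<phi> \<theta>)))
       = s ((z/\<gamma> \<theta>)^N * (\<gamma> \<theta> / (\<gamma> \<theta> - z))) (\<phi> \<theta>)"
      by (simp add: power_divide)
  qed
  also have "norm \<dots> \<le> (M * (cmod z / r)^N / (1 - cmod z / r)) * (2*pi - 0)"
  proof (rule integral_bound)
    show "continuous_on {0..2 * pi} (\<lambda>\<theta>. s ((z/\<gamma> \<theta>)^N * (\<gamma> \<theta> / (\<gamma> \<theta> - z))) (\<phi> \<theta>))"
      by (intro sc.continuous_on \<phi> continuous_intros) (use ne in auto)
    fix \<theta>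
    have "r - cmod z \<le> cmod (\<gamma> \<theta> - z)" using norm_triangle_ineq2[of "\<gamma> \<theta>" z] norm\<gamma> by simp
    then have "r / cmod (\<gamma> \<theta> - z) \<le> r / (r - cmod z)" using z r by (intro divide_left_mono) (auto intro!: mult_pos_pos)
    also have "\<dots> = 1 / (1 - cmod z / r)" using r by (simp add: field_simps)
    finally have *: "r / cmod (\<gamma> \<theta> - z) \<le> 1 / (1 - cmod z / r)" .
    have "norm (s ((z/\<gamma> \<theta>)^N * (\<gamma> \<theta> / (\<gamma> \<theta> - z))) (\<phi> \<theta>)) = (cmod z / r)^N * (r / cmod (\<gamma> \<theta> - z)) * norm (\<phi> \<theta>)"
      by (simp add: norm_mult norm_power norm_divide norm\<gamma>)
    also have "\<dots> \<le> (cmod z / r)^N * (1 / (1 - cmod z / r)) * M"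
      using r z by (intro mult_mono * M order.refl) auto
    finally show "norm (s ((z/\<gamma> \<theta>)^N * (\<gamma> \<theta> / (\<gamma> \<theta> - z))) (\<phi> \<theta>)) \<le> M * (cmod z / r)^N / (1 - cmod z / r)"
      by (simp add: mult_ac)
  qed auto
  finally show ?thesis by (simp add: mult_ac)
qed


lemma integral_inverse_circle_power:
  fixes r :: real
  assumes r: "0 < r"
  shows "integral {0..2*pi} (\<lambda>\<theta>. s (1 / (complex_of_real r * cis \<theta>) ^ l) w) = (if l = 0 then (2*pi) *\<^sub>R w else 0)"
proof (cases "l = 0")
  case False
  have eq: "1 / (complex_of_real r * cis \<theta>) ^ l = complex_of_real (1 / r^l) * cis (- (real l * \<theta>))" for \<theta>
    using r by (simp add: power_mult_distrib Complex.DeMoivre divide_simps cis_mult)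
  \<comment> \<open>Since (-il)(i/l) = 1, the factor i/l turns the exponential into a primitive of
    the integrand.\<close>
  define h where "h \<theta> = s (complex_of_real (1 / r^l) * cis (- (real l * \<theta>)) * (\<i> / of_nat l)) w" for \<theta>
  have "((\<lambda>\<theta>. s (1 / (complex_of_real r * cis \<theta>) ^ l) w) has_integral (h (2*pi) - h 0)) {0..2*pi}"
  proof (rule fundamental_theorem_of_calculus)
    fix \<theta> :: real
    have "((\<lambda>\<theta>. complex_of_real (1 / r^l) * cis (- (real l * \<theta>)) * (\<i> / of_nat l)) has_derivative
       (\<lambda>k. of_real k * (1 / (complex_of_real r * cis \<theta>) ^ l))) (at \<theta> within {0..2*pi})"
      unfolding eq
      by (rule has_derivative_eq_rhs[OF has_derivative_mult_left[OF has_derivative_mult_right[OF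
           has_derivative_cis[where d = "\<lambda>k. - (real l * k)"]]]])
         (use False in \<open>auto intro!: derivative_eq_intros ext simp: scaleR_conv_of_real mult_ac\<close>)
    from sc.bounded_linear_left[THEN bounded_linear.has_derivative, OF this, of w]
    show "(h has_vector_derivative s (1 / (complex_of_real r * cis \<theta>) ^ l) w) (at \<theta> within {0..2*pi})"
      unfolding has_vector_derivative_def h_def by (simp flip: scale_of_real)
  qed auto
  moreover have "cis (- (real l * (2*pi))) = 1"
    using cis_multiple_2pi[of "- real l"] by (simp add: mult_ac)
  ultimately show ?thesis using False by (auto simp: h_def dest!: integral_unique)
qed auto

text \<open>After deformation only the constant g z stands under the integral. In the geometric
  expansion of the kernel every power l > 0 integrates to zero over the circle, the term l = 0 gives
  2\<pi>, and the remainder vanishes as N grows.\<close>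

lemma cauchy_integral_circle:
  fixes r R :: real
  defines "\<gamma> \<equiv> \<lambda>\<theta>. complex_of_real r * cis \<theta>"
  assumes C1: "C1_on (ball 0 R) g" and r: "0 < r" "r < R" and z: "cmod z < r"
  shows "integral {0..2*pi} (\<lambda>\<theta>. s (\<gamma> \<theta> / (\<gamma> \<theta> - z)) (g (\<gamma> \<theta>))) = (2*pi) *\<^sub>R g z"
proof -
  let ?I = "integral {0..2*pi} (\<lambda>\<theta>. s (\<gamma> \<theta> / (\<gamma> \<theta> - z)) (g z))"
  have bd: "norm (?I - (2*pi) *\<^sub>R g z) \<le> 2*pi * (norm (g z) * (cmod z / r)^Suc N / (1 - cmod z / r))" for N
  proof -
    have "(\<Sum>l<Suc N. s (z^l) (integral {0..2*pi} (\<lambda>\<theta>. s (1 / \<gamma> \<theta> ^ l) (g z)))) = (2*pi) *\<^sub>R g z"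
      unfolding \<gamma>_def integral_inverse_circle_power[OF r(1)]
      by (simp only: sum.lessThan_Suc_shift) simp
    then show ?thesis
      using circle_geometric_remainder[OF r(1) z, of "\<lambda>_. g z" "norm (g z)" "Suc N"]
      by (simp add: \<gamma>_def)
  qed
  have "(\<lambda>N. 2*pi * (norm (g z) * (cmod z / r)^Suc N / (1 - cmod z / r))) \<longlonglongrightarrow> 2*pi * (norm (g z) * 0 / (1 - cmod z / r))"
    by (intro tendsto_intros LIMSEQ_Suc[OF LIMSEQ_power_zero]) (use r z in auto)
  then have "norm (?I - (2*pi) *\<^sub>R g z) \<le> 0"
    using bd by (intro LIMSEQ_le_const[where X = "\<lambda>N. 2*pi * (norm (g z) * (cmod z / r)^Suc N / (1 - cmod z / r))"]) auto
  then show ?thesis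
    using cauchy_deformation[OF C1 r z] by (simp add: \<gamma>_def)
qed

text \<open>The coefficients are Cauchy integrals over the circle of radius r, so at this stage they
  might depend on r; independence comes from uniqueness of asymptotic expansions.\<close>

lemma cauchy_coefficients:
  fixes r R :: real
  assumes C1: "C1_on (ball 0 R) g" and r: "0 < r" "r < R"
    and M: "\<And>t. cmod t = r \<Longrightarrow> norm (g t) \<le> M"
  shows "\<exists>a. (\<forall>l. norm (a l) \<le> M / r^l) \<and>
    (\<forall>z N. cmod z < r \<longrightarrow> norm (g z - (\<Sum>l<N. s (z^l) (a l))) \<le> M * (cmod z / r)^N / (1 - cmod z / r))"
proof -
  define \<gamma> where "\<gamma> = (\<lambda>\<theta>. complex_of_real r * cis \<theta>)"
  define a where "a l = (1/(2*pi)) *\<^sub>R integral {0..2*pi} (\<lambda>\<theta>. s (1 / \<gamma> \<theta> ^ l) (g (\<gamma> \<theta>)))" for l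
  have norm\<gamma>: "cmod (\<gamma> \<theta>) = r" for \<theta> using r by (simp add: \<gamma>_def norm_mult)
  have ne: "\<gamma> \<theta> \<noteq> 0" for \<theta> using norm\<gamma>[of \<theta>] r by auto
  have cont\<gamma>: "continuous_on {0..2*pi} \<gamma>" unfolding \<gamma>_def by (intro continuous_intros)
  have contg: "continuous_on {0..2*pi} (\<lambda>\<theta>. g (\<gamma> \<theta>))"
    by (rule continuous_on_compose2[OF C1_on_imp_continuous_on[OF C1] cont\<gamma>]) (use norm\<gamma> r in auto)
  have "norm (a l) \<le> M / r^l" for l
  proof -
    have "norm (integral {0..2*pi} (\<lambda>\<theta>. s (1 / \<gamma> \<theta> ^ l) (g (\<gamma> \<theta>)))) \<le> (M / r^l) * (2*pi - 0)"
      by (intro integral_bound sc.continuous_on contg continuous_intros cont\<gamma>)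
         (use ne M r in \<open>auto simp: norm\<gamma> norm_divide norm_power divide_right_mono\<close>)
    then show ?thesis by (simp add: a_def field_simps)
  qed
  moreover have "norm (g z - (\<Sum>l<N. s (z^l) (a l))) \<le> M * (cmod z / r)^N / (1 - cmod z / r)"
    if z: "cmod z < r" for z N
  proof -
    have "(2*pi) *\<^sub>R (\<Sum>l<N. s (z^l) (a l)) = (\<Sum>l<N. s (z^l) (integral {0..2*pi} (\<lambda>\<theta>. s (1 / \<gamma> \<theta> ^ l) (g (\<gamma> \<theta>)))))"
      unfolding scaleR_sum_right a_def by (intro sum.cong refl) (simp add: sc.scaleR_right)
    moreover have "norm (integral {0..2*pi} (\<lambda>\<theta>. s (\<gamma> \<theta> / (\<gamma> \<theta> - z)) (g (\<gamma> \<theta>)))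
       - (\<Sum>l<N. s (z^l) (integral {0..2*pi} (\<lambda>\<theta>. s (1 / \<gamma> \<theta> ^ l) (g (\<gamma> \<theta>))))))
       \<le> 2*pi * (M * (cmod z / r)^N / (1 - cmod z / r))"
      unfolding \<gamma>_def
      by (rule circle_geometric_remainder[OF r(1) z contg[unfolded \<gamma>_def]])
         (use M norm\<gamma> in \<open>auto simp: \<gamma>_def\<close>)
    ultimately have "norm ((2*pi) *\<^sub>R g z - (2*pi) *\<^sub>R (\<Sum>l<N. s (z^l) (a l))) \<le> 2*pi * (M * (cmod z / r)^N / (1 - cmod z / r))"
      using cauchy_integral_circle[OF C1 r z] by (simp add: \<gamma>_def)
    then have "2*pi * norm (g z - (\<Sum>l<N. s (z^l) (a l))) \<le> 2*pi * (M * (cmod z / r)^N / (1 - cmod z / r))"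
      by (simp flip: scaleR_diff_right)
    then show ?thesis by (rule mult_left_le_imp_le) simp
  qed
  ultimately show ?thesis by blast
qed

section \<open>Asymptotic expansions and Taylor coefficients\<close>

text \<open>Taylor coefficients without derivatives or convergence: bound and radius may depend on
  N. This is exactly what intertwining yields for the higher order operators, and it still
  determines the coefficients.\<close>

definition asymptotic_expansion :: "(complex \<Rightarrow> 'w) \<Rightarrow> (nat \<Rightarrow> 'w) \<Rightarrow> bool" where
  "asymptotic_expansion g p \<longleftrightarrow>
    (\<forall>N. \<exists>M r. r > 0 \<and> (\<forall>t. cmod t < r \<longrightarrow> norm (g t - (\<Sum>l<N. s (t^l) (p l))) \<le> M * cmod t ^ N))"

text \<open>Once the coefficients below n agree, the two truncations at order \<open>Suc n\<close>
  differ by t^n (p n - q n), which is also O(t^(n+1)). Dividing by t^n and letting a positive real t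
  tend to 0 gives p n = q n.\<close>

lemma asymptotic_expansion_unique:
  assumes p: "asymptotic_expansion g p" and q: "asymptotic_expansion g q"
  shows "p = q"
proof
  fix n show "p n = q n"
  proof (induction n rule: less_induct)
    case (less n)
    obtain M r where M: "r > 0" "\<And>t. cmod t < r \<Longrightarrow> norm (g t - (\<Sum>l<Suc n. s (t^l) (p l))) \<le> M * cmod t ^ Suc n"
      using p unfolding asymptotic_expansion_def by metis
    obtain M' r' where M': "r' > 0" "\<And>t. cmod t < r' \<Longrightarrow> norm (g t - (\<Sum>l<Suc n. s (t^l) (q l))) \<le> M' * cmod t ^ Suc n"
      using q unfolding asymptotic_expansion_def by metis
    have bd: "norm (p n - q n) \<le> (M + M') * x" if x: "0 < x" "x < min r r'" for x :: real
    proof -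
      let ?t = "complex_of_real x"
      have ct: "cmod ?t = x" using x by simp
      have key: "(x - B) - (x - A) = A - B" for x A B :: 'w by simp
      have "(\<Sum>l<Suc n. s (?t^l) (p l)) - (\<Sum>l<Suc n. s (?t^l) (q l)) = s (?t^n) (p n - q n)"
        using less by (simp add: scale_right_diff_distrib)
      then have "s (?t^n) (p n - q n) = (g ?t - (\<Sum>l<Suc n. s (?t^l) (q l))) - (g ?t - (\<Sum>l<Suc n. s (?t^l) (p l)))"
        by (simp only: key)
      then have "norm (s (?t^n) (p n - q n)) = norm ((g ?t - (\<Sum>l<Suc n. s (?t^l) (q l))) - (g ?t - (\<Sum>l<Suc n. s (?t^l) (p l))))"
        by (rule arg_cong)
      moreover have "norm (s (?t^n) (p n - q n)) = x^n * norm (p n - q n)" using x by (simp add: norm_power)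
      ultimately have "x^n * norm (p n - q n) = norm ((g ?t - (\<Sum>l<Suc n. s (?t^l) (q l))) - (g ?t - (\<Sum>l<Suc n. s (?t^l) (p l))))"
        by simp
      also have "\<dots> \<le> M' * x ^ Suc n + M * x ^ Suc n"
        using M(2)[of ?t] M'(2)[of ?t] x unfolding ct
        by (intro order.trans[OF norm_triangle_ineq4 add_mono]) (simp_all only: min_less_iff_conj)
      finally have "x^n * norm (p n - q n) \<le> x^n * ((M + M') * x)" by (simp add: algebra_simps)
      then show ?thesis using x by (simp add: mult_le_cancel_left_pos)
    qed
    have "norm (p n - q n) \<le> 0"
    proof (rule tendsto_le[OF _ _ tendsto_const])
      show "((\<lambda>x. (M + M') * x) \<longlongrightarrow> 0) (at_right (0::real))"
        by (auto intro!: tendsto_eq_intros)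
      show "\<forall>\<^sub>F x in at_right 0. norm (p n - q n) \<le> (M + M') * x"
        unfolding eventually_at_right_field using bd M(1) M'(1) by (intro exI[of _ "min r r'"]) auto
    qed simp
    then show ?case by simp
  qed
qed

lemma asymptotic_expansionI:
  assumes "0 < r"
    "\<And>z N. cmod z < r \<Longrightarrow> norm (g z - (\<Sum>l<N. s (z^l) (a l))) \<le> M * (cmod z / r)^N / (1 - cmod z / r)"
  shows "asymptotic_expansion g a"
  unfolding asymptotic_expansion_def
proof
  fix N
  have "norm (g t - (\<Sum>l<N. s (t^l) (a l))) \<le> (2 * \<bar>M\<bar> / r^N) * cmod t ^ N" if "cmod t < r/2" for t
  proof -
    have "M * (cmod t / r)^N / (1 - cmod t / r) \<le> \<bar>M\<bar> * (cmod t / r)^N / (1/2)"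
      using that assms(1) by (intro frac_le mult_right_mono) (auto simp: field_simps)
    with assms(2)[of t N] that assms(1) have "norm (g t - (\<Sum>l<N. s (t^l) (a l))) \<le> \<bar>M\<bar> * (cmod t / r)^N / (1/2)"
      by simp
    then show ?thesis by (simp add: power_divide mult_ac)
  qed
  then show "\<exists>M r. r > 0 \<and> (\<forall>t. cmod t < r \<longrightarrow> norm (g t - (\<Sum>l<N. s (t^l) (a l))) \<le> M * cmod t ^ N)"
    using assms(1) by (intro exI[of _ "2 * \<bar>M\<bar> / r^N"] exI[of _ "r/2"]) auto
qed

lemma bounded_on_circle:
  assumes "C1_on (ball 0 R) g" "0 < r" "r < R"
  shows "\<exists>M. \<forall>t. cmod t = r \<longrightarrow> norm (g t) \<le> M"
proof -
  have "compact (g ` sphere 0 r)"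
    using assms by (intro compact_continuous_image continuous_on_subset[OF C1_on_imp_continuous_on[OF assms(1)]]) auto
  then obtain M where "\<forall>x\<in>g ` sphere 0 r. norm x \<le> M"
    using compact_imp_bounded bounded_iff by metis
  then have "norm (g t) \<le> M" if "cmod t = r" for t using that by simp
  then show ?thesis by blast
qed

lemma C1_on_asymptotic_expansion_exists:
  assumes "C1_on (ball 0 R) g" "0 < R"
  shows "\<exists>p. asymptotic_expansion g p"
proof -
  obtain M where "\<And>t. cmod t = R/2 \<Longrightarrow> norm (g t) \<le> M"
    using bounded_on_circle[OF assms(1), of "R/2"] assms(2) by auto
  with cauchy_coefficients[OF assms(1), of "R/2" M] assms(2)
  have "\<exists>a. (\<forall>l. norm (a l) \<le> M / (R/2)^l) \<and> (\<forall>z N. cmod z < R/2 \<longrightarrow>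
     norm (g z - (\<Sum>l<N. s (z^l) (a l))) \<le> M * (cmod z / (R/2))^N / (1 - cmod z / (R/2)))"
    by simp
  then obtain a where "\<And>z N. cmod z < R/2 \<Longrightarrow> norm (g z - (\<Sum>l<N. s (z^l) (a l))) \<le> M * (cmod z / (R/2))^N / (1 - cmod z / (R/2))"
    by blast
  from asymptotic_expansionI[OF _ this] assms(2) show ?thesis by auto
qed

text \<open>By uniqueness the given p coincides with the Cauchy integrals over this particular
  circle. Hence one and the same sequence satisfies the estimates for every radius r < R.\<close>

lemma cauchy_taylor:
  fixes r R :: real
  assumes C1: "C1_on (ball 0 R) g" and p: "asymptotic_expansion g p" and r: "0 < r" "r < R"
    and M: "\<And>t. cmod t = r \<Longrightarrow> norm (g t) \<le> M"
  shows cauchy_estimate: "norm (p l) \<le> M / r^l"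
    and taylor_remainder: "cmod z < r \<Longrightarrow> norm (g z - (\<Sum>l<N. s (z^l) (p l))) \<le> M * (cmod z / r)^N / (1 - cmod z / r)"
proof -
  obtain a where a: "\<And>l. norm (a l) \<le> M / r^l"
    "\<And>z N. cmod z < r \<Longrightarrow> norm (g z - (\<Sum>l<N. s (z^l) (a l))) \<le> M * (cmod z / r)^N / (1 - cmod z / r)"
    using cauchy_coefficients[OF C1 r M] by auto
  have "p = a"
    by (rule asymptotic_expansion_unique[OF p asymptotic_expansionI[OF r(1) a(2)]])
  with a show "norm (p l) \<le> M / r^l"
    "cmod z < r \<Longrightarrow> norm (g z - (\<Sum>l<N. s (z^l) (p l))) \<le> M * (cmod z / r)^N / (1 - cmod z / r)"
    by auto
qed


section \<open>Power series with Banach space coefficients\<close>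

text \<open>Cauchy-type bounds at every radius below r, with a constant depending on the radius. In
  this form the condition is stable under formal differentiation.\<close>

definition geom_bounded :: "real \<Rightarrow> (nat \<Rightarrow> 'w) \<Rightarrow> bool" where
  "geom_bounded r a \<longleftrightarrow> (\<forall>q. 0 < q \<longrightarrow> q < r \<longrightarrow> (\<exists>M. \<forall>l. norm (a l) \<le> M / q^l))"

definition psum :: "(nat \<Rightarrow> 'w) \<Rightarrow> complex \<Rightarrow> 'w" where
  "psum a z = (\<Sum>l. s (z^l) (a l))"

definition dcoeff :: "(nat \<Rightarrow> 'w) \<Rightarrow> nat \<Rightarrow> 'w" where
  "dcoeff a l = s (of_nat (Suc l)) (a (Suc l))"

text \<open>The rising factorial (l+1)...(l+k) from k-fold formal differentiation becomes k! at l =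
  0, which is where the factorial in the N-th derivative comes from.\<close>

lemma dcoeff_iterate: "(dcoeff ^^ k) a l = s (pochhammer (of_nat (Suc l)) k) (a (l + k))"
proof (induction k arbitrary: l)
  case (Suc k)
  have "(dcoeff ^^ Suc k) a l = s (of_nat (Suc l) * pochhammer (of_nat (Suc l) + 1) k) (a (Suc l + k))"
  proof -
    have "(dcoeff ^^ Suc k) a l = s (of_nat (Suc l)) ((dcoeff ^^ k) a (Suc l))"
      by (simp add: dcoeff_def[of "(dcoeff ^^ k) a"] del: of_nat_Suc)
    also have "\<dots> = s (of_nat (Suc l) * pochhammer (of_nat (Suc l) + 1) k) (a (Suc l + k))"
      by (simp add: Suc add.commute)
    finally show ?thesis .
  qed
  then show ?case by (simp add: pochhammer_rec)
qed simp

lemma geom_bounded_dcoeff: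
  assumes "geom_bounded r a"
  shows "geom_bounded r (dcoeff a)"
  unfolding geom_bounded_def
proof (intro allI impI)
  fix q' :: real assume q': "0 < q'" "q' < r"
  obtain q where q: "q' < q" "q < r" using q' dense by blast
  obtain M where M: "\<And>l. norm (a l) \<le> M / q^l" using assms q q' unfolding geom_bounded_def by (meson order_less_trans)
  define x where "x = q'/q"
  have x: "0 \<le> x" "x < 1" using q q' by (auto simp: x_def)
  \<comment> \<open>One term of a nonnegative series is at most its sum, here the differentiated
    geometric series. The linear factor is thus absorbed by passing from radius q to q'.\<close>
  have le: "real (Suc l) * x^l \<le> 1 / (1-x)^2" for l
  proof -
    have "(\<lambda>n. real (Suc n) * x ^ n) sums (1 / (1 - x)^2)"
      using geometric_deriv_sums[of x] x by simp
    then show ?thesis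
      using sum_le_suminf[of "\<lambda>n. real (Suc n) * x ^ n" "{l}"] x by (auto simp: sums_iff)
  qed
  have "0 \<le> M" using order.trans[OF norm_ge_zero M[of 0]] by simp
  have "norm (dcoeff a l) \<le> (M / q * (1 / (1-x)^2)) / q'^l" for l
  proof -
    have "norm (dcoeff a l) \<le> real (Suc l) * (M / q^Suc l)"
      using M[of "Suc l"] unfolding dcoeff_def norm_scale by (intro mult_mono) (auto simp del: of_nat_Suc)
    also have "\<dots> = (M / q) * (real (Suc l) * x^l) / q'^l"
      using q q' by (simp add: x_def power_divide field_simps)
    also have "\<dots> \<le> (M / q * (1 / (1-x)^2)) / q'^l"
      using le[of l] q q' \<open>0 \<le> M\<close> by (intro divide_right_mono mult_left_mono) auto
    finally show ?thesis .
  qed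
  then show "\<exists>M. \<forall>l. norm (dcoeff a l) \<le> M / q'^l" by blast
qed

text \<open>Termwise differentiation: on the disc of radius q the differentiated series is dominated
  by a geometric series of ratio q/q', with q' strictly between q and r.\<close>

lemma psum_has_derivative:
  assumes a: "geom_bounded r a" and z: "cmod z < r"
  shows "(psum a has_derivative (\<lambda>h. s h (psum (dcoeff a) z))) (at z)"
proof -
  obtain q where q: "cmod z < q" "q < r" using z dense by blast
  obtain q' where q': "q < q'" "q' < r" using q dense by blast
  have "0 < q" using q norm_ge_zero[of z] by linarith
  then obtain M where M: "\<And>l. norm (dcoeff a l) \<le> M / q'^l"
    using geom_bounded_dcoeff[OF a] q' unfolding geom_bounded_def by (meson order_less_trans)
  let ?S = "ball (0::complex) q"
  have unif: "uniform_limit ?S (\<lambda>n x. \<Sum>l<n. s (x^l) (dcoeff a l)) (\<lambda>x. psum (dcoeff a) x) sequentially"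
    unfolding psum_def
  proof (rule Weierstrass_m_test[where M = "\<lambda>l. M * (q / q')^l"])
    show "summable (\<lambda>l. M * (q / q')^l)" using q' \<open>0 < q\<close> by (intro summable_mult summable_geometric) auto
    fix l x assume x: "x \<in> ?S"
    have "norm (s (x^l) (dcoeff a l)) = cmod x ^ l * norm (dcoeff a l)" by (simp add: norm_power)
    also have "\<dots> \<le> q^l * (M / q'^l)"
      using x M[of l] \<open>0 < q\<close> by (intro mult_mono power_mono) auto
    finally show "norm (s (x^l) (dcoeff a l)) \<le> M * (q / q')^l" by (simp add: power_divide mult_ac)
  qed
  \<comment> \<open>The constant term is left out, so that the n-th derivative is x^n times
    \<open>dcoeff a n\<close> without an index shift; it is added back at the end.\<close>
  have "\<exists>g. \<forall>x\<in>?S. (\<lambda>n. s (x^Suc n) (a (Suc n))) sums (g x) \<and>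
     (g has_derivative (\<lambda>h. s h (psum (dcoeff a) x))) (at x within ?S)"
  proof (rule has_derivative_series)
    show "convex ?S" by simp
    fix n and x :: complex
    have "((\<lambda>x. x^Suc n) has_derivative (\<lambda>h. of_nat (Suc n) * h * x^n)) (at x within ?S)"
      by (rule has_derivative_eq_rhs[OF has_derivative_power[OF has_derivative_ident]]) (auto simp: mult_ac)
    from sc.bounded_linear_left[THEN bounded_linear.has_derivative, OF this, of "a (Suc n)"]
    show "((\<lambda>x. s (x^Suc n) (a (Suc n))) has_derivative (\<lambda>h. s h (s (x^n) (dcoeff a n)))) (at x within ?S)"
      by (rule has_derivative_eq_rhs) (simp add: dcoeff_def mult_ac del: of_nat_Suc)
  next
    fix e :: real assume "e > 0"
    from uniform_limitD[OF unif this]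
    show "\<forall>\<^sub>F n in sequentially. \<forall>x\<in>?S. \<forall>h. norm ((\<Sum>i<n. s h (s (x^i) (dcoeff a i))) - s h (psum (dcoeff a) x)) \<le> e * norm h"
    proof eventually_elim
      case (elim n)
      show ?case
      proof (intro ballI allI)
        fix x h :: complex assume "x \<in> ?S"
        have "norm ((\<Sum>i<n. s h (s (x^i) (dcoeff a i))) - s h (psum (dcoeff a) x)) = norm h * norm ((\<Sum>i<n. s (x^i) (dcoeff a i)) - psum (dcoeff a) x)"
          by (simp only: flip: scale_sum_right scale_right_diff_distrib norm_scale)
        also have "\<dots> \<le> norm h * e" using elim \<open>x \<in> ?S\<close> by (intro mult_left_mono) (auto simp: dist_norm less_imp_le)
        finally show "norm ((\<Sum>i<n. s h (s (x^i) (dcoeff a i))) - s h (psum (dcoeff a) x)) \<le> e * norm h"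
          by (simp add: mult_ac)
      qed
    qed
  next
    show "0 \<in> ?S" using \<open>0 < q\<close> by simp
    show "(\<lambda>n. s (0^Suc n) (a (Suc n))) sums 0" by simp
  qed
  then obtain g where g: "\<And>x. x \<in> ?S \<Longrightarrow> (\<lambda>n. s (x^Suc n) (a (Suc n))) sums (g x)"
     "\<And>x. x \<in> ?S \<Longrightarrow> (g has_derivative (\<lambda>h. s h (psum (dcoeff a) x))) (at x within ?S)" by blast
  have zS: "z \<in> ?S" using q by simp
  have "((\<lambda>x. g x + a 0) has_derivative (\<lambda>h. s h (psum (dcoeff a) z))) (at z)"
    using has_derivative_add[OF g(2)[OF zS] has_derivative_const, of "a 0"] zS by (simp add: at_within_open[OF zS])
  then show ?thesis
  proof (rule has_derivative_transform_within_open[OF _ _ zS])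
    show "open ?S" by simp
    fix x assume "x \<in> ?S"
    then have "(\<lambda>n. s (x^n) (a n)) sums (g x + s (x^0) (a 0))"
      using g(1) by (subst (asm) sums_Suc_iff) auto
    then show "g x + a 0 = psum a x" by (simp add: psum_def sums_iff)
  qed
qed

end

section \<open>Admissible matrix norms and intertwining\<close>

lemma mat_dim_add: "X \<in> mat_dim p q \<Longrightarrow> Y \<in> mat_dim p q \<Longrightarrow> X + Y \<in> mat_dim p (q::nat)"
  for X Y :: "('a::monoid_add) mat"
  by (simp add: mat_dim_def)

lemma mat_dim_zero: "0 \<in> mat_dim p q"
  by (simp add: mat_dim_def)

lemma mat_dim_diff: "X \<in> mat_dim p q \<Longrightarrow> Y \<in> mat_dim p q \<Longrightarrow> X - Y \<in> mat_dim p (q::nat)"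
  for X Y :: "('a::group_add) mat"
  by (simp add: mat_dim_def)

lemma mat_dim_sum: "(\<And>i. i \<in> I \<Longrightarrow> X i \<in> mat_dim p q) \<Longrightarrow> sum X I \<in> mat_dim p q"
  for X :: "'i \<Rightarrow> ('a::comm_monoid_add) mat"
  by (induction I rule: infinite_finite_induct) (auto intro: mat_dim_add mat_dim_zero)

lemma sum_fun_apply2: "(sum X I) i j = (\<Sum>a\<in>I. X a i j)"
  for X :: "'i \<Rightarrow> ('a::comm_monoid_add) mat"
  by (induction I rule: infinite_finite_induct) auto

lemma mat_dim_mscale: "vector_space s \<Longrightarrow> X \<in> mat_dim p q \<Longrightarrow> mscale s c X \<in> mat_dim p q"
  for s :: "complex \<Rightarrow> 'v::ab_group_add \<Rightarrow> 'v"
proof -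
  assume "vector_space s" and X: "X \<in> mat_dim p q"
  then interpret vector_space s by simp
  show ?thesis using X by (simp add: mat_dim_def mscale_def)
qed

section \<open>Matrix units and entrywise equivalence of the norms\<close>

definition munit :: "nat \<Rightarrow> nat \<Rightarrow> complex mat" where
  "munit a b = (\<lambda>i j. if i = a \<and> j = b then 1 else 0)"

definition single :: "nat \<Rightarrow> nat \<Rightarrow> 'a \<Rightarrow> ('a::zero) mat" where
  "single a b w = (\<lambda>i j. if i = a \<and> j = b then w else 0)"

lemma munit_mat_dim: "a < n \<Longrightarrow> b < n \<Longrightarrow> munit a b \<in> mat_dim n n"
  by (auto simp: munit_def mat_dim_def)

lemma single_mat_dim: "a < n \<Longrightarrow> b < n \<Longrightarrow> single a b w \<in> mat_dim n n"
  by (auto simp: single_def mat_dim_def)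

lemma cop_norm_munit:
  assumes "a < n" "b < n"
  shows "0 \<le> cop_norm n (munit a b)" "cop_norm n (munit a b) \<le> 1"
proof -
  let ?A = "{sqrt (\<Sum>i<n. (cmod (\<Sum>k<n. munit a b i k * v k))\<^sup>2) | v. (\<Sum>k<n. (cmod (v k))\<^sup>2) \<le> 1}"
  have val: "(\<Sum>i<n. (cmod (\<Sum>k<n. munit a b i k * v k))\<^sup>2) = (cmod (v b))\<^sup>2" for v
  proof -
    have "(\<Sum>k<n. munit a b i k * v k) = (if i = a then v b else 0)" for i
    proof -
      have "(\<Sum>k<n. munit a b i k * v k) = (\<Sum>k<n. if k = b then (if i = a then v b else 0) else 0)"
        by (intro sum.cong) (auto simp: munit_def)
      then show ?thesis using assms by simp
    qed
    then have "(\<Sum>i<n. (cmod (\<Sum>k<n. munit a b i k * v k))\<^sup>2) = (\<Sum>i<n. if i = a then (cmod (v b))\<^sup>2 else 0)"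
      by (intro sum.cong) auto
    then show ?thesis using assms by simp
  qed
  have le1: "x \<le> 1" if "x \<in> ?A" for x
  proof -
    obtain v where v: "x = sqrt ((cmod (v b))\<^sup>2)" "(\<Sum>k<n. (cmod (v k))\<^sup>2) \<le> 1"
      using \<open>x \<in> ?A\<close> unfolding val by auto
    have "(cmod (v b))\<^sup>2 \<le> (\<Sum>k<n. (cmod (v k))\<^sup>2)"
      by (rule member_le_sum) (use assms in auto)
    with v(2) have "(cmod (v b))\<^sup>2 \<le> 1" by linarith
    then show ?thesis using v(1) by (simp add: abs_square_le_1)
  qed
  have 0: "0 \<in> ?A" by (auto intro!: exI[of _ "\<lambda>_. 0"])
  show "0 \<le> cop_norm n (munit a b)"
    unfolding cop_norm_def by (rule cSup_upper[OF 0]) (use le1 in \<open>auto intro!: bdd_aboveI\<close>)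
  show "cop_norm n (munit a b) \<le> 1"
    unfolding cop_norm_def by (rule cSup_least[OF _ le1]) (use 0 in blast)
qed

text \<open>Multiplying by matrix units on both sides isolates one entry of X and moves it to any
  chosen position. The sandwich inequality thereby compares a matrix with its individual
  entries.\<close>

lemma sandwich_munit:
  fixes s :: "complex \<Rightarrow> 'v::ab_group_add \<Rightarrow> 'v"
  assumes "vector_space s" "i < n" "j < n" "a < n" "b < n"
  shows "sandwich s n (munit a i) X (munit j b) = single a b (X i j)"
proof (intro ext)
  interpret vector_space s by fact
  fix p q
  have "(\<Sum>k<n. \<Sum>l<n. s (munit a i p k * munit j b l q) (X k l))
      = (\<Sum>k<n. \<Sum>l<n. if l = j then (if k = i then (if p = a \<and> q = b then X i j else 0) else 0) else 0)"
    by (intro sum.cong refl) (auto simp: munit_def)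
  also have "\<dots> = single a b (X i j) p q"
    using assms by (simp add: single_def)
  finally show "sandwich s n (munit a i) X (munit j b) p q = single a b (X i j) p q"
    using assms unfolding sandwich_def by (auto simp: single_def)
qed

lemma mat_eq_sum_single:
  assumes "X \<in> mat_dim n n"
  shows "X = (\<Sum>i<n. \<Sum>j<n. single i j (X i j))"
proof (intro ext)
  fix p q
  have "(\<Sum>i<n. \<Sum>j<n. single i j (X i j)) p q = (\<Sum>i<n. \<Sum>j<n. if j = q then (if i = p then X p q else 0) else 0)"
    unfolding sum_fun_apply2 by (intro sum.cong refl) (auto simp: single_def)
  also have "\<dots> = X p q"
    using assms by (cases "q < n") (auto simp: mat_dim_def)
  finally show "X p q = (\<Sum>i<n. \<Sum>j<n. single i j (X i j)) p q" ..
qed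

locale admissible = cbanach s for s :: "complex \<Rightarrow> 'w::banach \<Rightarrow> 'w" +
  fixes nrm :: "nat \<Rightarrow> 'w mat \<Rightarrow> real"
  assumes admissible: "admissible_norms s nrm"
begin

lemma cnorm: "n > 0 \<Longrightarrow> cnorm_on s n (nrm n)"
  using admissible by (simp add: admissible_norms_def)

lemma admissible_constants:
  "\<exists>C1 C1' :: nat \<Rightarrow> nat \<Rightarrow> real. \<exists>C2 :: nat \<Rightarrow> real.
        (\<forall>n m. 0 < n \<longrightarrow> 0 < m \<longrightarrow> 0 < C1 n m \<and> 0 < C1' n m \<and>
           (\<forall>X\<in>mat_dim n n. \<forall>Y\<in>mat_dim m m.
              max (nrm n X) (nrm m Y) / C1 n m \<le> nrm (n + m) (dsum n X Y) \<and>
              nrm (n + m) (dsum n X Y) \<le> C1' n m * max (nrm n X) (nrm m Y))) \<and>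
        (\<forall>n>0. 0 < C2 n \<and> (\<forall>S\<in>mat_dim n n. \<forall>T\<in>mat_dim n n. \<forall>X\<in>mat_dim n n.
           nrm n (sandwich s n S X T) \<le> C2 n * cop_norm n S * nrm n X * cop_norm n T))"
  using admissible unfolding admissible_norms_def by (elim conjE)

lemma dsum_bounds:
  assumes "0 < n" "0 < m"
  shows "\<exists>C1>0. \<exists>C1'>0. \<forall>X\<in>mat_dim n n. \<forall>Y\<in>mat_dim m m.
              max (nrm n X) (nrm m Y) / C1 \<le> nrm (n + m) (dsum n X Y) \<and>
              nrm (n + m) (dsum n X Y) \<le> C1' * max (nrm n X) (nrm m Y)"
proof -
  from admissible_constants obtain C1 C1' where
    "\<forall>n m. 0 < n \<longrightarrow> 0 < m \<longrightarrow> 0 < C1 n m \<and> 0 < C1' n m \<and>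
           (\<forall>X\<in>mat_dim n n. \<forall>Y\<in>mat_dim m m.
              max (nrm n X) (nrm m Y) / C1 n m \<le> nrm (n + m) (dsum n X Y) \<and>
              nrm (n + m) (dsum n X Y) \<le> C1' n m * max (nrm n X) (nrm m Y))"
    by (elim exE conjE)
  from this[rule_format, OF assms]
  show ?thesis by (intro exI[of _ "C1 n m"] exI[of _ "C1' n m"]) blast
qed

lemma sandwich_bound:
  assumes "0 < n"
  shows "\<exists>C2>0. \<forall>S\<in>mat_dim n n. \<forall>T\<in>mat_dim n n. \<forall>X\<in>mat_dim n n.
           nrm n (sandwich s n S X T) \<le> C2 * cop_norm n S * nrm n X * cop_norm n T"
proof -
  from admissible_constants obtain C2 where
    "\<forall>n>0. 0 < C2 n \<and> (\<forall>S\<in>mat_dim n n. \<forall>T\<in>mat_dim n n. \<forall>X\<in>mat_dim n n.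
           nrm n (sandwich s n S X T) \<le> C2 n * cop_norm n S * nrm n X * cop_norm n T)"
    by (elim exE conjE)
  from this[rule_format, OF assms]
  show ?thesis by (intro exI[of _ "C2 n"]) blast
qed

lemma nrm_nonneg: "n > 0 \<Longrightarrow> X \<in> mat_dim n n \<Longrightarrow> 0 \<le> nrm n X"
  using cnorm[of n] by (simp add: cnorm_on_def)

lemma nrm_zero: "n > 0 \<Longrightarrow> nrm n 0 = 0"
  using cnorm[of n] mat_dim_zero[of n n] unfolding cnorm_on_def by blast

lemma nrm_triangle: "n > 0 \<Longrightarrow> X \<in> mat_dim n n \<Longrightarrow> Y \<in> mat_dim n n \<Longrightarrow> nrm n (X + Y) \<le> nrm n X + nrm n Y"
  using cnorm[of n] by (simp add: cnorm_on_def)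

lemma nrm_sum:
  assumes "n > 0" "finite I" "\<And>i. i \<in> I \<Longrightarrow> X i \<in> mat_dim n n"
  shows "nrm n (sum X I) \<le> (\<Sum>i\<in>I. nrm n (X i))"
  using assms(2,3)
proof (induction I rule: finite_induct)
  case (insert a I)
  have "nrm n (X a + sum X I) \<le> nrm n (X a) + nrm n (sum X I)"
    by (rule nrm_triangle) (use insert assms in \<open>auto intro!: mat_dim_sum\<close>)
  with insert show ?case unfolding sum.insert[OF insert(1,2)] by (meson add_left_mono insertCI order.trans)
qed (use assms in \<open>simp add: nrm_zero\<close>)

text \<open>A matrix whose only entry is in the corner is w \<oplus> 0 with blocks of sizes 1 and n
  - 1. The direct sum inequalities reduce its norm to size 1, where it is the norm of the Banach
  space; n = 1 is separate because the second block would be empty.\<close>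

lemma nrm_single_00:
  assumes "n > 0"
  shows "\<exists>C>0. \<forall>w. norm w \<le> C * nrm n (single 0 0 w) \<and> nrm n (single 0 0 w) \<le> C * norm w"
proof -
  have one: "nrm 1 (single 0 0 w) = norm w" for w
  proof -
    have "\<forall>X\<in>mat_dim 1 1. nrm 1 X = norm (X 0 0)" using admissible unfolding admissible_norms_def by (elim conjE)
    then show ?thesis using single_mat_dim[of 0 1 0 w] by (simp add: single_def)
  qed
  show ?thesis
  proof (cases "n = 1")
    case True then show ?thesis using one by (intro exI[of _ 1]) auto
  next
    case False
    define m where "m = n - 1"
    have m: "0 < m" "n = 1 + m" using assms False by (auto simp: m_def)
    have ds: "dsum 1 (single 0 0 w) 0 = single 0 0 w" for w :: 'w
      by (auto simp: dsum_def single_def fun_eq_iff)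
    obtain C1 C1' :: real where C: "0 < C1" "0 < C1'"
      "\<And>X Y. X\<in>mat_dim 1 1 \<Longrightarrow> Y\<in>mat_dim m m \<Longrightarrow>
              max (nrm 1 X) (nrm m Y) / C1 \<le> nrm (1 + m) (dsum 1 X Y) \<and>
              nrm (1 + m) (dsum 1 X Y) \<le> C1' * max (nrm 1 X) (nrm m Y)"
      using dsum_bounds[OF zero_less_one m(1)] by blast
    have "norm w / C1 \<le> nrm n (single 0 0 w)" "nrm n (single 0 0 w) \<le> C1' * norm w" for w
      using C(3)[OF single_mat_dim[of 0 1 0 w] mat_dim_zero] m one[of w] nrm_zero[OF m(1)]
      unfolding ds by auto
    then have bd: "norm w \<le> C1 * nrm n (single 0 0 w)" "nrm n (single 0 0 w) \<le> C1' * norm w" for w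
      using C(1) by (auto simp: field_simps)
    have "norm w \<le> max C1 C1' * nrm n (single 0 0 w) \<and> nrm n (single 0 0 w) \<le> max C1 C1' * norm w" for w
    proof
      have "0 \<le> nrm n (single 0 0 w)" using assms by (intro nrm_nonneg single_mat_dim) auto
      then show "norm w \<le> max C1 C1' * nrm n (single 0 0 w)"
        by (intro order.trans[OF bd(1)] mult_right_mono) auto
      show "nrm n (single 0 0 w) \<le> max C1 C1' * norm w"
        by (intro order.trans[OF bd(2)] mult_right_mono) auto
    qed
    then show ?thesis using C by (intro exI[of _ "max C1 C1'"]) auto
  qed
qed

lemma nrm_single_move:
  assumes "n > 0"
  shows "\<exists>C>0. \<forall>X\<in>mat_dim n n. \<forall>i<n. \<forall>j<n. \<forall>a<n. \<forall>b<n. nrm n (single a b (X i j)) \<le> C * nrm n X"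
proof -
  obtain C2 :: real where C: "0 < C2"
    "\<And>S T X. S\<in>mat_dim n n \<Longrightarrow> T\<in>mat_dim n n \<Longrightarrow> X\<in>mat_dim n n \<Longrightarrow>
       nrm n (sandwich s n S X T) \<le> C2 * cop_norm n S * nrm n X * cop_norm n T"
    using sandwich_bound[OF assms] by blast
  have "nrm n (single a b (X i j)) \<le> C2 * nrm n X"
    if X: "X \<in> mat_dim n n" "i < n" "j < n" "a < n" "b < n" for X i j a b
  proof -
    have "nrm n (single a b (X i j)) \<le> C2 * cop_norm n (munit a i) * nrm n X * cop_norm n (munit j b)"
      using C(2)[OF munit_mat_dim munit_mat_dim X(1), of a i j b] X
      by (simp add: sandwich_munit[OF vector_space_axioms])
    also have "\<dots> \<le> C2 * 1 * nrm n X * 1"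
      using C(1) X cop_norm_munit[of a n i] cop_norm_munit[of j n b] nrm_nonneg[OF assms X(1)]
      by (intro mult_mono mult_nonneg_nonneg) auto
    finally show ?thesis by simp
  qed
  then show ?thesis using C(1) by blast
qed

text \<open>Together with \<open>nrm_le_norm_entries\<close> this makes \<open>nrm n\<close>
  equivalent to the sum of the entry norms, so that limits and estimates may be treated one entry at
  a time.\<close>

lemma norm_entry_le_nrm:
  assumes "n > 0"
  shows "\<exists>C>0. \<forall>X\<in>mat_dim n n. \<forall>i<n. \<forall>j<n. norm (X i j) \<le> C * nrm n X"
proof -
  obtain C where C: "C > 0" "\<And>w. norm w \<le> C * nrm n (single 0 0 w)"
    using nrm_single_00[OF assms] by blast
  obtain D where D: "D > 0" "\<And>X i j. X\<in>mat_dim n n \<Longrightarrow> i<n \<Longrightarrow> j<n \<Longrightarrow> nrm n (single 0 0 (X i j)) \<le> D * nrm n X"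
    using nrm_single_move[OF assms] assms by blast
  have "norm (X i j) \<le> (C * D) * nrm n X" if "X\<in>mat_dim n n" "i<n" "j<n" for X i j
    using C(2)[of "X i j"] mult_left_mono[OF D(2)[OF that], of C] C(1) unfolding mult.assoc by linarith
  then show ?thesis using C(1) D(1) by (intro exI[of _ "C * D"]) auto
qed

lemma nrm_le_norm_entries:
  assumes "n > 0"
  shows "\<exists>C>0. \<forall>X\<in>mat_dim n n. nrm n X \<le> C * (\<Sum>i<n. \<Sum>j<n. norm (X i j))"
proof -
  obtain C where C: "C > 0" "\<And>w. nrm n (single 0 0 w) \<le> C * norm w"
    using nrm_single_00[OF assms] by blast
  obtain D where D: "D > 0" "\<And>X i j a b. X\<in>mat_dim n n \<Longrightarrow> i<n \<Longrightarrow> j<n \<Longrightarrow> a<n \<Longrightarrow> b<n \<Longrightarrow>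
     nrm n (single a b (X i j)) \<le> D * nrm n X"
    using nrm_single_move[OF assms] by blast
  have single: "nrm n (single i j w) \<le> D * C * norm w" if "i<n" "j<n" for i j w
  proof -
    have "nrm n (single i j w) \<le> D * nrm n (single 0 0 w)"
      using D(2)[OF single_mat_dim[of 0 n 0 w], of 0 0 i j] that assms by (simp add: single_def)
    also have "\<dots> \<le> D * (C * norm w)" using C(2) D(1) by (intro mult_left_mono) auto
    finally show ?thesis by (simp add: mult_ac)
  qed
  have "nrm n X \<le> (D * C) * (\<Sum>i<n. \<Sum>j<n. norm (X i j))" if X: "X\<in>mat_dim n n" for X
  proof -
    have "nrm n X = nrm n (\<Sum>i<n. \<Sum>j<n. single i j (X i j))" using mat_eq_sum_single[OF X] by simp
    also have "\<dots> \<le> (\<Sum>i<n. nrm n (\<Sum>j<n. single i j (X i j)))"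
      using assms by (intro nrm_sum) (auto intro!: mat_dim_sum single_mat_dim)
    also have "\<dots> \<le> (\<Sum>i<n. \<Sum>j<n. nrm n (single i j (X i j)))"
      using assms by (intro sum_mono nrm_sum) (auto intro!: single_mat_dim)
    also have "\<dots> \<le> (\<Sum>i<n. \<Sum>j<n. D * C * norm (X i j))"
      by (intro sum_mono single) auto
    finally show ?thesis by (simp add: sum_distrib_left)
  qed
  then show ?thesis using C(1) D(1) by (intro exI[of _ "D * C"]) auto
qed

end

section \<open>Intertwining relations\<close>

text \<open>The block matrix with identities on the diagonal and T in the upper right p x q corner;
  negating T inverts it.\<close>

definition unipotent :: "nat \<Rightarrow> nat \<Rightarrow> complex mat \<Rightarrow> complex mat" where
  "unipotent p q T = (\<lambda>i j. if i < p + q \<and> j = i then 1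
     else if i < p \<and> p \<le> j \<and> j < p + q then T i (j - p) else 0)"

lemma sum_lessThan_add: "(\<Sum>k<p+q. h k) = (\<Sum>k<p. h k) + (\<Sum>k<q. h (p + k))" for p q :: nat and h :: "nat \<Rightarrow> 'a::comm_monoid_add"
  by (induction q) (auto simp: add.assoc)

lemma cmat_mult_unipotent:
  "cmat_mult (p + q) (unipotent p q T) (unipotent p q (\<lambda>i j. - T i j)) = cmat_id (p + q)"
proof (intro ext)
  fix i j
  let ?U = "\<lambda>i k. if i < p \<and> p \<le> k \<and> k < p + q then T i (k - p) else 0"
  have "(\<Sum>k<p+q. unipotent p q T i k * unipotent p q (\<lambda>i j. - T i j) k j)
    = (\<Sum>k<p+q. (if k = i then (if j = i then 1 else - ?U i j) else 0) + (if k = j then ?U i j else 0))"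
    if "i < p + q" "j < p + q"
    by (intro sum.cong) (use that in \<open>auto simp: unipotent_def\<close>)
  then show "cmat_mult (p + q) (unipotent p q T) (unipotent p q (\<lambda>i j. - T i j)) i j = cmat_id (p + q) i j"
    by (auto simp: cmat_mult_def cmat_id_def sum.distrib)
qed

lemma cinv_pair_unipotent: "cinv_pair (p + q) (unipotent p q T) (unipotent p q (\<lambda>i j. - T i j))"
  using cmat_mult_unipotent[of p q T] cmat_mult_unipotent[of p q "\<lambda>i j. - T i j"]
  by (auto simp: cinv_pair_def) (auto simp: mat_dim_def unipotent_def)

text \<open>Conjugation leaves the diagonal blocks alone and puts TY - XT in the upper right corner,
  so it fixes X \<oplus> Y when XT = TY.\<close>

lemma sandwich_unipotent_dsum:
  fixes s :: "complex \<Rightarrow> 'v::ab_group_add \<Rightarrow> 'v"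
  assumes "vector_space s" "i < p + q" "j < p + q"
  shows "sandwich s (p + q) (unipotent p q T) (dsum p X Y) (unipotent p q (\<lambda>i j. - T i j)) i j =
    dsum p X Y i j + (if i < p \<and> p \<le> j then (\<Sum>k<q. s (T i k) (Y k (j - p))) - (\<Sum>k<p. s (T k (j - p)) (X i k)) else 0)"
proof -
  interpret vector_space s by fact
  let ?D = "dsum p X Y"
  let ?U = "\<lambda>i k. if i < p \<and> p \<le> k \<and> k < p + q then T i (k - p) else 0"
  have "(\<Sum>k<p+q. \<Sum>l<p+q. s (unipotent p q T i k * unipotent p q (\<lambda>i j. - T i j) l j) (?D k l))
     = (\<Sum>k<p+q. \<Sum>l<p+q. (if k = i then (if l = j then ?D i j else 0) else 0)
          + (if l = j then s (?U i k) (?D k j) else 0)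
          - (if k = i then s (?U l j) (?D i l) else 0))"
  proof (intro sum.cong refl)
    fix k l assume "k \<in> {..<p+q}" "l \<in> {..<p+q}"
    then have kl: "k < p + q" "l < p + q" by auto
    \<comment> \<open>A contribution of both off-diagonal blocks would pick an entry from the lower
      left block of the direct sum, which is zero.\<close>
    have 0: "s (?U i k * ?U l j) (?D k l) = 0" by (auto simp: dsum_def)
    have U: "unipotent p q T i k = (if k = i then 1 else 0) + ?U i k"
      "unipotent p q (\<lambda>i j. - T i j) l j = (if l = j then 1 else 0) - ?U l j"
      using assms kl by (auto simp: unipotent_def)
    show "s (unipotent p q T i k * unipotent p q (\<lambda>i j. - T i j) l j) (?D k l) =
        (if k = i then (if l = j then ?D i j else 0) else 0)
          + (if l = j then s (?U i k) (?D k j) else 0)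
          - (if k = i then s (?U l j) (?D i l) else 0)"
      unfolding U using 0
      by (cases "k = i"; cases "l = j") (simp_all add: algebra_simps del: mult_eq_0_iff scale_eq_0_iff)
  qed
  also have "\<dots> = ?D i j + (\<Sum>k<p+q. s (?U i k) (?D k j)) - (\<Sum>l<p+q. s (?U l j) (?D i l))"
  proof -
    have "(\<Sum>k<p+q. \<Sum>l<p+q. if k = i then s (?U l j) (?D i l) else 0) = (\<Sum>k<p+q. if k = i then \<Sum>l<p+q. s (?U l j) (?D i l) else 0)"
      by (intro sum.cong) auto
    moreover have "(\<Sum>k<p+q. \<Sum>l<p+q. if k = i then (if l = j then ?D i j else 0) else 0) = (\<Sum>k<p+q. if k = i then \<Sum>l<p+q. if l = j then ?D i j else 0 else 0)"
      by (intro sum.cong) auto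
    ultimately show ?thesis using assms by (simp add: sum.distrib sum_subtractf)
  qed
  also have "(\<Sum>k<p+q. s (?U i k) (?D k j)) = (if i < p \<and> p \<le> j then \<Sum>k<q. s (T i k) (Y k (j - p)) else 0)"
    using assms by (auto simp: sum_lessThan_add dsum_def)
  also have "(\<Sum>l<p+q. s (?U l j) (?D i l)) = (if i < p \<and> p \<le> j then \<Sum>k<p. s (T k (j - p)) (X i k) else 0)"
    using assms by (auto simp: sum_lessThan_add dsum_def)
  finally show ?thesis using assms by (auto simp: sandwich_def)
qed

text \<open>The hypothesis on T says that the unipotent similarity fixes X \<oplus> Y. Both sides of
  the similarity law then concern one point of \<Omega>, so f(X) \<oplus> f(Y) is fixed as well, and
  its upper right corner is the claim.\<close>

lemma nc_function_intertwines:
  fixes sV :: "complex \<Rightarrow> 'v::ab_group_add \<Rightarrow> 'v" and sW :: "complex \<Rightarrow> 'w::ab_group_add \<Rightarrow> 'w"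
  assumes V: "vector_space sV" and W: "vector_space sW" and nc: "nc_set \<Omega>" and f: "nc_function sV sW \<Omega> f"
    and pq: "0 < p" "0 < q" and X: "X \<in> \<Omega> p" and Y: "Y \<in> \<Omega> q"
    and T: "\<And>i j. i < p \<Longrightarrow> j < q \<Longrightarrow> (\<Sum>k<p. sV (T k j) (X i k)) = (\<Sum>k<q. sV (T i k) (Y k j))"
    and ij: "i < p" "j < q"
  shows "(\<Sum>k<p. sW (T k j) (f p X i k)) = (\<Sum>k<q. sW (T i k) (f q Y k j))"
proof -
  let ?S = "unipotent p q T" and ?S' = "unipotent p q (\<lambda>i j. - T i j)" and ?D = "dsum p X Y"
  have D: "?D \<in> \<Omega> (p + q)" using nc X Y pq unfolding nc_set_def by blast
  then have Dm: "?D \<in> mat_dim (p + q) (p + q)" using nc unfolding nc_set_def by blast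
  have "sandwich sV (p + q) ?S ?D ?S' a b = ?D a b" for a b
  proof (cases "a < p + q \<and> b < p + q")
    case True
    then show ?thesis using T[of a "b - p"] by (auto simp: sandwich_unipotent_dsum[OF V])
  next
    case False
    then show ?thesis using Dm by (auto simp: sandwich_def mat_dim_def)
  qed
  then have eq: "sandwich sV (p + q) ?S ?D ?S' = ?D" by blast
  have "f (p + q) ?D = sandwich sW (p + q) ?S (f (p + q) ?D) ?S'"
    using f cinv_pair_unipotent[of p q T] D eq pq unfolding nc_function_def by (metis add_gr_0)
  moreover have "f (p + q) ?D = dsum p (f p X) (f q Y)"
    using f X Y pq unfolding nc_function_def by blast
  ultimately have "dsum p (f p X) (f q Y) i (p + j) = sandwich sW (p + q) ?S (dsum p (f p X) (f q Y)) ?S' i (p + j)"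
    by simp
  then show ?thesis
    using ij by (simp add: sandwich_unipotent_dsum[OF W])
qed

section \<open>Finite openness, amplifications and higher order operators\<close>

lemma vector_space_mscale:
  fixes s :: "complex \<Rightarrow> 'v::ab_group_add \<Rightarrow> 'v"
  assumes "vector_space s"
  shows "vector_space (mscale s)"
proof -
  interpret vector_space s by fact
  show ?thesis
    by unfold_locales (auto simp: mscale_def fun_eq_iff algebra_simps)
qed

text \<open>Finite openness is formulated for linearly independent families, while the families met
  later, such as Y with Z or E with Y, may be dependent. Inductively, a new vector either
  contributes its coordinates as a column of L or enlarges the basis.\<close>

lemma mlincomb_reduce_to_basis:
  fixes s :: "complex \<Rightarrow> 'v::ab_group_add \<Rightarrow> 'v"
  assumes "vector_space s" "\<forall>i<k. E i \<in> mat_dim n n"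
  shows "\<exists>m F L. fd_basis s n m F \<and> (\<forall>c. mlincomb s k c E = mlincomb s m (\<lambda>j. \<Sum>i<k. L j i * c i) F)"
  using assms(2)
proof (induction k)
  case 0
  then show ?case by (intro exI[of _ 0]) (simp add: fd_basis_def mlincomb_def)
next
  case (Suc k)
  interpret M: vector_space "mscale s" by (rule vector_space_mscale) fact
  obtain m F L where F: "fd_basis s n m F" and L: "\<And>c. mlincomb s k c E = mlincomb s m (\<lambda>j. \<Sum>i<k. L j i * c i) F"
    using Suc by (meson less_Suc_eq)
  show ?case
  proof (cases "\<exists>d. E k = mlincomb s m d F")
    case True
    then obtain d where d: "E k = mlincomb s m d F" by blast
    define L' where "L' j i = (if i = k then d j else L j i)" for j i
    have "mlincomb s (Suc k) c E = mlincomb s m (\<lambda>j. \<Sum>i<Suc k. L' j i * c i) F" for c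
    proof -
      have "mlincomb s (Suc k) c E = mlincomb s k c E + mscale s (c k) (E k)" by (simp only: mlincomb_def sum.lessThan_Suc)
      also have "\<dots> = mlincomb s m (\<lambda>j. \<Sum>i<k. L j i * c i) F + mscale s (c k) (mlincomb s m d F)"
        by (simp only: L flip: d)
      also have "\<dots> = mlincomb s m (\<lambda>j. (\<Sum>i<k. L j i * c i) + d j * c k) F"
        unfolding mlincomb_def M.scale_sum_right sum.distrib[symmetric]
        by (intro sum.cong) (simp_all only: M.scale_left_distrib M.scale_scale mult.commute)
      also have "(\<lambda>j. (\<Sum>i<k. L j i * c i) + d j * c k) = (\<lambda>j. \<Sum>i<Suc k. L' j i * c i)"
        by (auto simp: L'_def)
      finally show ?thesis .
    qed
    with F show ?thesis by blast
  next
    case False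
    define F' where "F' = F(m := E k)"
    define L' where "L' j i = (if j = m then (if i = k then 1 else 0) else if i = k then 0 else L j i)" for j i
    have split: "mlincomb s (Suc m) c F' = mlincomb s m c F + mscale s (c m) (E k)" for c
      unfolding mlincomb_def sum.lessThan_Suc by (simp add: F'_def)
    have "fd_basis s n (Suc m) F'"
      unfolding fd_basis_def
    proof (intro conjI allI impI)
      show "F' i \<in> mat_dim n n" if "i < Suc m" for i
        using that F Suc.prems by (auto simp: F'_def fd_basis_def less_Suc_eq)
      fix c i assume c: "mlincomb s (Suc m) c F' = 0" and i: "i < Suc m"
      have cm: "c m = 0"
      proof (rule ccontr)
        assume "c m \<noteq> 0"
        have "mscale s (c m) (E k) = - mlincomb s m c F"
          using c unfolding split by (metis add_eq_0_iff)
        then have "mscale s (1 / c m) (mscale s (c m) (E k)) = mscale s (1 / c m) (- mlincomb s m c F)" by simp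
        then have "E k = mscale s (1 / c m) (- mlincomb s m c F)" using \<open>c m \<noteq> 0\<close> by (simp only: M.scale_scale) simp
        also have "\<dots> = mlincomb s m (\<lambda>j. - (c j / c m)) F"
          by (simp add: mlincomb_def M.scale_sum_right sum_negf)
        finally show False using False by blast
      qed
      then have "mlincomb s m c F = 0" using c unfolding split by simp
      then show "c i = 0" using F cm i by (auto simp: fd_basis_def less_Suc_eq)
    qed
    moreover have "mlincomb s (Suc k) c E = mlincomb s (Suc m) (\<lambda>j. \<Sum>i<Suc k. L' j i * c i) F'" for c
    proof -
      have "mlincomb s (Suc m) (\<lambda>j. \<Sum>i<Suc k. L' j i * c i) F'
         = mlincomb s m (\<lambda>j. \<Sum>i<Suc k. L' j i * c i) F + mscale s (c k) (E k)"
        unfolding split by (simp add: L'_def)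
      also have "mlincomb s m (\<lambda>j. \<Sum>i<Suc k. L' j i * c i) F = mlincomb s m (\<lambda>j. \<Sum>i<k. L j i * c i) F"
        unfolding mlincomb_def by (rule sum.cong[OF refl]) (simp add: L'_def)
      finally show ?thesis by (simp only: mlincomb_def sum.lessThan_Suc L[unfolded mlincomb_def])
    qed
    ultimately show ?thesis by blast
  qed
qed

text \<open>Passing to basis coordinates is linear and preserves continuity in the parameter x; the
  open coordinate set supplied by finite openness is pulled back along this map.\<close>

lemma fin_open_level_preimage:
  fixes s :: "complex \<Rightarrow> 'v::ab_group_add \<Rightarrow> 'v" and c :: "'x::topological_space \<Rightarrow> nat \<Rightarrow> complex"
  assumes "vector_space s" "fin_open_level s n A" "\<And>i. i < k \<Longrightarrow> E i \<in> mat_dim n n"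
    "\<And>i. i < k \<Longrightarrow> continuous_on UNIV (\<lambda>x. c x i)"
  shows "open {x. mlincomb s k (c x) E \<in> A}"
proof -
  obtain m F L where F: "fd_basis s n m F" and L: "\<And>c. mlincomb s k c E = mlincomb s m (\<lambda>j. \<Sum>i<k. L j i * c i) F"
    using mlincomb_reduce_to_basis[OF assms(1), of k E n] assms(3) by blast
  \<comment> \<open>Zero beyond m, so that the vector lies in \<open>coords m\<close>.\<close>
  define d where "d x j = (if j < m then \<Sum>i<k. L j i * c x i else 0)" for x j
  obtain U where U: "open U" "{c \<in> coords m. mlincomb s m c F \<in> A} = coords m \<inter> U"
    using assms(2) F unfolding fin_open_level_def openin_open by blast
  have "continuous_on UNIV d"
  proof (rule continuous_on_coordinatewise_then_product)
    show "continuous_on UNIV (\<lambda>x. d x j)" for j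
      by (cases "j < m") (auto simp: d_def intro!: continuous_intros assms(4))
  qed
  then have "open (d -` U)" using U(1) by (simp add: open_vimage)
  moreover have "d -` U = {x. mlincomb s k (c x) E \<in> A}"
  proof -
    have "d x \<in> coords m" for x by (simp add: d_def coords_def)
    moreover have "mlincomb s m (d x) F = mlincomb s k (c x) E" for x
      unfolding L by (simp add: mlincomb_def d_def)
    ultimately have "d x \<in> U \<longleftrightarrow> mlincomb s k (c x) E \<in> A" for x
      using U(2) by (metis (mono_tags, lifting) Int_iff mem_Collect_eq)
    then show ?thesis by auto
  qed
  ultimately show ?thesis by simp
qed

lemma mlincomb_Suc: "mlincomb s (Suc k) c E = mlincomb s k c E + mscale s (c k) (E k)"
  by (simp only: mlincomb_def sum.lessThan_Suc)

lemma fin_open_level_slice: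
  fixes s :: "complex \<Rightarrow> 'v::ab_group_add \<Rightarrow> 'v"
  assumes "vector_space s" "fin_open_level s n A" "X \<in> mat_dim n n" "Z \<in> mat_dim n n"
  shows "open {t. X + mscale s t Z \<in> A}"
proof -
  interpret M: vector_space "mscale s" by (rule vector_space_mscale) fact
  have eq: "mlincomb s 2 (\<lambda>i. if i = 0 then 1 else t) (\<lambda>i. if i = 0 then X else Z) = X + mscale s t Z" for t
    by (simp add: mlincomb_def numeral_2_eq_2)
  have cont: "continuous_on UNIV (\<lambda>t. if i = 0 then 1 else t)" for i :: nat
    by (cases "i = 0") (auto intro: continuous_intros)
  show ?thesis
    using fin_open_level_preimage[where c = "\<lambda>t i. if i = 0 then 1 else t", OF assms(1,2) _ cont, of 2 "\<lambda>i. if i = 0 then X else Z"] assms(3,4)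
    unfolding eq by simp
qed

section \<open>Amplifications\<close>

text \<open>Y \<otimes> 1 + Z \<otimes> A as a d x d array of n x n blocks, block (a,b) being
  \<open>A a b\<close> times Z, plus Y when a = b. The dependence on A is complex linear algebra, so
  relations between coefficient matrices lift to relations between amplifications.\<close>

definition tens :: "(complex \<Rightarrow> 'v \<Rightarrow> 'v) \<Rightarrow> nat \<Rightarrow> nat \<Rightarrow> ('v::ab_group_add) mat \<Rightarrow> 'v mat \<Rightarrow> complex mat \<Rightarrow> 'v mat" where
  "tens s n d Y Z A = (\<lambda>i j. if i < d*n \<and> j < d*n then
     (if i div n = j div n then Y (i mod n) (j mod n) else 0) + s (A (i div n) (j div n)) (Z (i mod n) (j mod n)) else 0)"

lemma tens_mat_dim: "tens s n d Y Z A \<in> mat_dim (d*n) (d*n)"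
  by (auto simp: tens_def mat_dim_def)

lemma block_index_less: "c < d \<Longrightarrow> r < n \<Longrightarrow> c * n + r < d * n" for c d r n :: nat
proof -
  assume "c < d" "r < n"
  then have "c * n + r < Suc c * n" by simp
  also have "\<dots> \<le> d * n" using \<open>c < d\<close> by (intro mult_le_mono1) simp
  finally show ?thesis .
qed

lemma tens_block: "a < d \<Longrightarrow> b < d \<Longrightarrow> i < n \<Longrightarrow> j < n \<Longrightarrow>
    tens s n d Y Z A (a*n+i) (b*n+j) = (if a = b then Y i j else 0) + s (A a b) (Z i j)"
  by (simp add: tens_def block_index_less)

lemma tens_cong:
  assumes "\<And>a b. a < d \<Longrightarrow> b < d \<Longrightarrow> A a b = B a b"
  shows "tens s n d Y Z A = tens s n d Y Z B"
  unfolding tens_def using assms by (intro ext) (auto simp: less_mult_imp_div_less)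

context
  fixes s :: "complex \<Rightarrow> 'v::ab_group_add \<Rightarrow> 'v"
  assumes vs: "vector_space s"
begin

interpretation vector_space s by (rule vs)

text \<open>This and the next two identities show that moving the coefficient matrix, the direction
  Z or the base point along a line moves the amplification along a line too. Results about slices
  therefore apply to all three motions.\<close>

lemma tens_add_coeff:
  "tens s n d Y Z A + mscale s t (tens s n d 0 Z B) = tens s n d Y Z (\<lambda>a b. A a b + t * B a b)"
  by (auto simp: tens_def mscale_def fun_eq_iff algebra_simps)

lemma tens_add_direction:
  "tens s n d Y Z A + mscale s t (tens s n d 0 H A) = tens s n d Y (Z + mscale s t H) A"
  by (auto simp: tens_def mscale_def fun_eq_iff algebra_simps)

lemma tens_shift:
  "tens s n d (Y + mscale s t Z) Z A = tens s n d Y Z (\<lambda>a b. A a b + (if a = b then t else 0))"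
  by (auto simp: tens_def mscale_def fun_eq_iff algebra_simps)

lemma tens_1:
  assumes "Y \<in> mat_dim n n" "Z \<in> mat_dim n n"
  shows "tens s n (Suc 0) Y Z A = Y + mscale s (A 0 0) Z"
  using assms by (auto simp: tens_def mscale_def fun_eq_iff mat_dim_def)

text \<open>With A = 0 the amplification is a direct sum of copies of Y, which is how amplifications
  enter \<Omega>.\<close>

lemma dsum_tens_zero:
  assumes "Y \<in> mat_dim n n" "0 < n"
  shows "dsum n Y (tens s n d Y Z (\<lambda>_ _. 0)) = tens s n (Suc d) Y Z (\<lambda>_ _. 0)"
proof (intro ext)
  fix i j
  have div: "(k - n) div n = k div n - 1" "(k - n) mod n = k mod n" "k div n \<noteq> 0" if "n \<le> k" for k
    using that assms(2) by (auto simp: le_div_geq le_mod_geq div_greater_zero_iff)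
  show "dsum n Y (tens s n d Y Z (\<lambda>_ _. 0)) i j = tens s n (Suc d) Y Z (\<lambda>_ _. 0) i j"
  proof (cases "i < n"; cases "j < n")
    assume "\<not> i < n" "\<not> j < n"
    then have "n \<le> i" "n \<le> j" by auto
    with div[OF this(1)] div[OF this(2)] show ?thesis
      by (auto simp: dsum_def tens_def)
  qed (use assms div(3)[of i] div(3)[of j] in \<open>auto simp: dsum_def tens_def linorder_not_less\<close>)
qed

lemma sum_blocks: "(\<Sum>k<d*n. h k) = (\<Sum>c<d. \<Sum>r<n. h (c*n + r))" for d n :: nat and h :: "nat \<Rightarrow> 'a::comm_monoid_add"
  by (induction d) (simp_all add: sum_lessThan_add add.commute[of n])

lemma sum_block_column:
  assumes "(j::nat) < n"
  shows "(\<Sum>k<d*n. s (if k mod n = (b*n+j) mod n then T (k div n) ((b*n+j) div n) else 0) (X k)) = (\<Sum>c<d. s (T c b) (X (c*n+j)))"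
proof -
  have "(\<Sum>k<d*n. s (if k mod n = (b*n+j) mod n then T (k div n) ((b*n+j) div n) else 0) (X k))
     = (\<Sum>c<d. \<Sum>r<n. if r = j then s (T c b) (X (c*n+j)) else 0)"
    unfolding sum_blocks[of _ d n] by (intro sum.cong refl) (use assms in auto)
  then show ?thesis using assms by simp
qed

lemma sum_block_row:
  assumes "(i::nat) < n"
  shows "(\<Sum>k<d*n. s (if (a*n+i) mod n = k mod n then T ((a*n+i) div n) (k div n) else 0) (X k)) = (\<Sum>c<d. s (T a c) (X (c*n+i)))"
proof -
  have "(\<Sum>k<d*n. s (if (a*n+i) mod n = k mod n then T ((a*n+i) div n) (k div n) else 0) (X k))
     = (\<Sum>c<d. \<Sum>r<n. if r = i then s (T a c) (X (c*n+i)) else 0)"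
    unfolding sum_blocks[of _ d n] by (intro sum.cong refl) (use assms in auto)
  then show ?thesis using assms by simp
qed

end

text \<open>T acting on the block indices commutes with the Y part and turns the Z part into AT on
  one side and TB on the other, so AT = TB suffices. The result is read off at entry (i,j) of block
  (a,b).\<close>

lemma nc_function_tens_intertwines:
  fixes sV :: "complex \<Rightarrow> 'v::ab_group_add \<Rightarrow> 'v" and sW :: "complex \<Rightarrow> 'w::ab_group_add \<Rightarrow> 'w"
  assumes V: "vector_space sV" and W: "vector_space sW" and nc: "nc_set \<Omega>" and f: "nc_function sV sW \<Omega> f"
    and n: "0 < n" and X: "tens sV n d Y Z A \<in> \<Omega> (d*n)" and X': "tens sV n e Y Z B \<in> \<Omega> (e*n)"
    and T: "\<And>a b. a < d \<Longrightarrow> b < e \<Longrightarrow> (\<Sum>c<d. A a c * T c b) = (\<Sum>c<e. T a c * B c b)"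
    and ab: "a < d" "b < e" and ij: "i < n" "j < n"
  shows "(\<Sum>c<d. sW (T c b) (f (d*n) (tens sV n d Y Z A) (a*n+i) (c*n+j)))
       = (\<Sum>c<e. sW (T a c) (f (e*n) (tens sV n e Y Z B) (c*n+i) (b*n+j)))"
proof -
  interpret V: vector_space sV by fact
  define U where "U k l = (if k mod n = l mod n then T (k div n) (l div n) else 0)" for k l
  have "(\<Sum>k<d*n. sW (U k (b*n+j)) (f (d*n) (tens sV n d Y Z A) (a*n+i) k))
      = (\<Sum>k<e*n. sW (U (a*n+i) k) (f (e*n) (tens sV n e Y Z B) k (b*n+j)))"
  proof (rule nc_function_intertwines[OF V W nc f _ _ X X'])
    show "0 < d*n" "0 < e*n" using ab n by auto
    show "a*n+i < d*n" "b*n+j < e*n" using ab ij by (auto intro: block_index_less)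
    fix p q assume pq: "p < d*n" "q < e*n"
    define a' i' b' j' where "a' = p div n" "i' = p mod n" "b' = q div n" "j' = q mod n"
    have p: "p = a'*n+i'" "q = b'*n+j'" "i' < n" "j' < n" "a' < d" "b' < e"
      using pq n by (auto simp: a'_i'_b'_j'_def less_mult_imp_div_less)
    have "(\<Sum>k<d*n. sV (U k q) (tens sV n d Y Z A p k)) = (\<Sum>c<d. sV (T c b') (tens sV n d Y Z A p (c*n+j')))"
      unfolding p(2) U_def by (rule sum_block_column[OF V p(4)])
    also have "\<dots> = (\<Sum>c<d. (if c = a' then sV (T a' b') (Y i' j') else 0) + sV (A a' c * T c b') (Z i' j'))"
      unfolding p(1) using p by (intro sum.cong refl) (auto simp: tens_block V.scale_right_distrib mult.commute)
    also have "\<dots> = sV (T a' b') (Y i' j') + sV (\<Sum>c<d. A a' c * T c b') (Z i' j')"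
      using p by (simp add: sum.distrib V.scale_sum_left)
    finally have 1: "(\<Sum>k<d*n. sV (U k q) (tens sV n d Y Z A p k)) = sV (T a' b') (Y i' j') + sV (\<Sum>c<d. A a' c * T c b') (Z i' j')" .
    have "(\<Sum>k<e*n. sV (U p k) (tens sV n e Y Z B k q)) = (\<Sum>c<e. sV (T a' c) (tens sV n e Y Z B (c*n+i') q))"
      unfolding p(1) U_def by (rule sum_block_row[OF V p(3)])
    also have "\<dots> = (\<Sum>c<e. (if c = b' then sV (T a' b') (Y i' j') else 0) + sV (T a' c * B c b') (Z i' j'))"
      unfolding p(2) using p by (intro sum.cong refl) (auto simp: tens_block V.scale_right_distrib)
    also have "\<dots> = sV (T a' b') (Y i' j') + sV (\<Sum>c<e. T a' c * B c b') (Z i' j')"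
      using p by (simp add: sum.distrib V.scale_sum_left)
    finally show "(\<Sum>k<d*n. sV (U k q) (tens sV n d Y Z A p k)) = (\<Sum>k<e*n. sV (U p k) (tens sV n e Y Z B k q))"
      using 1 T[OF p(5,6)] by simp
  qed
  then show ?thesis
    unfolding U_def sum_block_column[OF W ij(2)] sum_block_row[OF W ij(1), where a = a and T = T] .
qed


section \<open>Similarities and the extension of f to the similarity envelope\<close>

lemma cmat_mult_assoc: "cmat_mult m (cmat_mult m A B) C = cmat_mult m A (cmat_mult m B C)"
proof (intro ext)
  fix i j
  have "(\<Sum>k<m. (\<Sum>l<m. A i l * B l k) * C k j) = (\<Sum>k<m. \<Sum>l<m. A i l * (B l k * C k j))"
    by (simp add: sum_distrib_right mult.assoc)
  also have "\<dots> = (\<Sum>l<m. \<Sum>k<m. A i l * (B l k * C k j))" by (rule sum.swap)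
  also have "\<dots> = (\<Sum>l<m. A i l * (\<Sum>k<m. B l k * C k j))" by (simp add: sum_distrib_left)
  finally show "cmat_mult m (cmat_mult m A B) C i j = cmat_mult m A (cmat_mult m B C) i j"
    by (simp add: cmat_mult_def)
qed

lemma cmat_mult_id:
  assumes "A \<in> mat_dim m m"
  shows "cmat_mult m (cmat_id m) A = A" "cmat_mult m A (cmat_id m) = A"
proof -
  have "(\<Sum>k<m. cmat_id m i k * A k j) = (\<Sum>k<m. if k = i then A i j else 0)" if "i < m" for i j
    using that by (intro sum.cong) (auto simp: cmat_id_def)
  then show "cmat_mult m (cmat_id m) A = A"
    using assms by (auto simp: cmat_mult_def fun_eq_iff mat_dim_def)
  have "(\<Sum>k<m. A i k * cmat_id m k j) = (\<Sum>k<m. if k = j then A i j else 0)" if "j < m" for i j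
    using that by (intro sum.cong) (auto simp: cmat_id_def)
  then show "cmat_mult m A (cmat_id m) = A"
    using assms by (auto simp: cmat_mult_def fun_eq_iff mat_dim_def)
qed

lemma cmat_mult_mat_dim: "cmat_mult m A B \<in> mat_dim m m"
  by (auto simp: cmat_mult_def mat_dim_def)

lemma cinv_pair_sym: "cinv_pair m S T \<Longrightarrow> cinv_pair m T S"
  by (auto simp: cinv_pair_def)

lemma cinv_pair_mult:
  assumes "cinv_pair m S T" "cinv_pair m S' T'"
  shows "cinv_pair m (cmat_mult m S S') (cmat_mult m T' T)"
proof -
  have "cmat_mult m (cmat_mult m S S') (cmat_mult m T' T) = cmat_mult m S (cmat_mult m (cmat_mult m S' T') T)"
    "cmat_mult m (cmat_mult m T' T) (cmat_mult m S S') = cmat_mult m T' (cmat_mult m (cmat_mult m T S) S')"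
    by (simp_all add: cmat_mult_assoc)
  with assms show ?thesis by (simp add: cinv_pair_def cmat_mult_id cmat_mult_mat_dim)
qed

lemma sum_swap_pairs:
  "(\<Sum>k\<in>A. \<Sum>l\<in>B. \<Sum>p\<in>C. \<Sum>q\<in>D. F k l p q) = (\<Sum>p\<in>C. \<Sum>q\<in>D. \<Sum>k\<in>A. \<Sum>l\<in>B. F k l p q)"
proof -
  have "(\<Sum>k\<in>A. \<Sum>l\<in>B. \<Sum>p\<in>C. \<Sum>q\<in>D. F k l p q) = (\<Sum>k\<in>A. \<Sum>p\<in>C. \<Sum>l\<in>B. \<Sum>q\<in>D. F k l p q)"
    by (rule sum.cong[OF refl], rule sum.swap)
  also have "\<dots> = (\<Sum>p\<in>C. \<Sum>k\<in>A. \<Sum>l\<in>B. \<Sum>q\<in>D. F k l p q)" by (rule sum.swap)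
  also have "\<dots> = (\<Sum>p\<in>C. \<Sum>k\<in>A. \<Sum>q\<in>D. \<Sum>l\<in>B. F k l p q)"
    by (rule sum.cong[OF refl], rule sum.cong[OF refl], rule sum.swap)
  also have "\<dots> = (\<Sum>p\<in>C. \<Sum>q\<in>D. \<Sum>k\<in>A. \<Sum>l\<in>B. F k l p q)"
    by (rule sum.cong[OF refl], rule sum.swap)
  finally show ?thesis .
qed

lemma sandwich_sandwich:
  fixes s :: "complex \<Rightarrow> 'v::ab_group_add \<Rightarrow> 'v"
  assumes "vector_space s"
  shows "sandwich s m S (sandwich s m S' X T') T = sandwich s m (cmat_mult m S S') X (cmat_mult m T' T)"
proof (intro ext)
  interpret vector_space s by fact
  fix i j
  show "sandwich s m S (sandwich s m S' X T') T i j = sandwich s m (cmat_mult m S S') X (cmat_mult m T' T) i j"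
  proof (cases "i < m \<and> j < m")
    case True
    have "sandwich s m S (sandwich s m S' X T') T i j
       = (\<Sum>k<m. \<Sum>l<m. s (S i k * T l j) (\<Sum>p<m. \<Sum>q<m. s (S' k p * T' q l) (X p q)))"
      using True by (simp add: sandwich_def)
    also have "\<dots> = (\<Sum>k<m. \<Sum>l<m. \<Sum>p<m. \<Sum>q<m. s (S i k * T l j * (S' k p * T' q l)) (X p q))"
      by (simp only: scale_sum_right scale_scale)
    also have "\<dots> = (\<Sum>p<m. \<Sum>q<m. \<Sum>k<m. \<Sum>l<m. s (S i k * T l j * (S' k p * T' q l)) (X p q))"
      by (rule sum_swap_pairs)
    also have "\<dots> = (\<Sum>p<m. \<Sum>q<m. s ((\<Sum>k<m. S i k * S' k p) * (\<Sum>l<m. T' q l * T l j)) (X p q))"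
    proof -
      have "(\<Sum>k<m. S i k * S' k p) * (\<Sum>l<m. T' q l * T l j) = (\<Sum>k<m. \<Sum>l<m. S i k * T l j * (S' k p * T' q l))" for p q
        by (simp add: sum_product mult_ac)
      then show ?thesis by (simp only: scale_sum_left)
    qed
    also have "\<dots> = sandwich s m (cmat_mult m S S') X (cmat_mult m T' T) i j"
      using True by (simp add: sandwich_def cmat_mult_def)
    finally show ?thesis .
  qed (auto simp: sandwich_def)
qed

lemma sandwich_diag:
  fixes s :: "complex \<Rightarrow> 'v::ab_group_add \<Rightarrow> 'v"
  assumes "vector_space s" "i < m" "j < m"
  shows "sandwich s m (\<lambda>i k. if i < m \<and> k = i then x i else 0) X (\<lambda>i k. if i < m \<and> k = i then y i else 0) i j = s (x i * y j) (X i j)"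
proof -
  interpret vector_space s by fact
  have "(\<Sum>k<m. \<Sum>l<m. s ((if i < m \<and> k = i then x i else 0) * (if l < m \<and> j = l then y l else 0)) (X k l))
     = (\<Sum>k<m. \<Sum>l<m. if l = j then (if k = i then s (x i * y j) (X i j) else 0) else 0)"
    using assms by (intro sum.cong refl) auto
  then show ?thesis using assms by (simp add: sandwich_def)
qed

lemma sandwich_id:
  fixes s :: "complex \<Rightarrow> 'v::ab_group_add \<Rightarrow> 'v"
  assumes "vector_space s" "X \<in> mat_dim m m"
  shows "sandwich s m (cmat_id m) X (cmat_id m) = X"
proof (intro ext)
  interpret vector_space s by fact
  fix i j
  show "sandwich s m (cmat_id m) X (cmat_id m) i j = X i j"
  proof (cases "i < m \<and> j < m")
    case True
    then show ?thesis using sandwich_diag[OF assms(1), of i m j "\<lambda>_. 1" X "\<lambda>_. 1"] by (simp add: cmat_id_def)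
  qed (use assms in \<open>auto simp: sandwich_def mat_dim_def\<close>)
qed

lemma nc_function_similarity:
  assumes "nc_function sV sW \<Omega> f" "0 < n" "cinv_pair n S T" "X \<in> \<Omega> n" "sandwich sV n S X T \<in> \<Omega> n"
  shows "f n (sandwich sV n S X T) = sandwich sW n S (f n X) T"
proof -
  from assms(1) have "\<forall>n>0. \<forall>S T X. cinv_pair n S T \<longrightarrow> X \<in> \<Omega> n \<longrightarrow> sandwich sV n S X T \<in> \<Omega> n \<longrightarrow>
        f n (sandwich sV n S X T) = sandwich sW n S (f n X) T"
    unfolding nc_function_def by (elim conjE)
  with assms(2-) show ?thesis by simp
qed

text \<open>Two representations of the same matrix by points of \<Omega> differ by a similarity
  between these points, and f respects it; therefore the choice in \<open>nc_ext\<close> does not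
  affect the value.\<close>

lemma nc_ext_eq:
  fixes sV :: "complex \<Rightarrow> 'v::ab_group_add \<Rightarrow> 'v" and sW :: "complex \<Rightarrow> 'w::ab_group_add \<Rightarrow> 'w"
  assumes V: "vector_space sV" and W: "vector_space sW" and nc: "nc_set \<Omega>" and f: "nc_function sV sW \<Omega> f"
    and m: "0 < m" and S: "cinv_pair m S T" and X: "X \<in> \<Omega> m"
  shows "nc_ext sV sW \<Omega> f m (sandwich sV m S X T) = sandwich sW m S (f m X) T"
proof -
  let ?P = "\<lambda>W. \<exists>S' T' X'. cinv_pair m S' T' \<and> X' \<in> \<Omega> m \<and>
      sandwich sV m S X T = sandwich sV m S' X' T' \<and> W = sandwich sW m S' (f m X') T'"
  have unique: "W = sandwich sW m S (f m X) T" if "?P W" for W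
  proof -
    from that obtain S' T' X' where S': "cinv_pair m S' T'" and X': "X' \<in> \<Omega> m"
      and eq: "sandwich sV m S X T = sandwich sV m S' X' T'" and W': "W = sandwich sW m S' (f m X') T'" by blast
    have X'm: "X' \<in> mat_dim m m" using nc X' unfolding nc_set_def by blast
    have "X' = sandwich sV m T' (sandwich sV m S' X' T') S'"
      using S' X'm by (simp add: sandwich_sandwich[OF V] cinv_pair_def sandwich_id[OF V])
    also have "\<dots> = sandwich sV m (cmat_mult m T' S) X (cmat_mult m T S')"
      by (simp add: sandwich_sandwich[OF V] flip: eq)
    finally have X'eq: "X' = sandwich sV m (cmat_mult m T' S) X (cmat_mult m T S')" .
    have inv: "cinv_pair m (cmat_mult m T' S) (cmat_mult m T S')"
      by (rule cinv_pair_mult[OF cinv_pair_sym[OF S'] S])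
    have "f m X' = sandwich sW m (cmat_mult m T' S) (f m X) (cmat_mult m T S')"
      unfolding X'eq by (rule nc_function_similarity[OF f m inv X X'[unfolded X'eq]])
    then have "W = sandwich sW m (cmat_mult m S' (cmat_mult m T' S)) (f m X) (cmat_mult m (cmat_mult m T S') T')"
      by (simp add: W' sandwich_sandwich[OF W])
    also have "cmat_mult m S' (cmat_mult m T' S) = S"
      using S S' by (simp add: cinv_pair_def cmat_mult_id flip: cmat_mult_assoc)
    also have "cmat_mult m (cmat_mult m T S') T' = T"
      using S S' by (simp add: cinv_pair_def cmat_mult_id cmat_mult_assoc)
    finally show ?thesis .
  qed
  have "?P (sandwich sW m S (f m X) T)"
    by (intro exI[of _ S] exI[of _ T] exI[of _ X] conjI S X refl)
  then have "?P (nc_ext sV sW \<Omega> f m (sandwich sV m S X T))"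
    unfolding nc_ext_def by (rule someI[where P = ?P])
  then show ?thesis by (rule unique)
qed

section \<open>Higher order operators as corners on amplifications\<close>

definition nilp :: "complex \<Rightarrow> complex mat" where
  "nilp \<epsilon> = (\<lambda>a b. if b = Suc a then \<epsilon> else 0)"

lemma offs_replicate: "a \<le> k \<Longrightarrow> offs (replicate k n) a = a * n"
  by (simp add: offs_def min_def sum_list_replicate)

lemma blk_replicate:
  assumes "0 < n" "i < k * n"
  shows "blk (replicate k n) i = i div n"
  unfolding blk_def
proof (rule Least_equality)
  have "i div n < k" using assms by (simp add: less_mult_imp_div_less)
  then show "i < offs (replicate k n) (Suc (i div n))"
    using assms by (simp add: offs_replicate dividend_less_div_times)
  fix a assume a: "i < offs (replicate k n) (Suc a)"
  have "i < Suc a * n"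
  proof (cases "Suc a \<le> k")
    case True then show ?thesis using a by (simp add: offs_replicate)
  next
    case False
    then have "k * n \<le> Suc a * n" by (intro mult_le_mono1) simp
    then show ?thesis using assms(2) by linarith
  qed
  then show "i div n \<le> a" using less_mult_imp_div_less[of i "Suc a" n] by simp
qed

lemma bidiag_replicate:
  fixes s :: "complex \<Rightarrow> 'v::ab_group_add \<Rightarrow> 'v"
  assumes "vector_space s" "0 < n"
  shows "bidiag (replicate (Suc l) n) (replicate (Suc l) Y) (replicate l Z) = tens s n (Suc l) Y Z (nilp 1)"
proof (intro ext)
  interpret vector_space s by fact
  fix i j
  have sl: "sum_list (replicate (Suc l) n) = Suc l * n" by (simp add: sum_list_replicate)
  show "bidiag (replicate (Suc l) n) (replicate (Suc l) Y) (replicate l Z) i j = tens s n (Suc l) Y Z (nilp 1) i j"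
  proof (cases "i < Suc l * n \<and> j < Suc l * n")
    case True
    then have ij: "i div n < Suc l" "j div n < Suc l" by (auto simp: less_mult_imp_div_less)
    then have "i - offs (replicate (Suc l) n) (i div n) = i mod n" "j - offs (replicate (Suc l) n) (j div n) = j mod n"
      by (auto simp: offs_replicate minus_div_mult_eq_mod simp del: replicate_Suc)
    then show ?thesis
      using True ij blk_replicate[OF assms(2), of i "Suc l"] blk_replicate[OF assms(2), of j "Suc l"]
      unfolding bidiag_def sl Let_def tens_def nilp_def by (auto simp del: replicate_Suc)
  next
    case False
    then show ?thesis unfolding bidiag_def sl tens_def by auto
  qed
qed

text \<open>Conjugation by the diagonal matrix with \<epsilon>^a on block a multiplies block (a,
  a+1) by 1/\<epsilon> and block (0, l) by 1/\<epsilon>^l. It turns the amplification of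
  \<open>nilp \<epsilon>\<close>, available in \<Omega> for small \<epsilon>, into that of
  \<open>nilp 1\<close>, and the second factor gives the stated scaling.\<close>

lemma DeltaR_eq:
  fixes sV :: "complex \<Rightarrow> 'v::ab_group_add \<Rightarrow> 'v" and sW :: "complex \<Rightarrow> 'w::ab_group_add \<Rightarrow> 'w"
  assumes V: "vector_space sV" and W: "vector_space sW" and nc: "nc_set \<Omega>" and f: "nc_function sV sW \<Omega> f"
    and n: "0 < n" and \<epsilon>: "\<epsilon> \<noteq> 0" and X: "tens sV n (Suc l) Y Z (nilp \<epsilon>) \<in> \<Omega> (Suc l * n)"
    and ij: "i < n" "j < n"
  shows "DeltaR sV sW \<Omega> f (replicate (Suc l) n) (replicate (Suc l) Y) (replicate l Z) i j
      = sW (1 / \<epsilon>^l) (f (Suc l * n) (tens sV n (Suc l) Y Z (nilp \<epsilon>)) i (l*n+j))"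
proof -
  interpret V: vector_space sV by fact
  define m where "m = Suc l * n"
  let ?X = "tens sV n (Suc l) Y Z (nilp \<epsilon>)"
  define S :: "complex mat" where "S = (\<lambda>i k. if i < m \<and> k = i then \<epsilon>^(i div n) else 0)"
  define T :: "complex mat" where "T = (\<lambda>i k. if i < m \<and> k = i then 1/\<epsilon>^(i div n) else 0)"
  have "(\<Sum>k<m. S i k * T k j) = (\<Sum>k<m. if k = i then (if j = i then 1 else 0) else 0)" for i j
    using \<epsilon> by (intro sum.cong) (auto simp: S_def T_def)
  moreover have "(\<Sum>k<m. T i k * S k j) = (\<Sum>k<m. if k = i then (if j = i then 1 else 0) else 0)" for i j
    using \<epsilon> by (intro sum.cong) (auto simp: S_def T_def)
  ultimately have ST: "cinv_pair m S T"
    unfolding cinv_pair_def cmat_mult_def cmat_id_def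
    by (auto simp: fun_eq_iff) (auto simp: mat_dim_def S_def T_def)
  have "sandwich sV m S ?X T = tens sV n (Suc l) Y Z (nilp 1)"
  proof (intro ext)
    fix p q
    show "sandwich sV m S ?X T p q = tens sV n (Suc l) Y Z (nilp 1) p q"
    proof (cases "p < m \<and> q < m")
      case True
      then have "sandwich sV m S ?X T p q = sV (\<epsilon>^(p div n) * (1/\<epsilon>^(q div n))) (?X p q)"
        unfolding S_def T_def by (intro sandwich_diag[OF V]) auto
      then show ?thesis using True \<epsilon> by (auto simp: tens_def nilp_def m_def)
    qed (auto simp: sandwich_def tens_def m_def)
  qed
  then have "nc_ext sV sW \<Omega> f m (tens sV n (Suc l) Y Z (nilp 1)) = sandwich sW m S (f m ?X) T"
    using nc_ext_eq[OF V W nc f _ ST, of ?X] X n by (simp add: m_def)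
  moreover have "sandwich sW m S (f m ?X) T i (l*n+j) = sW (\<epsilon>^(i div n) * (1/\<epsilon>^((l*n+j) div n))) (f m ?X i (l*n+j))"
    unfolding S_def T_def by (rule sandwich_diag[OF W]) (use ij in \<open>auto simp: m_def\<close>)
  moreover have "sum_list (replicate (Suc l) n) = m" by (simp add: sum_list_replicate m_def)
  ultimately show ?thesis
    unfolding DeltaR_def Let_def bidiag_replicate[OF V n] using ij
    by (simp add: offs_replicate m_def add.commute del: replicate_Suc)
qed

section \<open>Taylor expansion along slices\<close>

context cbanach
begin

lemma asymptotic_expansion_0:
  assumes "asymptotic_expansion g p"
  shows "p 0 = g 0"
proof -
  obtain M r where "r > 0" "\<And>t. cmod t < r \<Longrightarrow> norm (g t - (\<Sum>l<1. s (t^l) (p l))) \<le> M * cmod t ^ 1"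
    using assms unfolding asymptotic_expansion_def by blast
  from this(2)[of 0] this(1) show ?thesis by simp
qed

lemma asymptotic_expansion_has_derivative:
  assumes "asymptotic_expansion g p"
  shows "(g has_derivative (\<lambda>h. s h (p 1))) (at 0)"
proof -
  obtain M r where r: "r > 0" and M: "\<And>t. cmod t < r \<Longrightarrow> norm (g t - (\<Sum>l<2. s (t^l) (p l))) \<le> M * cmod t ^ 2"
    using assms unfolding asymptotic_expansion_def by blast
  have bd: "norm (g t - g 0 - s (t - 0) (p 1)) / norm (t - 0) \<le> M * cmod t" if "cmod t < r" "t \<noteq> 0" for t
  proof -
    have "norm (g t - g 0 - s t (p 1)) \<le> M * cmod t ^ 2"
      using M[OF that(1)] asymptotic_expansion_0[OF assms] by (simp add: numeral_2_eq_2 algebra_simps)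
    then show ?thesis using that(2) by (simp add: divide_simps power2_eq_square mult_ac)
  qed
  show ?thesis
    unfolding has_derivative_iff_norm
  proof (intro conjI sc.bounded_linear_left)
    show "((\<lambda>t. norm (g t - g 0 - s (t - 0) (p 1)) / norm (t - 0)) \<longlongrightarrow> 0) (at 0)"
    proof (rule Lim_null_comparison)
      show "\<forall>\<^sub>F t in at 0. norm (norm (g t - g 0 - s (t - 0) (p 1)) / norm (t - 0)) \<le> M * cmod t"
        unfolding eventually_at using r bd by (intro exI[of _ r]) auto
      show "((\<lambda>t. M * cmod t) \<longlongrightarrow> 0) (at 0)" by (auto intro!: tendsto_eq_intros)
    qed
  qed
qed

end

section \<open>The remainder recursion\<close>

text \<open>For l = 0 this is the 1 x 1 matrix t, whose amplification is Y + tZ itself; this is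
  where the recursion for the remainders starts.\<close>

definition lastpert :: "nat \<Rightarrow> complex \<Rightarrow> complex \<Rightarrow> complex mat" where
  "lastpert l \<epsilon> t = (\<lambda>a b. if b = Suc a then \<epsilon> else if a = l \<and> b = l then t else 0)"

locale nc_fun = admissible sW nrm for sW :: "complex \<Rightarrow> 'w::banach \<Rightarrow> 'w" and nrm +
  fixes sV :: "complex \<Rightarrow> 'v::ab_group_add \<Rightarrow> 'v"
    and \<Omega> :: "nat \<Rightarrow> 'v mat set" and f :: "nat \<Rightarrow> 'v mat \<Rightarrow> 'w mat"
  assumes V: "vector_space sV" and nc: "nc_set \<Omega>" and fo: "finitely_open sV \<Omega>"
    and ncf: "nc_function sV sW \<Omega> f" and lb: "locally_bounded_on_slices sV nrm \<Omega> f"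
begin

sublocale V: vector_space sV by (rule V)
sublocale M: vector_space "mscale sV" by (rule vector_space_mscale[OF V])

lemma W: "vector_space sW" by (rule vector_space_axioms)

definition Delta :: "nat \<Rightarrow> nat \<Rightarrow> 'v mat \<Rightarrow> 'v mat \<Rightarrow> 'w mat" where
  "Delta n l Y Z = DeltaR sV sW \<Omega> f (replicate (Suc l) n) (replicate (Suc l) Y) (replicate l Z)"

lemma Omega_mat_dim: "X \<in> \<Omega> n \<Longrightarrow> X \<in> mat_dim n n"
  using nc unfolding nc_set_def by blast

lemma f_mat_dim: "n > 0 \<Longrightarrow> X \<in> \<Omega> n \<Longrightarrow> f n X \<in> mat_dim n n"
  using ncf unfolding nc_function_def by (elim conjE) simp

lemma Delta_mat_dim: "Delta n l Y Z \<in> mat_dim n n"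
  by (auto simp: Delta_def DeltaR_def Let_def mat_dim_def simp flip: replicate_Suc)

lemma fin_open: "n > 0 \<Longrightarrow> fin_open_level sV n (\<Omega> n)"
  using fo unfolding finitely_open_def by blast

lemma open_slice:
  "n > 0 \<Longrightarrow> X \<in> mat_dim n n \<Longrightarrow> Z \<in> mat_dim n n \<Longrightarrow> open {t. X + mscale sV t Z \<in> \<Omega> n}"
  by (rule fin_open_level_slice[OF V fin_open])

lemma eventually_slice:
  assumes "n > 0" "X \<in> \<Omega> n" "Z \<in> mat_dim n n"
  shows "\<forall>\<^sub>F t in nhds 0. X + mscale sV t Z \<in> \<Omega> n"
  using eventually_nhds_in_open[OF open_slice[OF assms(1) Omega_mat_dim[OF assms(2)] assms(3)], of 0] assms(2)
  by simp

lemma tens_zero_in_Omega: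
  assumes "n > 0" "Y \<in> \<Omega> n"
  shows "tens sV n (Suc d) Y Z (\<lambda>_ _. 0) \<in> \<Omega> (Suc d * n)"
proof (induction d)
  case 0
  have "tens sV n (Suc 0) Y Z (\<lambda>_ _. 0) = Y"
    using Omega_mat_dim[OF assms(2)] by (auto simp: tens_def mat_dim_def fun_eq_iff)
  then show ?case using assms by simp
next
  case (Suc d)
  have "dsum n Y (tens sV n (Suc d) Y Z (\<lambda>_ _. 0)) \<in> \<Omega> (n + Suc d * n)"
    using nc assms Suc unfolding nc_set_def by simp
  then show ?case
    unfolding dsum_tens_zero[OF V Omega_mat_dim[OF assms(2)] assms(1)] by simp
qed

lemma tens_nilp:
  "tens sV n d Y Z (nilp \<epsilon>) = tens sV n d Y Z (\<lambda>_ _. 0) + mscale sV \<epsilon> (tens sV n d 0 Z (nilp 1))"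
  unfolding tens_add_coeff[OF V] by (rule tens_cong) (simp add: nilp_def)

lemma tens_lastpert:
  "tens sV n d Y Z (lastpert l \<epsilon> t) = tens sV n d Y Z (nilp \<epsilon>) + mscale sV t (tens sV n d 0 Z (munit l l))"
  unfolding tens_add_coeff[OF V] by (rule tens_cong) (auto simp: nilp_def lastpert_def munit_def)

lemma eventually_tens_nilp:
  assumes "n > 0" "Y \<in> \<Omega> n"
  shows "\<forall>\<^sub>F \<epsilon> in nhds 0. tens sV n (Suc l) Y Z (nilp \<epsilon>) \<in> \<Omega> (Suc l * n)"
  using eventually_slice[OF _ tens_zero_in_Omega[OF assms, of l Z] tens_mat_dim[of sV n "Suc l" 0 Z "nilp 1"]] assms
  unfolding tens_nilp[symmetric] by simp

lemma eventually_tens_lastpert: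
  assumes "n > 0" "tens sV n (Suc l) Y Z (nilp \<epsilon>) \<in> \<Omega> (Suc l * n)"
  shows "\<forall>\<^sub>F t in nhds 0. tens sV n (Suc l) Y Z (lastpert l \<epsilon> t) \<in> \<Omega> (Suc l * n)"
  unfolding tens_lastpert
  by (rule eventually_slice[OF _ assms(2) tens_mat_dim]) (use assms in simp)

lemma eventually_nhds_0_nonzero:
  assumes "\<forall>\<^sub>F \<epsilon> in nhds (0::complex). P \<epsilon>"
  shows "\<exists>\<epsilon>. \<epsilon> \<noteq> 0 \<and> P \<epsilon>"
proof -
  have "\<forall>\<^sub>F \<epsilon> in at (0::complex). P \<epsilon> \<and> \<epsilon> \<noteq> 0"
    using assms unfolding eventually_at_filter by (rule eventually_mono) simp
  then show ?thesis using eventually_happens'[OF at_neq_bot] by blast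
qed

text \<open>A single \<epsilon> has to serve all levels up to N, because the remainder recursion
  relates consecutive levels with the same \<epsilon>. It is nonzero since powers of it are divided
  by.\<close>

lemma ex_tens_nilp:
  assumes "n > 0" "Y \<in> \<Omega> n"
  shows "\<exists>\<epsilon>. \<epsilon> \<noteq> 0 \<and> (\<forall>l\<le>N. tens sV n (Suc l) Y Z (nilp \<epsilon>) \<in> \<Omega> (Suc l * n))"
proof -
  have "\<forall>\<^sub>F \<epsilon> in nhds 0. \<forall>l\<in>{..N}. tens sV n (Suc l) Y Z (nilp \<epsilon>) \<in> \<Omega> (Suc l * n)"
    by (intro eventually_ball_finite ballI eventually_tens_nilp assms) auto
  from eventually_nhds_0_nonzero[OF this] show ?thesis by auto
qed

lemma Delta_eq:
  assumes "0 < n" "\<epsilon> \<noteq> 0" "tens sV n (Suc l) Y Z (nilp \<epsilon>) \<in> \<Omega> (Suc l * n)" "i < n" "j < n"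
  shows "Delta n l Y Z i j = sW (1 / \<epsilon>^l) (f (Suc l * n) (tens sV n (Suc l) Y Z (nilp \<epsilon>)) i (l*n+j))"
  unfolding Delta_def by (rule DeltaR_eq[OF V W nc ncf assms])

text \<open>The bidiagonal matrix \<^term>\<open>lastpert l \<epsilon> t\<close> represents multiplication by $x$ on
  polynomials modulo $x^l(x-t)$; the intertwiner \<open>T\<close> represents the embedding
  $p \mapsto xp$ into polynomials modulo $x^{l+1}(x-t)$.\<close>

lemma remainder_step:
  assumes n: "0 < n" and \<epsilon>: "\<epsilon> \<noteq> 0"
    and X0: "tens sV n (Suc l) Y Z (nilp \<epsilon>) \<in> \<Omega> (Suc l * n)"
    and X1: "tens sV n (Suc l) Y Z (lastpert l \<epsilon> t) \<in> \<Omega> (Suc l * n)"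
    and X2: "tens sV n (Suc (Suc l)) Y Z (lastpert (Suc l) \<epsilon> t) \<in> \<Omega> (Suc (Suc l) * n)"
    and ij: "i < n" "j < n"
  shows "sW (1 / \<epsilon>^l) (f (Suc l * n) (tens sV n (Suc l) Y Z (lastpert l \<epsilon> t)) i (l*n+j))
    = Delta n l Y Z i j + sW t (sW (1 / \<epsilon>^Suc l) (f (Suc (Suc l) * n) (tens sV n (Suc (Suc l)) Y Z (lastpert (Suc l) \<epsilon> t)) i (Suc l*n+j)))"
proof -
  let ?F0 = "f (Suc l * n) (tens sV n (Suc l) Y Z (nilp \<epsilon>))"
  let ?F1 = "f (Suc l * n) (tens sV n (Suc l) Y Z (lastpert l \<epsilon> t))"
  let ?F2 = "f (Suc (Suc l) * n) (tens sV n (Suc (Suc l)) Y Z (lastpert (Suc l) \<epsilon> t))"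
  define T where "T c b = (if c = b then \<epsilon> else if c = Suc l \<and> b = l then t else 0)" for c b
  \<comment> \<open>Block row 0 and block column l: row 0 of T has the single entry \<epsilon>,
    column l the entries \<epsilon> and t, so only three blocks of values of f remain.\<close>
  have "(\<Sum>c<Suc (Suc l). sW (T c l) (?F2 (0*n+i) (c*n+j))) = (\<Sum>c<Suc l. sW (T 0 c) (?F1 (c*n+i) (l*n+j)))"
  proof (rule nc_function_tens_intertwines[OF V W nc ncf n X2 X1 _ _ _ ij])
    fix a b assume ab: "a < Suc (Suc l)" "b < Suc l"
    have "(\<Sum>c<Suc (Suc l). lastpert (Suc l) \<epsilon> t a c * T c b)
      = (\<Sum>c<Suc (Suc l). (if c = b then lastpert (Suc l) \<epsilon> t a b * \<epsilon> else 0)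
          + (if c = Suc l then (if b = l then lastpert (Suc l) \<epsilon> t a (Suc l) * t else 0) else 0))"
      using ab by (intro sum.cong refl) (auto simp: T_def)
    also have "\<dots> = lastpert (Suc l) \<epsilon> t a b * \<epsilon> + (if b = l then lastpert (Suc l) \<epsilon> t a (Suc l) * t else 0)"
      unfolding sum.distrib using ab by (simp del: sum.lessThan_Suc)
    finally have 1: "(\<Sum>c<Suc (Suc l). lastpert (Suc l) \<epsilon> t a c * T c b) = \<dots>" .
    have "(\<Sum>c<Suc l. T a c * lastpert l \<epsilon> t c b)
      = (\<Sum>c<Suc l. if c = (if a = Suc l then l else a) then (if a = Suc l then t * lastpert l \<epsilon> t l b else \<epsilon> * lastpert l \<epsilon> t a b) else 0)"
      using ab by (intro sum.cong refl) (auto simp: T_def)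
    also have "\<dots> = (if a = Suc l then t * lastpert l \<epsilon> t l b else \<epsilon> * lastpert l \<epsilon> t a b)"
      using ab by (simp del: sum.lessThan_Suc)
    finally show "(\<Sum>c<Suc (Suc l). lastpert (Suc l) \<epsilon> t a c * T c b) = (\<Sum>c<Suc l. T a c * lastpert l \<epsilon> t c b)"
      unfolding 1 using ab by (auto simp: lastpert_def)
  qed auto
  also have "(\<Sum>c<Suc l. sW (T 0 c) (?F1 (c*n+i) (l*n+j))) = (\<Sum>c<Suc l. if c = 0 then sW \<epsilon> (?F1 i (l*n+j)) else 0)"
    by (intro sum.cong refl) (auto simp: T_def)
  also have "\<dots> = sW \<epsilon> (?F1 i (l*n+j))" by (simp del: sum.lessThan_Suc)
  also have "(\<Sum>c<Suc (Suc l). sW (T c l) (?F2 (0*n+i) (c*n+j))) = sW \<epsilon> (?F2 i (l*n+j)) + sW t (?F2 i (Suc l*n+j))"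
    by (simp add: T_def)
  finally have A: "sW \<epsilon> (?F2 i (l*n+j)) + sW t (?F2 i (Suc l*n+j)) = sW \<epsilon> (?F1 i (l*n+j))" .
  \<comment> \<open>The second intertwiner is the inclusion of the first l + 1 coordinates. The
    perturbation sits in the last diagonal entry only, so on these coordinates the larger matrix
    acts as the unperturbed shift, and block (0,l) of the value of f does not depend on t.\<close>
  have "(\<Sum>c<Suc (Suc l). sW (if c = l then 1 else 0) (?F2 (0*n+i) (c*n+j))) = (\<Sum>c<Suc l. sW (if 0 = c then 1 else 0) (?F0 (c*n+i) (l*n+j)))"
  proof (rule nc_function_tens_intertwines[OF V W nc ncf n X2 X0 _ _ _ ij])
    fix a b assume ab: "a < Suc (Suc l)" "b < Suc l"
    have "(\<Sum>c<Suc (Suc l). lastpert (Suc l) \<epsilon> t a c * (if c = b then 1 else 0)) = (\<Sum>c<Suc (Suc l). if c = b then lastpert (Suc l) \<epsilon> t a b else 0)"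
      by (intro sum.cong) auto
    moreover have "(\<Sum>c<Suc l. (if a = c then 1 else 0) * nilp \<epsilon> c b) = (\<Sum>c<Suc l. if c = a then nilp \<epsilon> a b else 0)"
      by (intro sum.cong) auto
    ultimately show "(\<Sum>c<Suc (Suc l). lastpert (Suc l) \<epsilon> t a c * (if c = b then 1 else 0)) = (\<Sum>c<Suc l. (if a = c then 1 else 0) * nilp \<epsilon> c b)"
      using ab by (auto simp: lastpert_def nilp_def simp del: sum.lessThan_Suc)
  qed auto
  also have "(\<Sum>c<Suc l. sW (if 0 = c then 1 else 0) (?F0 (c*n+i) (l*n+j))) = (\<Sum>c<Suc l. if c = 0 then ?F0 i (l*n+j) else 0)"
    by (intro sum.cong) auto
  also have "\<dots> = ?F0 i (l*n+j)" by (simp del: sum.lessThan_Suc)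
  also have "(\<Sum>c<Suc (Suc l). sW (if c = l then 1 else 0) (?F2 (0*n+i) (c*n+j))) = ?F2 i (l*n+j)"
    by simp
  finally have B: "?F2 i (l*n+j) = ?F0 i (l*n+j)" .
  have "sW (1 / \<epsilon>^Suc l) (sW \<epsilon> (?F1 i (l*n+j))) = sW (1 / \<epsilon>^Suc l) (sW \<epsilon> (?F0 i (l*n+j))) + sW (1 / \<epsilon>^Suc l) (sW t (?F2 i (Suc l*n+j)))"
    unfolding A[symmetric] B scale_right_distrib ..
  then show ?thesis
    unfolding Delta_eq[OF n \<epsilon> X0 ij] using \<epsilon> by (simp add: mult.commute)
qed

text \<open>N steps of the recursion, with \<epsilon> fixed for the given N before t is restricted.
  The remainder bound contains 1/\<epsilon>^N and a local bound of f at size (N+1)n, so nothing is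
  uniform in N and the expansion is only asymptotic.\<close>

lemma slice_asymptotic_expansion:
  assumes n: "0 < n" and Y: "Y \<in> \<Omega> n" and Z: "Z \<in> mat_dim n n" and ij: "i < n" "j < n"
  shows "asymptotic_expansion (\<lambda>t. f n (Y + mscale sV t Z) i j) (\<lambda>l. Delta n l Y Z i j)"
  unfolding asymptotic_expansion_def
proof
  fix N
  obtain \<epsilon> where \<epsilon>: "\<epsilon> \<noteq> 0" and X0: "\<And>l. l \<le> N \<Longrightarrow> tens sV n (Suc l) Y Z (nilp \<epsilon>) \<in> \<Omega> (Suc l * n)"
    using ex_tens_nilp[OF n Y] by blast
  have "\<forall>\<^sub>F t in nhds 0. \<forall>l\<in>{..N}. tens sV n (Suc l) Y Z (lastpert l \<epsilon> t) \<in> \<Omega> (Suc l * n)"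
    by (intro eventually_ball_finite ballI eventually_tens_lastpert n X0) auto
  then obtain r1 where r1: "r1 > 0" and X1: "\<And>t l. cmod t < r1 \<Longrightarrow> l \<le> N \<Longrightarrow> tens sV n (Suc l) Y Z (lastpert l \<epsilon> t) \<in> \<Omega> (Suc l * n)"
    unfolding eventually_nhds_metric by (auto simp: dist_norm)
  let ?m = "Suc N * n"
  have m: "0 < ?m" using n by simp
  \<comment> \<open>The perturbed amplifications form a slice in the direction of the last diagonal
    unit, based at the amplification of \<open>nilp \<epsilon>\<close>; local boundedness of f is
    applied to it.\<close>
  obtain r2 M where r2: "r2 > 0" and M: "\<And>t. cmod t < r2 \<Longrightarrow> tens sV n (Suc N) Y Z (lastpert N \<epsilon> t) \<in> \<Omega> ?m \<Longrightarrow>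
      nrm ?m (f ?m (tens sV n (Suc N) Y Z (lastpert N \<epsilon> t))) \<le> M"
    using lb[unfolded locally_bounded_on_slices_def, rule_format, OF m X0[OF order.refl] tens_mat_dim[of sV n "Suc N" 0 Z "munit N N"]]
    unfolding tens_lastpert by blast
  obtain C where C: "C > 0" "\<And>X i j. X \<in> mat_dim ?m ?m \<Longrightarrow> i < ?m \<Longrightarrow> j < ?m \<Longrightarrow> norm (X i j) \<le> C * nrm ?m X"
    using norm_entry_le_nrm[OF m] by blast
  define R where "R l t = sW (1 / \<epsilon>^l) (f (Suc l * n) (tens sV n (Suc l) Y Z (lastpert l \<epsilon> t)) i (l*n+j))" for l t
  have step: "R l t = Delta n l Y Z i j + sW t (R (Suc l) t)" if "l < N" "cmod t < r1" for l t
    unfolding R_def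
    by (rule remainder_step[OF n \<epsilon> X0 X1 X1 ij]) (use that in auto)
  have R0: "R 0 t = f n (Y + mscale sV t Z) i j" for t
  proof -
    have "tens sV n (Suc 0) Y Z (lastpert 0 \<epsilon> t) = Y + mscale sV t Z"
      by (subst tens_1[OF V Omega_mat_dim[OF Y] Z]) (simp add: lastpert_def)
    then show ?thesis by (simp add: R_def)
  qed
  have expand: "R 0 t = (\<Sum>l<k. sW (t^l) (Delta n l Y Z i j)) + sW (t^k) (R k t)" if "k \<le> N" "cmod t < r1" for k t
    using that(1)
  proof (induction k)
    case (Suc k)
    then show ?case using step[of k t] that(2) by (simp add: scale_right_distrib mult_ac)
  qed simp
  have "norm (f n (Y + mscale sV t Z) i j - (\<Sum>l<N. sW (t^l) (Delta n l Y Z i j))) \<le> (cmod (1 / \<epsilon>^N) * (C * M)) * cmod t ^ N"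
    if t: "cmod t < min r1 r2" for t
  proof -
    have X1N: "tens sV n (Suc N) Y Z (lastpert N \<epsilon> t) \<in> \<Omega> ?m" using X1[of t N] t by simp
    have "norm (f ?m (tens sV n (Suc N) Y Z (lastpert N \<epsilon> t)) i (N*n+j)) \<le> C * nrm ?m (f ?m (tens sV n (Suc N) Y Z (lastpert N \<epsilon> t)))"
      by (rule C(2)[OF f_mat_dim[OF m X1N]]) (use ij in auto)
    also have "\<dots> \<le> C * M" using M[OF _ X1N] t C(1) by (intro mult_left_mono) auto
    finally have "norm (R N t) \<le> cmod (1 / \<epsilon>^N) * (C * M)"
      unfolding R_def norm_scale by (intro mult_left_mono) auto
    then have "cmod t ^ N * norm (R N t) \<le> cmod t ^ N * (cmod (1 / \<epsilon>^N) * (C * M))" by (intro mult_left_mono) auto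
    moreover have "f n (Y + mscale sV t Z) i j - (\<Sum>l<N. sW (t^l) (Delta n l Y Z i j)) = sW (t^N) (R N t)"
      using expand[of N t] t by (simp add: R0)
    ultimately show ?thesis by (simp add: norm_power mult.commute)
  qed
  then show "\<exists>M r. r > 0 \<and> (\<forall>t. cmod t < r \<longrightarrow> norm (f n (Y + mscale sV t Z) i j - (\<Sum>l<N. sW (t^l) (Delta n l Y Z i j))) \<le> M * cmod t ^ N)"
    using r1 r2 by (intro exI[of _ "cmod (1 / \<epsilon>^N) * (C * M)"] exI[of _ "min r1 r2"]) auto
qed

lemma slice_shift: "Y + mscale sV (t + u) Z = (Y + mscale sV t Z) + mscale sV u Z"
  by (simp only: M.scale_left_distrib add.assoc)

lemma slice_has_derivative:
  assumes n: "0 < n" and Y: "Y + mscale sV t Z \<in> \<Omega> n" and Z: "Z \<in> mat_dim n n" and ij: "i < n" "j < n"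
  shows "((\<lambda>t. f n (Y + mscale sV t Z) i j) has_derivative (\<lambda>h. sW h (Delta n 1 (Y + mscale sV t Z) Z i j))) (at t)"
proof -
  have 1: "((\<lambda>u. f n (Y + mscale sV t Z + mscale sV u Z) i j) has_derivative (\<lambda>h. sW h (Delta n 1 (Y + mscale sV t Z) Z i j))) (at (t - t))"
    using asymptotic_expansion_has_derivative[OF slice_asymptotic_expansion[OF n Y Z ij]] by simp
  have 2: "((\<lambda>u. u - t) has_derivative (\<lambda>h. h)) (at t)" by (auto intro!: derivative_eq_intros)
  have 3: "Y + mscale sV t Z + mscale sV (u - t) Z = Y + mscale sV u Z" for u
    unfolding slice_shift[symmetric] by simp
  show ?thesis using has_derivative_compose[OF 2 1] unfolding 3 .
qed

text \<open>The derivative at t is \<open>Delta n 1\<close> with base point Y + tZ, hence a corner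
  of f at size 2n. An \<epsilon> chosen for t0 remains usable near t0 by openness, and there the
  corner runs along a slice, which is differentiable and so continuous.\<close>

lemma slice_C1_on:
  assumes n: "0 < n" and Y: "Y \<in> mat_dim n n" and Z: "Z \<in> mat_dim n n" and ij: "i < n" "j < n"
  shows "C1_on {t. Y + mscale sV t Z \<in> \<Omega> n} (\<lambda>t. f n (Y + mscale sV t Z) i j)"
  unfolding C1_on_def
proof (intro exI conjI ballI)
  let ?O = "{t. Y + mscale sV t Z \<in> \<Omega> n}"
  let ?D = "\<lambda>t. Delta n 1 (Y + mscale sV t Z) Z i j"
  show "((\<lambda>t. f n (Y + mscale sV t Z) i j) has_derivative (\<lambda>h. sW h (?D t))) (at t)" if "t \<in> ?O" for t
    by (rule slice_has_derivative) (use n Z ij that in auto)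
  show "continuous_on ?O ?D"
    unfolding continuous_on_eq_continuous_within
  proof
    fix t0 assume "t0 \<in> ?O"
    then have Y0: "Y + mscale sV t0 Z \<in> \<Omega> n" by simp
    obtain \<epsilon> where \<epsilon>: "\<epsilon> \<noteq> 0" and X0: "tens sV n (Suc 1) (Y + mscale sV t0 Z) Z (nilp \<epsilon>) \<in> \<Omega> (Suc 1 * n)"
      using ex_tens_nilp[OF n Y0] by blast
    \<comment> \<open>Moving the base point along Z adds t to every diagonal coefficient, so the
      direction of the larger slice is the block diagonal matrix with copies of Z.\<close>
    let ?Y = "tens sV n (Suc 1) Y Z (nilp \<epsilon>)" and ?Z = "tens sV n (Suc 1) 0 Z (\<lambda>a b. if a = b then 1 else 0)"
    have eq: "tens sV n (Suc 1) (Y + mscale sV t Z) Z (nilp \<epsilon>) = ?Y + mscale sV t ?Z" for t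
      unfolding tens_shift[OF V] tens_add_coeff[OF V] by (rule tens_cong) auto
    let ?U = "{t. ?Y + mscale sV t ?Z \<in> \<Omega> (Suc 1 * n)}"
    have U: "open ?U" by (rule open_slice[OF _ tens_mat_dim tens_mat_dim]) (use n in simp)
    have t0: "t0 \<in> ?U" using X0 unfolding eq by simp
    have m: "0 < Suc 1 * n" "i < Suc 1 * n" "1 * n + j < Suc 1 * n" using n ij by auto
    have "((\<lambda>t. f (Suc 1 * n) (?Y + mscale sV t ?Z) i (1 * n + j)) has_derivative
        (\<lambda>h. sW h (Delta (Suc 1 * n) 1 (?Y + mscale sV t0 ?Z) ?Z i (1 * n + j)))) (at t0)"
      by (rule slice_has_derivative[OF m(1) _ tens_mat_dim m(2,3)]) (use t0 in simp)
    then have "isCont (\<lambda>t. f (Suc 1 * n) (?Y + mscale sV t ?Z) i (1 * n + j)) t0"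
      by (rule has_derivative_continuous)
    then have "isCont (\<lambda>t. sW (1 / \<epsilon>^1) (f (Suc 1 * n) (?Y + mscale sV t ?Z) i (1 * n + j))) t0"
      by (intro sc.continuous continuous_intros)
    moreover have "\<forall>\<^sub>F t in nhds t0. sW (1 / \<epsilon>^1) (f (Suc 1 * n) (?Y + mscale sV t ?Z) i (1 * n + j)) = ?D t"
      using eventually_nhds_in_open[OF U t0]
    proof eventually_elim
      case (elim t)
      then show ?case using Delta_eq[OF n \<epsilon>, of 1 "Y + mscale sV t Z" Z i j] ij unfolding eq by simp
    qed
    ultimately have "isCont ?D t0" by (subst (asm) isCont_cong) auto
    then show "continuous (at t0 within ?O) ?D" by (rule continuous_at_imp_continuous_at_within)
  qed
qed

end

section \<open>Continuity on finite-dimensional subspaces\<close>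

text \<open>Cauchy's estimates on a closed disc need differentiability on a slightly larger open
  one. A compact set has a uniform margin e inside an open set; a point outside the disc is compared
  with its radial projection to the circle.\<close>

lemma open_cball_enlarge:
  fixes U :: "complex set"
  assumes "open U" "cball 0 r \<subseteq> U" "0 \<le> r"
  shows "\<exists>R>r. ball 0 R \<subseteq> U"
proof -
  obtain e where e: "e > 0" "(\<Union>x\<in>cball 0 r. ball x e) \<subseteq> U"
    using compact_subset_open_imp_ball_epsilon_subset[OF compact_cball assms(1,2)] by blast
  have "t \<in> U" if t: "cmod t < r + e" for t
  proof (cases "cmod t \<le> r")
    case False
    define x where "x = complex_of_real (r / cmod t) * t"
    have "t \<noteq> 0" using False assms(3) by auto
    then have x: "cmod x = r" using assms(3) by (simp add: x_def norm_mult norm_divide)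
    have "t - x = complex_of_real (1 - r / cmod t) * t" by (simp add: x_def algebra_simps)
    then have "cmod (t - x) = \<bar>1 - r / cmod t\<bar> * cmod t" by (simp only: norm_mult norm_of_real)
    moreover have "\<bar>1 - r / cmod t\<bar> = 1 - r / cmod t" using False \<open>t \<noteq> 0\<close> by (intro abs_of_nonneg) (simp add: divide_le_eq)
    ultimately have "cmod (t - x) = cmod t - r" using \<open>t \<noteq> 0\<close> by (simp add: left_diff_distrib)
    then have "x \<in> cball 0 r" "t \<in> ball x e" using t x by (auto simp: dist_norm norm_minus_commute)
    then show ?thesis using e(2) by blast
  qed (use assms in auto)
  then show ?thesis using e(1) by (intro exI[of _ "r + e"]) auto
qed

text \<open>A basic open set of the product topology restricts finitely many coordinates, and the
  minimum of their radii is a common one.\<close>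

lemma open_fun_box:
  fixes S :: "(nat \<Rightarrow> complex) set"
  assumes "open S" "a \<in> S"
  shows "\<exists>\<eta>>0. \<forall>c. (\<forall>i. dist (c i) (a i) < \<eta>) \<longrightarrow> c \<in> S"
proof -
  obtain U where U: "finite {i. U i \<noteq> UNIV}" "\<And>i. open (U i)" "a \<in> Pi\<^sub>E UNIV U" "Pi\<^sub>E UNIV U \<subseteq> S"
    using assms unfolding open_fun_def openin_product_topology_alt by auto
  let ?I = "{i. U i \<noteq> UNIV}"
  have "\<exists>e>0. ball (a i) e \<subseteq> U i" for i
    using U(2)[of i] U(3) open_contains_ball[of "U i"] by (auto simp: PiE_iff)
  then obtain e where e: "\<And>i. e i > 0" "\<And>i. ball (a i) (e i) \<subseteq> U i" by metis
  define \<eta> where "\<eta> = Min (insert 1 (e ` ?I))"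
  have "\<eta> > 0" unfolding \<eta>_def using U(1) e(1) by (subst Min_gr_iff) auto
  moreover have "c \<in> S" if c: "\<And>i. dist (c i) (a i) < \<eta>" for c
  proof -
    have "c i \<in> U i" for i
    proof (cases "i \<in> ?I")
      case True
      then have "\<eta> \<le> e i" unfolding \<eta>_def using U(1) by (intro Min_le) auto
      then have "c i \<in> ball (a i) (e i)" using c[of i] by (simp add: dist_commute)
      then show ?thesis using e(2) by blast
    qed auto
    then show ?thesis using U(4) by (auto simp: PiE_iff)
  qed
  ultimately show ?thesis by blast
qed

text \<open>Interpolation at the (l+1)-st roots of unity: \<open>L j\<close> is the Lagrange basis
  polynomial in discrete Fourier form, and orthogonality of characters reproduces the monomials up
  to degree l. A polynomial is thus expressed through its values at fixed nodes with continuous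
  weights.\<close>

lemma interpolation_exists:
  "\<exists>x L. (\<forall>j. continuous_on UNIV (L j)) \<and> (\<forall>m\<le>l. \<forall>t. (\<Sum>j\<le>l. L j t * x j ^ m) = (t::complex) ^ m)"
proof -
  define K where "K = real (Suc l)"
  define x where "x j = cis (2*pi * real j / K)" for j
  define L where "L j t = (1 / complex_of_real K) * (\<Sum>m\<le>l. t^m * cnj (x j) ^ m)" for j t
  have orth: "(\<Sum>j\<le>l. cnj (x j) ^ m * x j ^ m') = (if m = m' then complex_of_real K else 0)" if "m \<le> l" "m' \<le> l" for m m'
  proof -
    define z where "z = cis (2*pi * (real m' - real m) / K)"
    have "cnj (x j) ^ m * x j ^ m' = z ^ j" for j
      unfolding x_def z_def cis_cnj Complex.DeMoivre cis_mult
      by (rule arg_cong[where f = cis]) (simp add: K_def divide_simps, simp add: algebra_simps)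
    then have sum: "(\<Sum>j\<le>l. cnj (x j) ^ m * x j ^ m') = (\<Sum>j<Suc l. z ^ j)"
      by (simp add: lessThan_Suc_atMost)
    show ?thesis
    proof (cases "m = m'")
      case True
      then show ?thesis unfolding sum by (simp add: z_def K_def)
    next
      case False
      \<comment> \<open>z = 1 would make m' - m a multiple of l + 1, impossible for distinct indices
        up to l.\<close>
      have "z \<noteq> 1"
      proof
        assume "z = 1"
        then have "cos (2*pi * (real m' - real m) / K) = 1" by (simp add: z_def complex_eq_iff)
        then obtain q :: int where "2*pi * (real m' - real m) / K = of_int q * 2 * pi"
          using cos_one_2pi_int by blast
        then have "2 * pi * (real m' - real m) = 2 * pi * (of_int q * K)" by (simp add: K_def field_simps)
        then have "real m' - real m = of_int q * K" by simp
        then have "of_int (int m' - int m) = (of_int (q * int (Suc l)) :: real)" by (simp add: K_def)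
        then have eq: "int m' - int m = q * int (Suc l)" by (simp only: of_int_eq_iff)
        have "\<bar>int m' - int m\<bar> < int (Suc l)" using that by linarith
        then have "\<bar>q\<bar> * int (Suc l) < 1 * int (Suc l)" unfolding eq abs_mult by simp
        then have "\<bar>q\<bar> < 1" by (rule mult_right_less_imp_less) simp
        then have "q = 0" by simp
        then show False using eq False by simp
      qed
      moreover have "z ^ Suc l = 1"
      proof -
        have "z ^ Suc l = cis (2*pi * (real_of_int (int m' - int m)))"
          unfolding z_def Complex.DeMoivre by (rule arg_cong[where f = cis]) (simp add: K_def)
        also have "\<dots> = 1" by (rule cis_multiple_2pi) simp
        finally show ?thesis .
      qed
      ultimately show ?thesis unfolding sum using False by (subst geometric_sum) auto
    qed
  qed
  have "(\<Sum>j\<le>l. L j t * x j ^ m') = t ^ m'" if m': "m' \<le> l" for m' t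
  proof -
    have "(\<Sum>j\<le>l. L j t * x j ^ m') = (1 / complex_of_real K) * (\<Sum>j\<le>l. \<Sum>m\<le>l. t^m * (cnj (x j) ^ m * x j ^ m'))"
      unfolding L_def by (simp add: sum_distrib_left sum_distrib_right mult_ac)
    also have "(\<Sum>j\<le>l. \<Sum>m\<le>l. t^m * (cnj (x j) ^ m * x j ^ m')) = (\<Sum>m\<le>l. \<Sum>j\<le>l. t^m * (cnj (x j) ^ m * x j ^ m'))"
      by (rule sum.swap)
    also have "\<dots> = (\<Sum>m\<le>l. if m = m' then t^m' * complex_of_real K else 0)"
      unfolding sum_distrib_left[symmetric] by (intro sum.cong refl) (use m' in \<open>auto simp: orth\<close>)
    also have "\<dots> = t^m' * complex_of_real K" using m' by simp
    finally have "(\<Sum>j\<le>l. L j t * x j ^ m') = (1 / complex_of_real K) * (t^m' * complex_of_real K)" .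
    moreover have "complex_of_real K \<noteq> 0" unfolding K_def of_real_eq_0_iff of_nat_eq_0_iff by simp
    ultimately show ?thesis by simp
  qed
  moreover have "continuous_on UNIV (L j)" for j
    unfolding L_def by (intro continuous_intros)
  ultimately show ?thesis by (intro exI[of _ x] exI[of _ L]) blast
qed

context cbanach
begin

section \<open>Polynomial growth, separate polynomiality and Baire's theorem\<close>

lemma asymptotic_expansion_scale:
  assumes "asymptotic_expansion g p"
  shows "asymptotic_expansion (\<lambda>t. g (c * t)) (\<lambda>l. s (c^l) (p l))"
  unfolding asymptotic_expansion_def
proof
  fix N
  obtain M r where r: "r > 0" and M: "\<And>t. cmod t < r \<Longrightarrow> norm (g t - (\<Sum>l<N. s (t^l) (p l))) \<le> M * cmod t ^ N"
    using assms unfolding asymptotic_expansion_def by blast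
  have "norm (g (c * t) - (\<Sum>l<N. s (t^l) (s (c^l) (p l)))) \<le> (M * cmod c ^ N) * cmod t ^ N" if "cmod t < r / (cmod c + 1)" for t
  proof -
    have "cmod (c * t) \<le> (cmod c + 1) * cmod t" by (simp add: norm_mult mult_right_mono)
    also have "\<dots> < r" using that by (simp add: field_simps add_pos_nonneg)
    finally have "norm (g (c * t) - (\<Sum>l<N. s ((c * t)^l) (p l))) \<le> M * cmod (c * t) ^ N" by (rule M)
    then show ?thesis by (simp add: power_mult_distrib norm_mult mult_ac)
  qed
  then show "\<exists>M r. r > 0 \<and> (\<forall>t. cmod t < r \<longrightarrow> norm (g (c * t) - (\<Sum>l<N. s (t^l) (s (c^l) (p l)))) \<le> M * cmod t ^ N)"
    using r by (intro exI[of _ "M * cmod c ^ N"] exI[of _ "r / (cmod c + 1)"]) (auto simp: add_nonneg_pos)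
qed

text \<open>Liouville's argument: Cauchy's estimate on radius r bounds the m-th coefficient by C
  r^(l-m), which tends to 0 for m > l. Fixing r = |z| + 1 and letting the order of truncation grow
  shows that the finite Taylor sum is g itself.\<close>

lemma entire_polynomial_growth:
  assumes C1: "C1_on UNIV g" and C: "\<And>t. 1 \<le> cmod t \<Longrightarrow> norm (g t) \<le> C * cmod t ^ l"
  shows "\<exists>b. \<forall>t. g t = (\<Sum>m\<le>l. s (t^m) (b m))"
proof -
  have C1R: "C1_on (ball 0 R) g" for R by (rule C1_on_subset[OF C1]) simp
  obtain b where b: "asymptotic_expansion g b"
    using C1_on_asymptotic_expansion_exists[OF C1R[of 1]] by auto
  have est: "norm (b m) \<le> C * r^l / r^m" if "1 \<le> r" for m r
    by (rule cauchy_estimate[OF C1R[of "r+1"] b]) (use that C in auto)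
  have rem: "norm (g z - (\<Sum>m<N. s (z^m) (b m))) \<le> C * r^l * (cmod z / r)^N / (1 - cmod z / r)" if "1 \<le> r" "cmod z < r" for r z N
    by (rule taylor_remainder[OF C1R[of "r+1"] b]) (use that C in auto)
  have b0: "b m = 0" if "m > l" for m
  proof -
    have bd: "norm (b m) \<le> C / r" if "1 \<le> r" for r
    proof -
      have C0: "0 \<le> C" using order.trans[OF norm_ge_zero C[of 1]] by simp
      have "C * r^l / r^m = C / r^(m - l)" using \<open>m > l\<close> that by (simp add: power_diff divide_simps)
      also have "\<dots> \<le> C / r^1" using \<open>m > l\<close> that C0 by (intro divide_left_mono power_increasing) auto
      finally show ?thesis using est[OF that, of m] by simp
    qed
    have "norm (b m) \<le> 0"
    proof (rule tendsto_le[OF _ _ tendsto_const])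
      show "((\<lambda>r. C / r) \<longlongrightarrow> 0) at_top"
        by (rule tendsto_divide_0[OF tendsto_const]) (simp add: filterlim_at_top_imp_at_infinity filterlim_ident)
      show "\<forall>\<^sub>F r in at_top. norm (b m) \<le> C / r"
        using eventually_ge_at_top[of 1] by eventually_elim (rule bd)
    qed simp
    then show ?thesis by simp
  qed
  have "g z = (\<Sum>m\<le>l. s (z^m) (b m))" for z
  proof -
    define r where "r = cmod z + 1"
    have sum: "(\<Sum>m<N + Suc l. s (z^m) (b m)) = (\<Sum>m\<le>l. s (z^m) (b m))" for N
    proof -
      have "(\<Sum>m<N + Suc l. s (z^m) (b m)) = (\<Sum>m\<in>{..l}. s (z^m) (b m))"
        by (rule sum.mono_neutral_right) (use b0 in auto)
      then show ?thesis .
    qed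
    have q: "0 \<le> cmod z / r" "cmod z / r < 1" by (auto simp: r_def add_nonneg_pos)
    have "norm (g z - (\<Sum>m\<le>l. s (z^m) (b m))) \<le> 0"
    proof (rule tendsto_le[OF _ _ tendsto_const])
      have "(\<lambda>N. C * r^l * (cmod z / r)^(N + Suc l) / (1 - cmod z / r)) \<longlonglongrightarrow> C * r^l * 0 / (1 - cmod z / r)"
        by (intro tendsto_intros LIMSEQ_ignore_initial_segment LIMSEQ_power_zero) (use q in auto)
      then show "(\<lambda>N. C * r^l * (cmod z / r)^(N + Suc l) / (1 - cmod z / r)) \<longlonglongrightarrow> 0" by simp
      show "\<forall>\<^sub>F N in sequentially. norm (g z - (\<Sum>m\<le>l. s (z^m) (b m))) \<le> C * r^l * (cmod z / r)^(N + Suc l) / (1 - cmod z / r)"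
        using rem[of r z "N + Suc l" for N] unfolding sum by (auto simp: r_def)
    qed simp
    then show ?thesis by simp
  qed
  then show ?thesis by blast
qed

text \<open>Induction on the number of variables: interpolation in the last one writes q as a finite
  sum of continuous weights times q with that variable frozen at a node. Fixed nodes suffice because
  the degree bound l is the same on all coordinate lines.\<close>

lemma separately_polynomial_continuous:
  fixes q :: "(nat \<Rightarrow> complex) \<Rightarrow> 'w"
  assumes "\<And>c m. m < k \<Longrightarrow> \<exists>b. \<forall>t. q (c(m := t)) = (\<Sum>j\<le>l. s (t^j) (b j))"
    and "\<And>c c'. (\<And>i. i < k \<Longrightarrow> c i = c' i) \<Longrightarrow> q c = q c'"
  shows "continuous_on UNIV q"
  using assms
proof (induction k arbitrary: q)
  case 0
  have "continuous_on UNIV (\<lambda>_::nat \<Rightarrow> complex. q (\<lambda>_. 0))" by simp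
  then show ?case by (rule continuous_on_eq) (rule 0(2), simp)
next
  case (Suc k)
  obtain x L where L: "\<And>j. continuous_on UNIV (L j)"
    and L1: "\<And>m t. m \<le> l \<Longrightarrow> (\<Sum>j\<le>l. L j t * x j ^ m) = (t::complex) ^ m"
    using interpolation_exists[of l] by blast
  have eq: "q c = (\<Sum>j\<le>l. s (L j (c k)) (q (c(k := x j))))" for c
  proof -
    obtain b where b: "\<And>t. q (c(k := t)) = (\<Sum>m\<le>l. s (t^m) (b m))" using Suc.prems(1)[OF lessI, of c] by blast
    have "q c = (\<Sum>m\<le>l. s (c k^m) (b m))" using b[of "c k"] by simp
    also have "\<dots> = (\<Sum>m\<le>l. \<Sum>j\<le>l. s (L j (c k) * x j ^ m) (b m))"
      by (intro sum.cong refl) (simp add: L1 flip: scale_sum_left)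
    also have "\<dots> = (\<Sum>j\<le>l. \<Sum>m\<le>l. s (L j (c k) * x j ^ m) (b m))" by (rule sum.swap)
    also have "\<dots> = (\<Sum>j\<le>l. s (L j (c k)) (q (c(k := x j))))"
      unfolding b scale_sum_right by simp
    finally show ?thesis .
  qed
  have cont: "continuous_on UNIV (\<lambda>c. q (c(k := x j)))" for j
  proof (rule Suc.IH)
    fix c m assume "m < k"
    then obtain b where "\<And>t. q ((c(k := x j))(m := t)) = (\<Sum>j\<le>l. s (t^j) (b j))"
      using Suc.prems(1)[OF less_SucI, of m "c(k := x j)"] by blast
    then show "\<exists>b. \<forall>t. q ((c(m := t))(k := x j)) = (\<Sum>j\<le>l. s (t^j) (b j))"
      using \<open>m < k\<close> by (metis fun_upd_twist less_irrefl)
  next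
    fix c c' :: "nat \<Rightarrow> complex" assume "\<And>i. i < k \<Longrightarrow> c i = c' i"
    then show "q (c(k := x j)) = q (c'(k := x j))" by (intro Suc.prems(2)) auto
  qed
  have "continuous_on UNIV (\<lambda>c. \<Sum>j\<le>l. s (L j (c k)) (q (c(k := x j))))"
    by (intro continuous_intros sc.continuous_on cont continuous_on_compose2[OF L])
       (auto intro: continuous_on_product_coordinates)
  then show ?case by (rule continuous_on_eq) (rule eq[symmetric])
qed

text \<open>The sets \<open>A M\<close> of points obeying the bound with M are closed and cover a
  completely metrizable space, so one of them has interior. The form M^(l+1) merges prefactor and
  ratio of a geometric bound into one natural number, which makes the cover countable.\<close>

lemma baire_uniform_bound:
  fixes p :: "nat \<Rightarrow> (nat \<Rightarrow> complex) \<Rightarrow> 'w"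
  assumes cont: "\<And>l. continuous_on UNIV (p l)"
    and bd: "\<And>c. \<exists>M::nat. \<forall>l. norm (p l c) \<le> real M ^ Suc l"
  shows "\<exists>(M::nat) a \<eta>. \<eta> > 0 \<and> (\<forall>c. (\<forall>i. dist (c i) (a i) < \<eta>) \<longrightarrow> (\<forall>l. norm (p l c) \<le> real M ^ Suc l))"
proof -
  define A where "A M = {c. \<forall>l. norm (p l c) \<le> real M ^ Suc l}" for M :: nat
  have "closed (A M)" for M
  proof -
    have "A M = (\<Inter>l. {c. norm (p l c) \<le> real M ^ Suc l})" by (auto simp: A_def)
    moreover have "closed {c. norm (p l c) \<le> real M ^ Suc l}" for l
      by (intro closed_Collect_le continuous_intros cont)
    ultimately show ?thesis by auto
  qed
  moreover have "(\<Union>M. A M) = UNIV" using bd by (auto simp: A_def)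
  ultimately have "\<exists>M. interior (A M) \<noteq> {}"
    using Baire_category_alt[of "euclidean :: (nat \<Rightarrow> complex) topology" "range A"]
    by (auto simp: completely_metrizable_space_euclidean)
  then obtain M a where "a \<in> interior (A M)" by blast
  then obtain \<eta> where "\<eta> > 0" "\<forall>c. (\<forall>i. dist (c i) (a i) < \<eta>) \<longrightarrow> c \<in> interior (A M)"
    using open_fun_box[OF open_interior] by blast
  then have "\<forall>c. (\<forall>i. dist (c i) (a i) < \<eta>) \<longrightarrow> c \<in> A M" using interior_subset[of "A M"] by blast
  with \<open>\<eta> > 0\<close> show ?thesis unfolding A_def
    by (intro exI[of _ M] exI[of _ a] exI[of _ \<eta>]) simp
qed

end


lemma fin_open_level_affine_preimage:
  fixes s :: "complex \<Rightarrow> 'v::ab_group_add \<Rightarrow> 'v" and c :: "'x::topological_space \<Rightarrow> nat \<Rightarrow> complex"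
  assumes "vector_space s" "fin_open_level s n A" "Y \<in> mat_dim n n" "\<And>i. i < k \<Longrightarrow> E i \<in> mat_dim n n"
    "\<And>i. i < k \<Longrightarrow> continuous_on UNIV (\<lambda>x. c x i)"
  shows "open {x. Y + mlincomb s k (c x) E \<in> A}"
proof -
  interpret M: vector_space "mscale s" by (rule vector_space_mscale) fact
  have eq: "mlincomb s (Suc k) ((c x)(k := 1)) (E(k := Y)) = Y + mlincomb s k (c x) E" for x
    unfolding mlincomb_Suc by (simp add: mlincomb_def)
  have cont: "continuous_on UNIV (\<lambda>x. ((c x)(k := 1)) i)" if "i < Suc k" for i
    using assms(5)[of i] that by (cases "i = k") auto
  have "open {x. mlincomb s (Suc k) ((c x)(k := 1)) (E(k := Y)) \<in> A}"
    by (rule fin_open_level_preimage[OF assms(1,2) _ cont]) (use assms(3,4) in \<open>auto simp: less_Suc_eq\<close>)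
  then show ?thesis unfolding eq .
qed

context nc_fun
begin

section \<open>The homogeneous terms on lines and finite families\<close>

lemma slice_taylor:
  assumes n: "0 < n" and Y: "Y \<in> \<Omega> n" and Z: "Z \<in> mat_dim n n" and ij: "i < n" "j < n"
    and r: "0 < r" and disc: "\<And>t. cmod t \<le> r \<Longrightarrow> Y + mscale sV t Z \<in> \<Omega> n"
    and M: "\<And>t. cmod t = r \<Longrightarrow> norm (f n (Y + mscale sV t Z) i j) \<le> M"
  shows slice_cauchy_estimate: "norm (Delta n l Y Z i j) \<le> M / r^l"
    and slice_taylor_remainder: "cmod z < r \<Longrightarrow>
      norm (f n (Y + mscale sV z Z) i j - (\<Sum>l<N. sW (z^l) (Delta n l Y Z i j))) \<le> M * (cmod z / r)^N / (1 - cmod z / r)"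
proof -
  let ?U = "{t. Y + mscale sV t Z \<in> \<Omega> n}"
  have disc_sub: "cball 0 r \<subseteq> ?U" using disc by (auto simp: subset_iff)
  obtain R where R: "r < R" "ball 0 R \<subseteq> ?U"
    using open_cball_enlarge[OF open_slice[OF n Omega_mat_dim[OF Y] Z] disc_sub less_imp_le[OF r]] by blast
  have C1: "C1_on (ball 0 R) (\<lambda>t. f n (Y + mscale sV t Z) i j)"
    by (rule C1_on_subset[OF slice_C1_on[OF n Omega_mat_dim[OF Y] Z ij] R(2)])
  note a = slice_asymptotic_expansion[OF n Y Z ij]
  show "norm (Delta n l Y Z i j) \<le> M / r^l"
    by (rule cauchy_estimate[OF C1 a r R(1) M])
  show "norm (f n (Y + mscale sV z Z) i j - (\<Sum>l<N. sW (z^l) (Delta n l Y Z i j))) \<le> M * (cmod z / r)^N / (1 - cmod z / r)"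
    if "cmod z < r"
    by (rule taylor_remainder[OF C1 a r R(1) M that])
qed

lemma slice_bounded:
  assumes n: "0 < n" and Y: "Y \<in> \<Omega> n" and Z: "Z \<in> mat_dim n n" and ij: "i < n" "j < n"
    and disc: "\<And>t. cmod t \<le> r \<Longrightarrow> Y + mscale sV t Z \<in> \<Omega> n"
  shows "\<exists>M. \<forall>t. cmod t \<le> r \<longrightarrow> norm (f n (Y + mscale sV t Z) i j) \<le> M"
proof -
  have "compact ((\<lambda>t. f n (Y + mscale sV t Z) i j) ` cball 0 r)"
    by (intro compact_continuous_image continuous_on_subset[OF C1_on_imp_continuous_on[OF slice_C1_on[OF n Omega_mat_dim[OF Y] Z ij]]])
       (use disc in auto)
  then obtain M where "\<forall>x\<in>(\<lambda>t. f n (Y + mscale sV t Z) i j) ` cball 0 r. norm x \<le> M"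
    using compact_imp_bounded bounded_iff by metis
  then show ?thesis by (intro exI[of _ M]) simp
qed

text \<open>Radius and bound come from the slice through Y in direction Z and depend on Z; this
  pointwise statement is what Baire's theorem converts into a uniform one.\<close>

lemma Delta_geometric_bound:
  assumes n: "0 < n" and Y: "Y \<in> \<Omega> n" and Z: "Z \<in> mat_dim n n" and ij: "i < n" "j < n"
  shows "\<exists>r>0. \<exists>M. \<forall>l. norm (Delta n l Y Z i j) \<le> M / r^l"
proof -
  obtain r where r: "r > 0" "cball 0 r \<subseteq> {t. Y + mscale sV t Z \<in> \<Omega> n}"
    using open_contains_cball[THEN iffD1, OF open_slice[OF n Omega_mat_dim[OF Y] Z], rule_format, of 0] Y by auto
  then have disc: "Y + mscale sV t Z \<in> \<Omega> n" if "cmod t \<le> r" for t using that by auto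
  obtain M where "\<And>t. cmod t \<le> r \<Longrightarrow> norm (f n (Y + mscale sV t Z) i j) \<le> M"
    using slice_bounded[OF n Y Z ij disc] by blast
  then have "norm (Delta n l Y Z i j) \<le> M / r^l" for l
    by (intro slice_cauchy_estimate[OF n Y Z ij r(1) disc]) auto
  then show ?thesis using r(1) by blast
qed

text \<open>The radius exceeds 1, so that t = 1 lies inside the circle and the remainder decays like
  r^(-N).\<close>

lemma slice_sums:
  assumes n: "0 < n" and Y: "Y \<in> \<Omega> n" and Z: "Z \<in> mat_dim n n" and ij: "i < n" "j < n"
    and r: "1 < r" and disc: "\<And>t. cmod t \<le> r \<Longrightarrow> Y + mscale sV t Z \<in> \<Omega> n"
  shows "(\<lambda>l. Delta n l Y Z i j) sums f n (Y + Z) i j"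
proof -
  obtain M where M: "\<And>t. cmod t \<le> r \<Longrightarrow> norm (f n (Y + mscale sV t Z) i j) \<le> M"
    using slice_bounded[OF n Y Z ij disc] by blast
  have "norm (f n (Y + mscale sV 1 Z) i j - (\<Sum>l<N. sW (1^l) (Delta n l Y Z i j))) \<le> M * (cmod 1 / r)^N / (1 - cmod 1 / r)" for N
    by (rule slice_taylor_remainder[OF n Y Z ij _ disc]) (use M r in auto)
  then have bd: "norm ((\<Sum>l<N. Delta n l Y Z i j) - f n (Y + Z) i j) \<le> M * (1 / r)^N / (1 - 1 / r)" for N
    by (simp add: norm_minus_commute)
  have "(\<lambda>N. M * (1 / r)^N / (1 - 1 / r)) \<longlonglongrightarrow> M * 0 / (1 - 1 / r)"
    by (intro tendsto_intros LIMSEQ_power_zero) (use r in auto)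
  then have "(\<lambda>N. M * (1 / r)^N / (1 - 1 / r)) \<longlonglongrightarrow> 0" by simp
  then have "(\<lambda>N. (\<Sum>l<N. Delta n l Y Z i j) - f n (Y + Z) i j) \<longlonglongrightarrow> 0"
    by (rule Lim_null_comparison[rotated]) (use bd in auto)
  then show ?thesis unfolding sums_def using LIM_zero_iff by blast
qed

text \<open>Both sequences are asymptotic expansions of t \<mapsto> f(Y + ctZ), read as a slice in
  direction cZ and as a rescaled slice in direction Z; uniqueness equates them.\<close>

lemma Delta_homogeneous:
  assumes n: "0 < n" and Y: "Y \<in> \<Omega> n" and Z: "Z \<in> mat_dim n n" and ij: "i < n" "j < n"
  shows "Delta n l Y (mscale sV c Z) i j = sW (c^l) (Delta n l Y Z i j)"
proof -
  have 1: "asymptotic_expansion (\<lambda>t. f n (Y + mscale sV (c * t) Z) i j) (\<lambda>l. sW (c^l) (Delta n l Y Z i j))"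
    using asymptotic_expansion_scale[OF slice_asymptotic_expansion[OF n Y Z ij], of c] .
  have 2: "asymptotic_expansion (\<lambda>t. f n (Y + mscale sV (c * t) Z) i j) (\<lambda>l. Delta n l Y (mscale sV c Z) i j)"
    using slice_asymptotic_expansion[OF n Y mat_dim_mscale[OF V Z] ij, of c] by (simp add: mult.commute)
  show ?thesis using fun_cong[OF asymptotic_expansion_unique[OF 2 1]] .
qed

text \<open>The \<epsilon> chosen at t0 displays \<open>Delta\<close> near t0 as a rescaled corner
  of f on a slice at size (l+1)n. The choice changes with t0 but the value does not, so the local
  statements glue to an entire function.\<close>

lemma Delta_line_C1_on:
  assumes n: "0 < n" and Y: "Y \<in> \<Omega> n" and ij: "i < n" "j < n"
  shows "C1_on UNIV (\<lambda>t. Delta n l Y (A + mscale sV t H) i j)"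
proof (rule C1_on_locally)
  fix t0
  obtain \<epsilon> where \<epsilon>: "\<epsilon> \<noteq> 0" and X0: "tens sV n (Suc l) Y (A + mscale sV t0 H) (nilp \<epsilon>) \<in> \<Omega> (Suc l * n)"
    using ex_tens_nilp[OF n Y] by blast
  let ?m = "Suc l * n"
  let ?Y = "tens sV n (Suc l) Y A (nilp \<epsilon>)" and ?Z = "tens sV n (Suc l) 0 H (nilp \<epsilon>)"
  have eq: "tens sV n (Suc l) Y (A + mscale sV t H) (nilp \<epsilon>) = ?Y + mscale sV t ?Z" for t
    by (rule tens_add_direction[OF V, symmetric])
  let ?U = "{t. ?Y + mscale sV t ?Z \<in> \<Omega> ?m}"
  have m: "0 < ?m" "i < ?m" "l * n + j < ?m" using n ij by auto
  have U: "open ?U" by (rule open_slice[OF m(1) tens_mat_dim tens_mat_dim])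
  have t0: "t0 \<in> ?U" using X0 unfolding eq by simp
  obtain r where r: "r > 0" "ball t0 r \<subseteq> ?U" using U t0 open_contains_ball by blast
  have "C1_on (ball t0 r) (\<lambda>t. sW (1 / \<epsilon>^l) (f ?m (?Y + mscale sV t ?Z) i (l * n + j)))"
    by (rule C1_on_scale[OF C1_on_subset[OF slice_C1_on[OF m(1) tens_mat_dim tens_mat_dim m(2,3)] r(2)]])
  then have "C1_on (ball t0 r) (\<lambda>t. Delta n l Y (A + mscale sV t H) i j)"
  proof (rule C1_on_cong)
    fix t assume "t \<in> ball t0 r"
    then have "tens sV n (Suc l) Y (A + mscale sV t H) (nilp \<epsilon>) \<in> \<Omega> ?m" using r(2) unfolding eq by auto
    from Delta_eq[OF n \<epsilon> this ij] show "Delta n l Y (A + mscale sV t H) i j = sW (1 / \<epsilon>^l) (f ?m (?Y + mscale sV t ?Z) i (l * n + j))"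
      unfolding eq .
  qed simp
  then show "\<exists>r>0. C1_on (ball t0 r) (\<lambda>t. Delta n l Y (A + mscale sV t H) i j)" using r(1) by blast
qed

text \<open>By homogeneity, the behaviour of \<open>Delta\<close> at infinity on a line becomes its
  behaviour near 0 on the line with A and H exchanged.\<close>

lemma Delta_line_invert:
  assumes n: "0 < n" and Y: "Y \<in> \<Omega> n" and AH: "A \<in> mat_dim n n" "H \<in> mat_dim n n" and ij: "i < n" "j < n" and t: "t \<noteq> 0"
  shows "Delta n l Y (A + mscale sV t H) i j = sW (t^l) (Delta n l Y (H + mscale sV (1/t) A) i j)"
proof -
  have "A + mscale sV t H = mscale sV t (H + mscale sV (1/t) A)"
    using t by (simp add: M.scale_right_distrib add.commute)
  moreover have "H + mscale sV (1/t) A \<in> mat_dim n n" by (intro mat_dim_add mat_dim_mscale[OF V] AH)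
  ultimately show ?thesis using Delta_homogeneous[OF n Y _ ij] by simp
qed

text \<open>Continuity of the inverted line on the closed unit disc gives the bound C |t|^l for |t|
  \<ge> 1, and an entire function of this growth is a polynomial of degree at most l.\<close>

lemma Delta_line_polynomial:
  assumes n: "0 < n" and Y: "Y \<in> \<Omega> n" and AH: "A \<in> mat_dim n n" "H \<in> mat_dim n n" and ij: "i < n" "j < n"
  shows "\<exists>b. \<forall>t. Delta n l Y (A + mscale sV t H) i j = (\<Sum>m\<le>l. sW (t^m) (b m))"
proof -
  have "compact ((\<lambda>t. Delta n l Y (H + mscale sV t A) i j) ` cball 0 1)"
    by (intro compact_continuous_image continuous_on_subset[OF C1_on_imp_continuous_on[OF Delta_line_C1_on[OF n Y ij]]]) auto
  then obtain C where C: "\<forall>x\<in>(\<lambda>t. Delta n l Y (H + mscale sV t A) i j) ` cball 0 1. norm x \<le> C"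
    using compact_imp_bounded bounded_iff by metis
  show ?thesis
  proof (rule entire_polynomial_growth[OF Delta_line_C1_on[OF n Y ij]])
    fix t :: complex assume t: "1 \<le> cmod t"
    then have "1/t \<in> cball 0 1" by (simp add: norm_divide divide_le_eq)
    then have "norm (Delta n l Y (H + mscale sV (1/t) A) i j) \<le> C" using C by blast
    moreover have "t \<noteq> 0" using t by auto
    ultimately show "norm (Delta n l Y (A + mscale sV t H) i j) \<le> C * cmod t ^ l"
      by (simp add: Delta_line_invert[OF n Y AH ij] norm_power mult.commute mult_right_mono del: of_nat_Suc)
  qed
qed

text \<open>Maximum principle for the entire function $s \mapsto \Delta(H + sA)$, which equals $s^l \Delta(A + s^{-1}H)$.\<close>

lemma Delta_leading_bound:
  assumes n: "0 < n" and Y: "Y \<in> \<Omega> n" and AH: "A \<in> mat_dim n n" "H \<in> mat_dim n n" and ij: "i < n" "j < n"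
    and B: "\<And>t. cmod t = 1 \<Longrightarrow> norm (Delta n l Y (A + mscale sV t H) i j) \<le> B"
  shows "norm (Delta n l Y H i j) \<le> B"
proof -
  let ?Q = "\<lambda>s. Delta n l Y (H + mscale sV s A) i j"
  have C1: "C1_on (ball 0 2) ?Q" by (rule C1_on_subset[OF Delta_line_C1_on[OF n Y ij]]) simp
  obtain b where b: "asymptotic_expansion ?Q b" using C1_on_asymptotic_expansion_exists[OF C1] by auto
  \<comment> \<open>The zeroth coefficient is the value at the centre, so Cauchy's estimate at
    radius 1 serves as the maximum principle.\<close>
  have "norm (b 0) \<le> B / 1^0"
  proof (rule cauchy_estimate[OF C1 b])
    fix t :: complex assume t: "cmod t = 1"
    then have "t \<noteq> 0" by auto
    then have "norm (?Q t) = norm (Delta n l Y (A + mscale sV (1/t) H) i j)"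
      unfolding Delta_line_invert[OF n Y AH(2,1) ij \<open>t \<noteq> 0\<close>] using t by (simp add: norm_power)
    also have "\<dots> \<le> B" by (rule B) (use t in \<open>simp add: norm_divide\<close>)
    finally show "norm (?Q t) \<le> B" .
  qed auto
  then show ?thesis using asymptotic_expansion_0[OF b] by simp
qed

lemma mlincomb_mat_dim: "\<forall>i<k. E i \<in> mat_dim n n \<Longrightarrow> mlincomb sV k c E \<in> mat_dim n n"
  unfolding mlincomb_def by (intro mat_dim_sum mat_dim_mscale[OF V]) auto

lemma mlincomb_cong: "(\<And>i. i < k \<Longrightarrow> c i = c' i) \<Longrightarrow> mlincomb sV k c E = mlincomb sV k c' E"
  unfolding mlincomb_def by (rule sum.cong) auto

lemma mlincomb_add: "mlincomb sV k (\<lambda>i. c i + d i) E = mlincomb sV k c E + mlincomb sV k d E"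
  unfolding mlincomb_def sum.distrib[symmetric] by (rule sum.cong) (simp_all only: M.scale_left_distrib)

lemma mlincomb_scale: "mlincomb sV k (\<lambda>i. t * c i) E = mscale sV t (mlincomb sV k c E)"
  unfolding mlincomb_def M.scale_sum_right by (rule sum.cong) (simp_all only: M.scale_scale)

lemma mlincomb_unit: "m < k \<Longrightarrow> mlincomb sV k (\<lambda>i. if i = m then t else 0) E = mscale sV t (E m)"
proof -
  assume m: "m < k"
  have "mlincomb sV k (\<lambda>i. if i = m then t else 0) E = (\<Sum>i<k. if i = m then mscale sV t (E m) else 0)"
    unfolding mlincomb_def by (rule sum.cong) auto
  then show ?thesis using m by simp
qed

lemma Delta_mlincomb_continuous:
  assumes n: "0 < n" and Y: "Y \<in> \<Omega> n" and E: "\<forall>i<k. E i \<in> mat_dim n n" and ij: "i < n" "j < n"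
  shows "continuous_on UNIV (\<lambda>c. Delta n l Y (mlincomb sV k c E) i j)"
proof (rule separately_polynomial_continuous)
  fix c :: "nat \<Rightarrow> complex" and m assume m: "m < k"
  have eq: "mlincomb sV k (c(m := t)) E = mlincomb sV k (c(m := 0)) E + mscale sV t (E m)" for t
    unfolding mlincomb_unit[OF m, symmetric] mlincomb_add[symmetric] by (rule mlincomb_cong) auto
  obtain b where b: "\<And>t. Delta n l Y (mlincomb sV k (c(m := 0)) E + mscale sV t (E m)) i j = (\<Sum>m\<le>l. sW (t^m) (b m))"
    using Delta_line_polynomial[OF n Y mlincomb_mat_dim[OF E] E[rule_format, OF m] ij] by blast
  then show "\<exists>b. \<forall>t. Delta n l Y (mlincomb sV k (c(m := t)) E) i j = (\<Sum>m\<le>l. sW (t^m) (b m))"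
    by (intro exI[of _ b] allI, subst eq) (rule b)
next
  fix c c' :: "nat \<Rightarrow> complex" assume "\<And>i. i < k \<Longrightarrow> c i = c' i"
  then show "Delta n l Y (mlincomb sV k c E) i j = Delta n l Y (mlincomb sV k c' E) i j"
    using mlincomb_cong[of k c c' E] by simp
qed

text \<open>Baire bounds \<open>Delta\<close> on a box about some a. For c in the box of the same
  size about 0, all points a + tc with |t| = 1 stay in the first box, and
  \<open>Delta_leading_bound\<close> transfers the bound to c. Passing to \<open>Suc K\<close> makes
  the base at least 1.\<close>

lemma Delta_mlincomb_bound:
  assumes n: "0 < n" and Y: "Y \<in> \<Omega> n" and E: "\<forall>i<k. E i \<in> mat_dim n n" and ij: "i < n" "j < n"
  shows "\<exists>M\<ge>1. \<exists>\<eta>>0. \<forall>c. (\<forall>m<k. cmod (c m) < \<eta>) \<longrightarrow> (\<forall>l. norm (Delta n l Y (mlincomb sV k c E) i j) \<le> M ^ Suc l)"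
proof -
  have "\<exists>K::nat. \<forall>l. norm (Delta n l Y (mlincomb sV k c E) i j) \<le> real K ^ Suc l" for c
  proof -
    obtain r M where r: "r > 0" and M: "\<And>l. norm (Delta n l Y (mlincomb sV k c E) i j) \<le> M / r^l"
      using Delta_geometric_bound[OF n Y mlincomb_mat_dim[OF E] ij] by blast
    \<comment> \<open>K dominates both the prefactor M and the ratio 1/r, so M / r^l \<le>
      K^(l+1).\<close>
    obtain K :: nat where K: "max M (1/r) \<le> real K" using real_arch_simple by blast
    have "0 \<le> M" using order.trans[OF norm_ge_zero M[of 0]] by simp
    have "norm (Delta n l Y (mlincomb sV k c E) i j) \<le> real K ^ Suc l" for l
    proof -
      have "M / r^l = M * (1/r)^l" by (simp add: power_divide)
      also have "\<dots> \<le> real K * real K ^ l" using K r \<open>0 \<le> M\<close> by (intro mult_mono power_mono) auto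
      finally show ?thesis using M[of l] by simp
    qed
    then show ?thesis by blast
  qed
  from baire_uniform_bound[OF Delta_mlincomb_continuous[OF n Y E ij] this]
  obtain K :: nat and a \<eta> where \<eta>: "\<eta> > 0"
    and K: "\<And>c l. (\<And>m. dist (c m) (a m) < \<eta>) \<Longrightarrow> norm (Delta n l Y (mlincomb sV k c E) i j) \<le> real K ^ Suc l"
    by blast
  have "norm (Delta n l Y (mlincomb sV k c E) i j) \<le> real (Suc K) ^ Suc l" if c: "\<And>m. m < k \<Longrightarrow> cmod (c m) < \<eta>" for c l
  proof -
    have "norm (Delta n l Y (mlincomb sV k c E) i j) \<le> real K ^ Suc l"
    proof (rule Delta_leading_bound[OF n Y mlincomb_mat_dim[OF E, of a] mlincomb_mat_dim[OF E] ij])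
      fix t :: complex assume t: "cmod t = 1"
      \<comment> \<open>Beyond the first k coordinates a is kept, so the box condition holds for
        every index.\<close>
      let ?c = "\<lambda>m. if m < k then a m + t * c m else a m"
      have "mlincomb sV k ?c E = mlincomb sV k a E + mscale sV t (mlincomb sV k c E)"
        unfolding mlincomb_scale[symmetric] mlincomb_add[symmetric] by (rule mlincomb_cong) auto
      moreover have "norm (Delta n l Y (mlincomb sV k ?c E) i j) \<le> real K ^ Suc l"
        by (rule K) (use c t \<eta> in \<open>auto simp: dist_norm norm_mult\<close>)
      ultimately show "norm (Delta n l Y (mlincomb sV k a E + mscale sV t (mlincomb sV k c E)) i j) \<le> real K ^ Suc l"
        by simp
    qed
    also have "\<dots> \<le> real (Suc K) ^ Suc l" by (intro power_mono) auto
    finally show ?thesis .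
  qed
  then show ?thesis using \<eta> by (intro exI[of _ "real (Suc K)"] conjI exI[of _ \<eta>]) auto
qed

lemma mlincomb_in_Omega:
  assumes n: "0 < n" and Y: "Y \<in> \<Omega> n" and E: "\<forall>i<k. E i \<in> mat_dim n n"
  shows "\<exists>\<delta>>0. \<forall>c. (\<forall>m<k. cmod (c m) < \<delta>) \<longrightarrow> Y + mlincomb sV k c E \<in> \<Omega> n"
proof -
  have "open {c. Y + mlincomb sV k c E \<in> \<Omega> n}"
    by (rule fin_open_level_affine_preimage[OF V fin_open[OF n] Omega_mat_dim[OF Y]])
       (use E in \<open>auto intro: continuous_on_product_coordinates\<close>)
  moreover have "mlincomb sV k (\<lambda>_. 0) E = 0" by (simp add: mlincomb_def)
  ultimately obtain \<delta> where \<delta>: "\<delta> > 0" and *: "\<And>c. (\<And>m. cmod (c m) < \<delta>) \<Longrightarrow> Y + mlincomb sV k c E \<in> \<Omega> n"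
    using open_fun_box[of "{c. Y + mlincomb sV k c E \<in> \<Omega> n}" "\<lambda>_. 0"] Y by (auto simp: dist_norm)
  have "Y + mlincomb sV k c E \<in> \<Omega> n" if "\<And>m. m < k \<Longrightarrow> cmod (c m) < \<delta>" for c
  proof -
    have "mlincomb sV k c E = mlincomb sV k (\<lambda>m. if m < k then c m else 0) E" by (rule mlincomb_cong) simp
    then show ?thesis using *[of "\<lambda>m. if m < k then c m else 0"] that \<delta> by simp
  qed
  then show ?thesis using \<delta> by blast
qed

text \<open>Shrinking the coefficients by \<sigma> multiplies the term of degree l + 1 by
  \<sigma>^(l+1), so the bound M^(l+2) turns into at most M \<tau> 2^(-(l+1)). Summed over l this is
  M \<tau> < e, while the term of degree 0 is f(Y).\<close>

lemma f_mlincomb_continuous_at: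
  assumes n: "0 < n" and Y: "Y \<in> \<Omega> n" and E: "\<forall>i<k. E i \<in> mat_dim n n" and ij: "i < n" "j < n" and e: "e > 0"
  shows "\<exists>\<delta>>0. \<forall>c. (\<forall>m<k. cmod (c m) < \<delta>) \<longrightarrow> norm (f n (Y + mlincomb sV k c E) i j - f n Y i j) < e"
proof -
  obtain M \<eta> where M: "M \<ge> 1" and \<eta>: "\<eta> > 0"
    and bd: "\<And>c l. (\<And>m. m < k \<Longrightarrow> cmod (c m) < \<eta>) \<Longrightarrow> norm (Delta n l Y (mlincomb sV k c E) i j) \<le> M ^ Suc l"
    using Delta_mlincomb_bound[OF n Y E ij] by blast
  obtain \<delta>0 where \<delta>0: "\<delta>0 > 0" and dom: "\<And>c. (\<And>m. m < k \<Longrightarrow> cmod (c m) < \<delta>0) \<Longrightarrow> Y + mlincomb sV k c E \<in> \<Omega> n"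
    using mlincomb_in_Omega[OF n Y E] by blast
  define \<tau> where "\<tau> = min 1 (e / (2 * M))"
  have \<tau>: "0 < \<tau>" "\<tau> \<le> 1" "M * \<tau> < e"
  proof -
    have "M * \<tau> \<le> M * (e / (2 * M))" unfolding \<tau>_def using M by (intro mult_left_mono) auto
    also have "\<dots> < e" using M e by simp
    finally show "M * \<tau> < e" .
  qed (use M e in \<open>auto simp: \<tau>_def\<close>)
  define \<sigma> where "\<sigma> = \<tau> / (2 * M)"
  have \<sigma>: "\<sigma> > 0" using \<tau> M by (simp add: \<sigma>_def)
  \<comment> \<open>Half of \<delta>0 keeps the disc |t| \<le> 2 inside \<Omega>, a radius above 1
    as \<open>slice_sums\<close> demands; the factor \<sigma> in front of \<eta> puts c/\<sigma>
    into the \<eta>-box.\<close>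
  have "norm (f n (Y + mlincomb sV k c E) i j - f n Y i j) < e"
    if c: "\<And>m. m < k \<Longrightarrow> cmod (c m) < min (\<delta>0 / 2) (\<sigma> * \<eta>)" for c
  proof -
    define Z where "Z = mlincomb sV k c E"
    have Zm: "Z \<in> mat_dim n n" unfolding Z_def by (rule mlincomb_mat_dim[OF E])
    have disc: "Y + mscale sV t Z \<in> \<Omega> n" if t: "cmod t \<le> 2" for t
    proof -
      have "cmod (t * c m) < \<delta>0" if "m < k" for m
      proof -
        have "cmod (t * c m) \<le> 2 * cmod (c m)" using t by (simp add: norm_mult mult_right_mono)
        also have "\<dots> < \<delta>0" using c[OF that] by simp
        finally show ?thesis .
      qed
      from dom[OF this] show ?thesis unfolding Z_def mlincomb_scale .
    qed
    have sums: "(\<lambda>l. Delta n l Y Z i j) sums f n (Y + Z) i j"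
      by (rule slice_sums[OF n Y Zm ij _ disc]) auto
    have "Delta n 0 Y Z i j = f n Y i j"
      using asymptotic_expansion_0[OF slice_asymptotic_expansion[OF n Y Zm ij]] by simp
    then have s1: "(\<lambda>l. Delta n (Suc l) Y Z i j) sums (f n (Y + Z) i j - f n Y i j)"
      using sums by (subst sums_Suc_iff) simp
    have s2: "(\<lambda>l. (M * \<tau>) * (1/2)^Suc l) sums ((M * \<tau>) * 1)"
      by (intro sums_mult power_half_series)
    have "norm (Delta n (Suc l) Y Z i j) \<le> (M * \<tau>) * (1/2)^Suc l" for l
    proof -
      let ?h = "\<lambda>m. c m / complex_of_real \<sigma>"
      have "Z = mscale sV (complex_of_real \<sigma>) (mlincomb sV k ?h E)"
        unfolding Z_def mlincomb_scale[symmetric] using \<sigma> by simp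
      then have "Delta n (Suc l) Y Z i j = sW (complex_of_real \<sigma> ^ Suc l) (Delta n (Suc l) Y (mlincomb sV k ?h E) i j)"
        using Delta_homogeneous[OF n Y mlincomb_mat_dim[OF E] ij] by simp
      then have "norm (Delta n (Suc l) Y Z i j) = \<sigma> ^ Suc l * norm (Delta n (Suc l) Y (mlincomb sV k ?h E) i j)"
        using \<sigma> by (simp add: norm_mult norm_power)
      also have "\<dots> \<le> \<sigma> ^ Suc l * M ^ Suc (Suc l)"
      proof (intro mult_left_mono bd)
        fix m assume "m < k"
        then show "cmod (?h m) < \<eta>" using c[of m] \<sigma> by (simp add: norm_divide pos_divide_less_eq mult.commute)
      qed (use \<sigma> in auto)
      also have "\<dots> = M * (\<tau> ^ Suc l * (1/2)^Suc l)"
        using M by (simp add: \<sigma>_def power_divide power_mult_distrib)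
      also have "\<dots> \<le> M * (\<tau> * (1/2)^Suc l)"
        using M \<tau> power_le_one[of \<tau> l] by (intro mult_left_mono mult_right_mono) (auto simp: mult_left_le)
      finally show ?thesis by (simp add: mult_ac)
    qed
    from norm_sums_le[OF s1 s2 this] have "norm (f n (Y + Z) i j - f n Y i j) \<le> (M * \<tau>) * 1" .
    then show ?thesis using \<tau>(3) by (simp add: Z_def)
  qed
  then show ?thesis using \<delta>0 \<sigma> \<eta> by (intro exI[of _ "min (\<delta>0 / 2) (\<sigma> * \<eta>)"]) auto
qed

lemma f_mlincomb_continuous_on:
  fixes c :: "'x::t2_space \<Rightarrow> nat \<Rightarrow> complex"
  assumes n: "0 < n" and E: "\<forall>i<k. E i \<in> mat_dim n n" and ij: "i < n" "j < n"
    and c: "\<And>i. i < k \<Longrightarrow> continuous_on UNIV (\<lambda>x. c x i)"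
  shows "continuous_on {x. mlincomb sV k (c x) E \<in> \<Omega> n} (\<lambda>x. f n (mlincomb sV k (c x) E) i j)"
  unfolding continuous_on_eq_continuous_within
proof
  fix x0 assume "x0 \<in> {x. mlincomb sV k (c x) E \<in> \<Omega> n}"
  then have Y: "mlincomb sV k (c x0) E \<in> \<Omega> n" by simp
  have "isCont (\<lambda>x. f n (mlincomb sV k (c x) E) i j) x0"
    unfolding isCont_def tendsto_iff
  proof (intro allI impI)
    fix e :: real assume "e > 0"
    from f_mlincomb_continuous_at[OF n Y E ij this] obtain \<delta> where \<delta>: "\<delta> > 0"
      and *: "\<And>d. (\<And>m. m < k \<Longrightarrow> cmod (d m) < \<delta>) \<Longrightarrow>
        norm (f n (mlincomb sV k (c x0) E + mlincomb sV k d E) i j - f n (mlincomb sV k (c x0) E) i j) < e"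
      by blast
    have "\<forall>\<^sub>F x in at x0. dist (c x m) (c x0 m) < \<delta>" if "m < k" for m
    proof -
      have "isCont (\<lambda>x. c x m) x0" using c[OF that] by (simp add: continuous_on_eq_continuous_at)
      then show ?thesis using \<delta> by (simp add: isCont_def tendsto_iff)
    qed
    then have "\<forall>\<^sub>F x in at x0. \<forall>m\<in>{..<k}. dist (c x m) (c x0 m) < \<delta>"
      by (intro eventually_ball_finite) auto
    then show "\<forall>\<^sub>F x in at x0. dist (f n (mlincomb sV k (c x) E) i j) (f n (mlincomb sV k (c x0) E) i j) < e"
    proof eventually_elim
      case (elim x)
      have "mlincomb sV k (c x) E = mlincomb sV k (c x0) E + mlincomb sV k (\<lambda>m. c x m - c x0 m) E"
        unfolding mlincomb_add[symmetric] by (rule mlincomb_cong) simp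
      then show ?case using *[of "\<lambda>m. c x m - c x0 m"] elim by (simp add: dist_norm)
    qed
  qed
  then show "continuous (at x0 within {x. mlincomb sV k (c x) E \<in> \<Omega> n}) (\<lambda>x. f n (mlincomb sV k (c x) E) i j)"
    by (rule continuous_at_imp_continuous_at_within)
qed

end

section \<open>The Taylor-Taylor series\<close>

text \<open>Tube lemma: the closed disc is compact, so a universal quantifier over it preserves
  openness. Applied to discs through a varying point, it gives finite openness of circular
  sets.\<close>

lemma open_forall_compact:
  fixes U :: "('a::topological_space \<times> complex) set"
  assumes "open U"
  shows "open {c. \<forall>t. cmod t \<le> r \<longrightarrow> (c, t) \<in> U}"
proof (subst open_subopen, intro ballI)
  fix c assume "c \<in> {c. \<forall>t. cmod t \<le> r \<longrightarrow> (c, t) \<in> U}"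
  then have "{c} \<times> cball 0 r \<subseteq> U" by auto
  from Elementary_Topology.tube_lemma[OF compact_cball assms this]
  obtain X0 where "c \<in> X0" "open X0" "X0 \<times> cball 0 r \<subseteq> U" by blast
  then show "\<exists>T. open T \<and> c \<in> T \<and> T \<subseteq> {c. \<forall>t. cmod t \<le> r \<longrightarrow> (c, t) \<in> U}"
    by (intro exI[of _ X0]) auto
qed

context cbanach
begin

lemma psum_0: "psum a 0 = a 0"
proof -
  have "(\<lambda>l. s (0^l) (a l)) sums (\<Sum>l\<in>{0}. s (0^l) (a l))"
    by (rule sums_finite) auto
  then show ?thesis by (simp add: psum_def sums_iff)
qed

lemma difference_quotient_tendsto:
  assumes "(g has_derivative (\<lambda>h. s h D)) (at t0)"
  shows "((\<lambda>h. norm (s (1/h) (g (t0 + h) - g t0) - D)) \<longlongrightarrow> 0) (at 0)"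
proof -
  have "((\<lambda>h. norm (g (t0 + h) - g t0 - s h D) / norm h) \<longlongrightarrow> 0) (at 0)"
    using assms unfolding has_derivative_at by blast
  moreover have "\<forall>\<^sub>F h in at 0. norm (g (t0 + h) - g t0 - s h D) / norm h = norm (s (1/h) (g (t0 + h) - g t0) - D)"
    using eventually_neq_at_within[of 0]
  proof eventually_elim
    case (elim h)
    have "s (1/h) (g (t0 + h) - g t0) - D = s (1/h) (g (t0 + h) - g t0 - s h D)"
      using elim by (simp add: scale_right_diff_distrib)
    then have "norm (s (1/h) (g (t0 + h) - g t0) - D) = norm (s (1/h) (g (t0 + h) - g t0 - s h D))"
      by (rule arg_cong)
    then show ?case by (simp add: norm_divide)
  qed
  ultimately show ?thesis by (rule Lim_transform_eventually)
qed

end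

context admissible
begin

section \<open>Passing from entries to matrix norms\<close>

text \<open>Chosen once for each n, so that the estimates for the terms and for the remainders share
  one constant for all X.\<close>

definition entry_const :: "nat \<Rightarrow> real" where
  "entry_const n = (SOME C. \<forall>X\<in>mat_dim n n. \<forall>B. (\<forall>i<n. \<forall>j<n. norm (X i j) \<le> B) \<longrightarrow> nrm n X \<le> C * B)"

lemma nrm_le_entry_const:
  assumes n: "n > 0" and X: "X \<in> mat_dim n n" and B: "\<And>i j. i < n \<Longrightarrow> j < n \<Longrightarrow> norm (X i j) \<le> B"
  shows "nrm n X \<le> entry_const n * B"
proof -
  let ?P = "\<lambda>C. \<forall>X\<in>mat_dim n n. \<forall>B. (\<forall>i<n. \<forall>j<n. norm (X i j) \<le> B) \<longrightarrow> nrm n X \<le> C * B"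
  obtain C where C: "C > 0" "\<And>X. X \<in> mat_dim n n \<Longrightarrow> nrm n X \<le> C * (\<Sum>i<n. \<Sum>j<n. norm (X i j))"
    using nrm_le_norm_entries[OF n] by blast
  have "nrm n X \<le> (C * (real n * real n)) * B" if X: "X \<in> mat_dim n n" and B: "\<forall>i<n. \<forall>j<n. norm (X i j) \<le> B" for X B
  proof -
    have "nrm n X \<le> C * (\<Sum>i<n. \<Sum>j<n. norm (X i j))" by (rule C(2)[OF X])
    also have "\<dots> \<le> C * (\<Sum>i<n. \<Sum>j<n. B)" using C(1) B by (intro mult_left_mono sum_mono) auto
    finally show ?thesis by (simp add: mult_ac)
  qed
  then have "?P (C * (real n * real n))" by blast
  then have "?P (entry_const n)" unfolding entry_const_def by (rule someI[where P = ?P])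
  with X B show ?thesis by blast
qed

lemma nrm_tendsto_zero:
  assumes n: "n > 0" and G: "\<forall>\<^sub>F x in F. G x \<in> mat_dim n n"
    and lim: "\<And>i j. i < n \<Longrightarrow> j < n \<Longrightarrow> ((\<lambda>x. norm (G x i j)) \<longlongrightarrow> 0) F"
  shows "((\<lambda>x. nrm n (G x)) \<longlongrightarrow> 0) F"
proof -
  obtain C where C: "\<And>X. X \<in> mat_dim n n \<Longrightarrow> nrm n X \<le> C * (\<Sum>i<n. \<Sum>j<n. norm (X i j))"
    using nrm_le_norm_entries[OF n] by blast
  have "((\<lambda>x. C * (\<Sum>i<n. \<Sum>j<n. norm (G x i j))) \<longlongrightarrow> C * (\<Sum>i<n. \<Sum>j<n. 0)) F"
    by (intro tendsto_intros lim) auto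
  then have "((\<lambda>x. C * (\<Sum>i<n. \<Sum>j<n. norm (G x i j))) \<longlongrightarrow> 0) F" by simp
  then show ?thesis
  proof (rule Lim_null_comparison[rotated])
    show "\<forall>\<^sub>F x in F. norm (nrm n (G x)) \<le> C * (\<Sum>i<n. \<Sum>j<n. norm (G x i j))"
      using G by eventually_elim (use C nrm_nonneg[OF n] in auto)
  qed
qed

lemma has_mderivI:
  assumes n: "n > 0" and g: "open T" "t0 \<in> T" "\<And>t. t \<in> T \<Longrightarrow> g t \<in> mat_dim n n" and D: "D \<in> mat_dim n n"
    and der: "\<And>i j. i < n \<Longrightarrow> j < n \<Longrightarrow> ((\<lambda>t. g t i j) has_derivative (\<lambda>h. s h (D i j))) (at t0)"
  shows "has_mderiv s (nrm n) g D t0"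
  unfolding has_mderiv_def
proof (rule nrm_tendsto_zero[OF n])
  have "open ((\<lambda>h. t0 + h) -` T)" by (intro open_vimage g continuous_intros)
  then have "\<forall>\<^sub>F h in nhds 0. t0 + h \<in> T"
    using eventually_nhds_in_open[of "(\<lambda>h. t0 + h) -` T" 0] g(2) by simp
  then have "\<forall>\<^sub>F h in at 0. t0 + h \<in> T" unfolding eventually_at_filter by eventually_elim simp
  then show "\<forall>\<^sub>F h in at 0. mscale s (1/h) (g (t0 + h) - g t0) - D \<in> mat_dim n n"
    by eventually_elim (intro mat_dim_diff mat_dim_mscale[OF vector_space_axioms] g D)
  fix i j assume "i < n" "j < n"
  from difference_quotient_tendsto[OF der[OF this]]
  show "((\<lambda>h. norm ((mscale s (1/h) (g (t0 + h) - g t0) - D) i j)) \<longlongrightarrow> 0) (at 0)"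
    by (simp add: mscale_def)
qed

end

context nc_fun
begin

section \<open>Derivatives along slices\<close>

lemma nc_G_differentiable: "G_differentiable sV sW nrm \<Omega> f"
  unfolding G_differentiable_def
proof (intro allI impI ballI)
  fix n and X Z :: "'v mat" assume n: "0 < n" and X: "X \<in> \<Omega> n" and Z: "Z \<in> mat_dim n n"
  have X0: "X + mscale sV 0 Z \<in> \<Omega> n" using X by simp
  have "has_mderiv sW (nrm n) (\<lambda>t. f n (X + mscale sV t Z)) (Delta n 1 (X + mscale sV 0 Z) Z) 0"
    by (rule has_mderivI[OF n open_slice[OF n Omega_mat_dim[OF X] Z]])
       (use X0 f_mat_dim[OF n] Delta_mat_dim slice_has_derivative[OF n X0 Z] in auto)
  then have "((\<lambda>t. nrm n (mscale sW (1 / t) (f n (X + mscale sV t Z) - f n X) - Delta n 1 X Z)) \<longlongrightarrow> 0) (at 0)"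
    by (simp add: has_mderiv_def)
  then show "\<exists>D\<in>mat_dim n n. ((\<lambda>t. nrm n (mscale sW (1 / t) (f n (X + mscale sV t Z) - f n X) - D)) \<longlongrightarrow> 0) (at 0)"
    using Delta_mat_dim by blast
qed

text \<open>Near 0 each entry of the slice is a power series with coefficients \<open>Delta\<close>,
  so the derivatives on a whole ball are obtained by iterating \<open>dcoeff\<close>; at 0 the N-th
  one is N! times the N-th coefficient.\<close>

lemma nc_nth_deriv_at:
  assumes n: "0 < n" and Y: "Y \<in> \<Omega> n" and Z: "Z \<in> mat_dim n n"
  shows "nth_deriv_at sW n (nrm n) (\<lambda>t. f n (Y + mscale sV t Z)) N (mscale sW (of_nat (fact N)) (Delta n N Y Z))"
proof -
  obtain r where r: "r > 0" "cball 0 r \<subseteq> {t. Y + mscale sV t Z \<in> \<Omega> n}"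
    using open_contains_cball[THEN iffD1, OF open_slice[OF n Omega_mat_dim[OF Y] Z], rule_format, of 0] Y by auto
  then have disc: "Y + mscale sV t Z \<in> \<Omega> n" if "cmod t \<le> r" for t using that by auto
  define a where "a i j l = Delta n l Y Z i j" for i j l
  have gb: "geom_bounded r (a i j)" if ij: "i < n" "j < n" for i j
    unfolding geom_bounded_def
  proof (intro allI impI)
    fix q :: real assume q: "0 < q" "q < r"
    obtain M where M: "\<And>t. cmod t \<le> r \<Longrightarrow> norm (f n (Y + mscale sV t Z) i j) \<le> M"
      using slice_bounded[OF n Y Z ij disc] by blast
    have "norm (a i j l) \<le> M / q^l" for l
      unfolding a_def by (rule slice_cauchy_estimate[OF n Y Z ij q(1)]) (use q M disc in auto)
    then show "\<exists>M. \<forall>l. norm (a i j l) \<le> M / q^l" by blast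
  qed
  then have gbk: "geom_bounded r ((dcoeff ^^ k) (a i j))" if "i < n" "j < n" for i j k
    using that by (induction k) (auto intro: geom_bounded_dcoeff)
  have sumf: "psum (a i j) t = f n (Y + mscale sV t Z) i j" if t: "cmod t < r" and ij: "i < n" "j < n" for t i j
  proof -
    obtain M where M: "\<And>t. cmod t \<le> r \<Longrightarrow> norm (f n (Y + mscale sV t Z) i j) \<le> M"
      using slice_bounded[OF n Y Z ij disc] by blast
    have bd: "norm ((\<Sum>l<N. sW (t^l) (a i j l)) - f n (Y + mscale sV t Z) i j) \<le> M * (cmod t / r)^N / (1 - cmod t / r)" for N
      using slice_taylor_remainder[OF n Y Z ij r(1) disc _ t, where M = M and N = N] M unfolding a_def by (simp add: norm_minus_commute)
    have "(\<lambda>N. M * (cmod t / r)^N / (1 - cmod t / r)) \<longlonglongrightarrow> M * 0 / (1 - cmod t / r)"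
      by (intro tendsto_intros LIMSEQ_power_zero) (use r t in auto)
    then have "(\<lambda>N. M * (cmod t / r)^N / (1 - cmod t / r)) \<longlonglongrightarrow> 0" by simp
    then have "(\<lambda>N. (\<Sum>l<N. sW (t^l) (a i j l)) - f n (Y + mscale sV t Z) i j) \<longlonglongrightarrow> 0"
      by (rule Lim_null_comparison[rotated]) (use bd in auto)
    then have "(\<lambda>l. sW (t^l) (a i j l)) sums f n (Y + mscale sV t Z) i j"
      unfolding sums_def using LIM_zero_iff by blast
    then show ?thesis by (simp add: psum_def sums_iff)
  qed
  define Ds where "Ds k t = (\<lambda>i j. if i < n \<and> j < n then psum ((dcoeff ^^ k) (a i j)) t else 0)" for k :: nat and t
  have Dm: "Ds k t \<in> mat_dim n n" for k t by (auto simp: Ds_def mat_dim_def)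
  have der: "has_mderiv sW (nrm n) (Ds k) (Ds (Suc k) t) t" if "t \<in> ball 0 r" for k t
    by (rule has_mderivI[OF n open_UNIV])
       (use that gbk Dm in \<open>auto simp: Ds_def intro!: psum_has_derivative\<close>)
  show ?thesis
    unfolding nth_deriv_at_def
  proof (intro exI[of _ r] exI[of _ Ds] conjI ballI allI impI)
    show "Ds 0 t = f n (Y + mscale sV t Z)" if "t \<in> ball 0 r" for t
      using f_mat_dim[OF n disc[of t]] that sumf by (auto simp: Ds_def mat_dim_def fun_eq_iff)
    show "has_mderiv sW (nrm n) (Ds (N - 1)) (Ds N 0) 0" if "0 < N"
      using der[of 0 "N - 1"] that r(1) by simp
    show "Ds N 0 = mscale sW (of_nat (fact N)) (Delta n N Y Z)"
      using Delta_mat_dim[of n N Y Z]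
      by (auto simp: Ds_def mscale_def psum_0 dcoeff_iterate a_def pochhammer_fact[symmetric] mat_dim_def fun_eq_iff)
  qed (use r Dm der in auto)
qed

section \<open>Uniform estimates on discs and circular neighbourhoods\<close>

text \<open>Of the direction Z, only r and M enter the right-hand sides, so any set of directions
  sharing them has uniform estimates; r > 1 produces the geometric ratio 1/r.\<close>

lemma disc_estimates:
  assumes n: "0 < n" and Y: "Y \<in> \<Omega> n" and Z: "Z \<in> mat_dim n n" and r: "1 < r"
    and disc: "\<And>t. cmod t \<le> r \<Longrightarrow> Y + mscale sV t Z \<in> \<Omega> n"
    and M: "\<And>i j t. i < n \<Longrightarrow> j < n \<Longrightarrow> cmod t \<le> r \<Longrightarrow> norm (f n (Y + mscale sV t Z) i j) \<le> M"
  shows disc_Delta_bound: "nrm n (Delta n l Y Z) \<le> entry_const n * M * (1/r)^l"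
    and disc_remainder_bound: "nrm n (f n (Y + Z) - (\<Sum>l<N. Delta n l Y Z)) \<le> entry_const n * M * (1/r)^N / (1 - 1/r)"
proof -
  have r0: "0 < r" using r by simp
  have "norm (Delta n l Y Z i j) \<le> M / r^l" if "i < n" "j < n" for i j
    by (rule slice_cauchy_estimate[OF n Y Z that r0 disc M[OF that]]) auto
  from nrm_le_entry_const[OF n Delta_mat_dim this]
  show "nrm n (Delta n l Y Z) \<le> entry_const n * M * (1/r)^l" by (simp add: power_divide)
  have YZ: "Y + Z \<in> \<Omega> n" using disc[of 1] r by simp
  have "nrm n (f n (Y + Z) - (\<Sum>l<N. Delta n l Y Z)) \<le> entry_const n * (M * (1/r)^N / (1 - 1/r))"
  proof (rule nrm_le_entry_const[OF n])
    show "f n (Y + Z) - (\<Sum>l<N. Delta n l Y Z) \<in> mat_dim n n"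
      by (intro mat_dim_diff mat_dim_sum f_mat_dim[OF n YZ] Delta_mat_dim)
    fix i j assume ij: "i < n" "j < n"
    have "norm (f n (Y + mscale sV 1 Z) i j - (\<Sum>l<N. sW (1^l) (Delta n l Y Z i j))) \<le> M * (cmod 1 / r)^N / (1 - cmod 1 / r)"
      by (rule slice_taylor_remainder[OF n Y Z ij r0 disc M[OF ij]]) (use r in auto)
    then show "norm ((f n (Y + Z) - (\<Sum>l<N. Delta n l Y Z)) i j) \<le> M * (1/r)^N / (1 - 1/r)"
      by (simp add: sum_fun_apply2)
  qed
  then show "nrm n (f n (Y + Z) - (\<Sum>l<N. Delta n l Y Z)) \<le> entry_const n * M * (1/r)^N / (1 - 1/r)"
    by (simp add: mult.assoc)
qed

text \<open>Y + t(X - Y) = tX + (1 - t)Y is a combination of the family extended by Y at index k,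
  with coefficients continuous in the pair (c, t). This reduces questions about discs through
  varying X to openness and continuity on finite families.\<close>

lemma circle_mlincomb:
  "Y + mscale sV t (mlincomb sV k c E - Y) = mlincomb sV (Suc k) (\<lambda>m. if m < k then t * c m else 1 - t) (E(k := Y))"
proof -
  have "mlincomb sV k (\<lambda>m. if m < k then t * c m else 1 - t) (E(k := Y)) = mscale sV t (mlincomb sV k c E)"
    unfolding mlincomb_scale[symmetric] by (simp add: mlincomb_def)
  then show ?thesis
    unfolding mlincomb_Suc by (simp add: M.scale_right_diff_distrib M.scale_left_diff_distrib)
qed

lemma circle_coeff_continuous:
  "continuous_on UNIV (\<lambda>x::(nat \<Rightarrow> complex) \<times> complex. if m < k then snd x * fst x m else 1 - snd x)"
proof -
  have "continuous_on UNIV (\<lambda>x::(nat \<Rightarrow> complex) \<times> complex. fst x m)"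
    using continuous_on_compose2[OF continuous_on_product_coordinates[of m] continuous_on_fst[OF continuous_on_id]] by auto
  then show ?thesis by (cases "m < k") (auto intro!: continuous_intros)
qed

lemma circle_mlincomb_family:
  assumes "\<forall>i<k. E i \<in> mat_dim n n" "Y \<in> \<Omega> n"
  shows "\<forall>i<Suc k. (E(k := Y)) i \<in> mat_dim n n"
  using assms Omega_mat_dim by (auto simp: less_Suc_eq)

lemma open_circle:
  assumes n: "0 < n" and Y: "Y \<in> \<Omega> n" and E: "\<forall>i<k. E i \<in> mat_dim n n"
  shows "open {x. Y + mscale sV (snd x) (mlincomb sV k (fst x) E - Y) \<in> \<Omega> n}"
  unfolding circle_mlincomb
  by (rule fin_open_level_preimage[OF V fin_open[OF n] _ circle_coeff_continuous])
     (use circle_mlincomb_family[OF E Y] in auto)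

lemma f_circle_continuous_on:
  assumes n: "0 < n" and Y: "Y \<in> \<Omega> n" and E: "\<forall>i<k. E i \<in> mat_dim n n" and ij: "i < n" "j < n"
  shows "continuous_on {x. Y + mscale sV (snd x) (mlincomb sV k (fst x) E - Y) \<in> \<Omega> n}
    (\<lambda>x. f n (Y + mscale sV (snd x) (mlincomb sV k (fst x) E - Y)) i j)"
  unfolding circle_mlincomb
  by (rule f_mlincomb_continuous_on[OF n circle_mlincomb_family[OF E Y] ij circle_coeff_continuous])

text \<open>f is continuous on the open set of pairs that stay in \<Omega>, and a strict inequality
  between continuous functions is an open condition.\<close>

lemma open_circle_bounded:
  assumes n: "0 < n" and Y: "Y \<in> \<Omega> n" and E: "\<forall>i<k. E i \<in> mat_dim n n"
  shows "open {x. Y + mscale sV (snd x) (mlincomb sV k (fst x) E - Y) \<in> \<Omega> n \<and>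
    (\<forall>i<n. \<forall>j<n. norm (f n (Y + mscale sV (snd x) (mlincomb sV k (fst x) E - Y)) i j) < M)}"
proof -
  let ?U = "{x. Y + mscale sV (snd x) (mlincomb sV k (fst x) E - Y) \<in> \<Omega> n}"
  let ?F = "\<lambda>i j x. f n (Y + mscale sV (snd x) (mlincomb sV k (fst x) E - Y)) i j"
  define W where "W i j = ?U \<inter> (\<lambda>x. norm (?F i j x)) -` {..<M}" for i j
  have "open (W i j)" if "i < n" "j < n" for i j
    unfolding W_def
    by (rule continuous_open_preimage[OF continuous_on_norm[OF f_circle_continuous_on[OF n Y E that]] open_circle[OF n Y E]]) simp
  then have "open (?U \<inter> (\<Inter>i\<in>{..<n}. \<Inter>j\<in>{..<n}. W i j))"
    using open_circle[OF n Y E] by (intro open_Int open_INT ballI) auto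
  also have "?U \<inter> (\<Inter>i\<in>{..<n}. \<Inter>j\<in>{..<n}. W i j)
    = {x. Y + mscale sV (snd x) (mlincomb sV k (fst x) E - Y) \<in> \<Omega> n \<and> (\<forall>i<n. \<forall>j<n. norm (?F i j x) < M)}"
    by (auto simp: W_def)
  finally show ?thesis .
qed

lemma fin_open_levelI:
  assumes "\<And>k E. \<forall>i<k. E i \<in> mat_dim n n \<Longrightarrow> open {c. mlincomb sV k c E \<in> A}"
  shows "fin_open_level sV n A"
  unfolding fin_open_level_def
proof (intro allI impI)
  fix k E assume "fd_basis sV n k E"
  then have "open {c. mlincomb sV k c E \<in> A}" using assms by (auto simp: fd_basis_def)
  moreover have "{c \<in> coords k. mlincomb sV k c E \<in> A} = coords k \<inter> {c. mlincomb sV k c E \<in> A}" by auto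
  ultimately show "openin (top_of_set (coords k)) {c \<in> coords k. mlincomb sV k c E \<in> A}"
    by (simp add: openin_open_Int)
qed

text \<open>Multiplying the disc parameter u by t with |t| \<le> 1 stays in the disc |u| \<le> r.
  The radius is free because it is 1 for \<open>Upsilon\<close> and larger than 1 for the
  neighbourhood of a compact set.\<close>

lemma complete_circularI:
  assumes "\<And>X. X \<in> A \<longleftrightarrow> (\<forall>t. cmod t \<le> r \<longrightarrow> Y + mscale sV t (X - Y) \<in> B)"
  shows "complete_circular sV Y A"
  unfolding complete_circular_def
proof (intro ballI allI impI)
  fix X and t :: complex assume X: "X \<in> A" and t: "cmod t \<le> 1"
  have "Y + mscale sV u (Y + mscale sV t (X - Y) - Y) \<in> B" if u: "cmod u \<le> r" for u
  proof -
    have "cmod (u * t) \<le> r" using mult_left_le[OF t, of "cmod u"] u by (simp add: norm_mult)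
    then have "Y + mscale sV (u * t) (X - Y) \<in> B" using X assms by blast
    then show ?thesis by simp
  qed
  then show "Y + mscale sV t (X - Y) \<in> A" using assms by blast
qed

lemma Upsilon_iff: "X \<in> Upsilon sV \<Omega> n Y \<longleftrightarrow> (\<forall>t. cmod t \<le> 1 \<longrightarrow> Y + mscale sV t (X - Y) \<in> \<Omega> n)"
proof -
  have "X \<in> \<Omega> n" if "\<forall>t. cmod t \<le> 1 \<longrightarrow> Y + mscale sV t (X - Y) \<in> \<Omega> n"
    using that[rule_format, of 1] by simp
  then show ?thesis by (auto simp: Upsilon_def)
qed

lemma fin_open_Upsilon:
  assumes n: "0 < n" and Y: "Y \<in> \<Omega> n"
  shows "fin_open_level sV n (Upsilon sV \<Omega> n Y)"
proof (rule fin_open_levelI)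
  fix k and E :: "nat \<Rightarrow> 'v mat" assume "\<forall>i<k. E i \<in> mat_dim n n"
  from open_forall_compact[OF open_circle[OF n Y this], of 1]
  show "open {c. mlincomb sV k c E \<in> Upsilon sV \<Omega> n Y}" unfolding Upsilon_iff by simp
qed

lemma Upsilon_maximal:
  assumes "A \<subseteq> \<Omega> n" "complete_circular sV Y A"
  shows "A \<subseteq> Upsilon sV \<Omega> n Y"
  using assms unfolding Upsilon_iff subset_iff complete_circular_def by blast

text \<open>Openness enlarges the closed unit disc through X to a radius above 1, on which all
  entries of f are bounded; the disc estimates then give geometric decay.\<close>

lemma Upsilon_series:
  assumes n: "0 < n" and Y: "Y \<in> \<Omega> n" and X: "X \<in> Upsilon sV \<Omega> n Y"
  shows "summable (\<lambda>l. nrm n (Delta n l Y (X - Y)))"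
    and "(\<lambda>N. nrm n (f n X - (\<Sum>l<N. Delta n l Y (X - Y)))) \<longlonglongrightarrow> 0"
proof -
  have X1: "cball 0 1 \<subseteq> {t. Y + mscale sV t (X - Y) \<in> \<Omega> n}" using X unfolding Upsilon_iff by auto
  have Xm: "X \<in> \<Omega> n" using X by (simp add: Upsilon_def)
  have Z: "X - Y \<in> mat_dim n n" by (intro mat_dim_diff Omega_mat_dim Xm Y)
  obtain R where R: "R > 1" "ball 0 R \<subseteq> {t. Y + mscale sV t (X - Y) \<in> \<Omega> n}"
    using open_cball_enlarge[OF open_slice[OF n Omega_mat_dim[OF Y] Z] X1] by auto
  define r where "r = (1 + R) / 2"
  have r: "1 < r" "r < R" using R(1) by (auto simp: r_def)
  have disc: "Y + mscale sV t (X - Y) \<in> \<Omega> n" if "cmod t \<le> r" for t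
  proof -
    have "t \<in> ball 0 R" using r that by simp
    then show ?thesis using R(2) by blast
  qed
  have "\<exists>M. \<forall>t. cmod t \<le> r \<longrightarrow> norm (f n (Y + mscale sV t (X - Y)) i j) \<le> M" if "i < n" "j < n" for i j
    by (rule slice_bounded[OF n Y Z that disc])
  then obtain m where m: "\<And>i j t. i < n \<Longrightarrow> j < n \<Longrightarrow> cmod t \<le> r \<Longrightarrow> norm (f n (Y + mscale sV t (X - Y)) i j) \<le> m i j"
    by metis
  define M where "M = (\<Sum>i<n. \<Sum>j<n. \<bar>m i j\<bar>)"
  have M: "norm (f n (Y + mscale sV t (X - Y)) i j) \<le> M" if ij: "i < n" "j < n" and t: "cmod t \<le> r" for i j t
  proof -
    have "norm (f n (Y + mscale sV t (X - Y)) i j) \<le> \<bar>m i j\<bar>" using m[OF ij t] by simp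
    also have "\<dots> \<le> (\<Sum>j<n. \<bar>m i j\<bar>)" by (rule member_le_sum) (use ij in auto)
    also have "\<dots> \<le> M" unfolding M_def by (rule member_le_sum) (use ij in \<open>auto intro: sum_nonneg\<close>)
    finally show ?thesis .
  qed
  define C where "C = entry_const n"
  have C: "nrm n (Delta n l Y (X - Y)) \<le> C * M * (1/r)^l"
     "nrm n (f n (Y + (X - Y)) - (\<Sum>l<N. Delta n l Y (X - Y))) \<le> C * M * (1/r)^N / (1 - 1/r)" for l N
    unfolding C_def using disc_estimates[OF n Y Z r(1) disc M] by auto
  show "summable (\<lambda>l. nrm n (Delta n l Y (X - Y)))"
  proof (rule summable_comparison_test'[where N = 0])
    show "summable (\<lambda>l. C * M * (1/r)^l)" using r by (intro summable_mult summable_geometric) auto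
    show "norm (nrm n (Delta n l Y (X - Y))) \<le> C * M * (1/r)^l" for l
      using C(1)[of l] nrm_nonneg[OF n Delta_mat_dim[of n l Y "X - Y"]] by simp
  qed
  have "(\<lambda>N. C * M * (1/r)^N / (1 - 1/r)) \<longlonglongrightarrow> C * M * 0 / (1 - 1/r)"
    by (intro tendsto_intros LIMSEQ_power_zero) (use r in auto)
  then have lim: "(\<lambda>N. C * M * (1/r)^N / (1 - 1/r)) \<longlonglongrightarrow> 0" by simp
  have nn: "0 \<le> nrm n (f n X - (\<Sum>l<N. Delta n l Y (X - Y)))" for N
    by (intro nrm_nonneg[OF n] mat_dim_diff mat_dim_sum f_mat_dim[OF n Xm] Delta_mat_dim)
  have "Y + (X - Y) = X" by simp
  then show "(\<lambda>N. nrm n (f n X - (\<Sum>l<N. Delta n l Y (X - Y)))) \<longlonglongrightarrow> 0"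
    using C(2) nn by (intro Lim_null_comparison[OF _ lim]) auto
qed

text \<open>The neighbourhood is the set of all X for which Y + t(X - Y), |t| \<le> r, stays in
  \<Omega> with entries of f below M in norm. Compactness of K supplies r > 1 and M; since both are
  fixed, the set carries uniform geometric estimates, and K inherits uniform convergence from
  it.\<close>

lemma compact_uniform:
  assumes n: "0 < n" and Y: "Y \<in> \<Omega> n" and E: "fd_basis sV n k E" and K: "fd_compact sV k E K" and KU: "K \<subseteq> Upsilon sV \<Omega> n Y"
  shows "\<forall>\<epsilon>>0. \<exists>N0. \<forall>N\<ge>N0. \<forall>X\<in>K. nrm n (f n X - (\<Sum>l<N. Delta n l Y (X - Y))) < \<epsilon>" (is ?unif)
    and "\<exists>\<Upsilon>K. fin_open_level sV n \<Upsilon>K \<and> complete_circular sV Y \<Upsilon>K \<and> K \<subseteq> \<Upsilon>K \<and> \<Upsilon>K \<subseteq> Upsilon sV \<Omega> n Y \<and>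
              (\<Sum>l. (SUP X\<in>\<Upsilon>K. ennreal (nrm n (Delta n l Y (X - Y))))) < top" (is ?nbhd)
proof -
  have E': "\<forall>i<k. E i \<in> mat_dim n n" using E by (simp add: fd_basis_def)
  define Kc where "Kc = {c \<in> coords k. mlincomb sV k c E \<in> K}"
  have cK: "compact Kc" using K by (simp add: fd_compact_def Kc_def)
  let ?U = "{x :: (nat \<Rightarrow> complex) \<times> complex. Y + mscale sV (snd x) (mlincomb sV k (fst x) E - Y) \<in> \<Omega> n}"
  have "Kc \<times> cball 0 1 \<subseteq> ?U" using KU by (auto simp: Kc_def Upsilon_iff subset_iff)
  from compact_subset_open_imp_ball_epsilon_subset[OF compact_Times[OF cK compact_cball] open_circle[OF n Y E'] this]
  obtain e where e: "e > 0" "(\<Union>x\<in>Kc \<times> cball 0 1. ball x e) \<subseteq> ?U" by blast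
  \<comment> \<open>r - 1 = e/2 is less than the margin e: dividing t by r brings it back to the
    unit disc and moves it by at most r - 1.\<close>
  define r where "r = 1 + e / 2"
  have r: "r > 1" using e by (simp add: r_def)
  have sub: "Kc \<times> cball 0 r \<subseteq> ?U"
  proof
    fix x :: "(nat \<Rightarrow> complex) \<times> complex" assume "x \<in> Kc \<times> cball 0 r"
    then obtain c t where x: "x = (c, t)" "c \<in> Kc" "cmod t \<le> r" by (cases x) auto
    let ?t = "t / complex_of_real r"
    have "cmod ?t \<le> 1" using x r by (simp add: norm_divide)
    moreover have "dist ?t t < e"
    proof -
      have "?t - t = complex_of_real (1/r - 1) * t" by (simp add: algebra_simps)
      then have "dist ?t t = \<bar>1/r - 1\<bar> * cmod t" unfolding dist_norm by (simp only: norm_mult norm_of_real)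
      also have "\<dots> \<le> \<bar>1/r - 1\<bar> * r" using x by (intro mult_left_mono) auto
      also have "\<dots> = r - 1" using r by (simp add: abs_if field_simps)
      finally show ?thesis using e by (simp add: r_def)
    qed
    then have "x \<in> ball (c, ?t) e" unfolding x(1) by (simp add: dist_Pair_Pair)
    moreover have "(c, ?t) \<in> Kc \<times> cball 0 1" using calculation(1) x(2) by simp
    ultimately have "x \<in> (\<Union>x\<in>Kc \<times> cball 0 1. ball x e)" by blast
    then show "x \<in> ?U" using e(2) by blast
  qed
  define S where "S x = (\<Sum>i<n. \<Sum>j<n. norm (f n (Y + mscale sV (snd x) (mlincomb sV k (fst x) E - Y)) i j))" for x
  have "continuous_on (Kc \<times> cball 0 r) S"
    unfolding S_def
    by (intro continuous_on_sum continuous_on_norm continuous_on_subset[OF f_circle_continuous_on[OF n Y E'] sub]) auto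
  then have "compact (S ` (Kc \<times> cball 0 r))"
    by (rule compact_continuous_image) (intro compact_Times cK compact_cball)
  then obtain B where "\<forall>x\<in>S ` (Kc \<times> cball 0 r). norm x \<le> B" using compact_imp_bounded bounded_iff by metis
  then have B: "S x \<le> B" if "x \<in> Kc \<times> cball 0 r" for x using that by force
  \<comment> \<open>Strictly above the bound B, as the open condition in P asks for a strict
    inequality.\<close>
  define M where "M = B + 1"
  define P where "P X \<longleftrightarrow> X \<in> \<Omega> n \<and> (\<forall>i<n. \<forall>j<n. norm (f n X i j) < M)" for X
  \<comment> \<open>Cut out of all n x n matrices rather than of the span of E, since it has to be
    open in every finite-dimensional subspace.\<close>
  define UK where "UK = {X. \<forall>t. cmod t \<le> r \<longrightarrow> Y + mscale sV t (X - Y) \<in> {X. P X}}"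
  have KUK: "K \<subseteq> UK"
  proof
    fix X assume "X \<in> K"
    then obtain c where c: "c \<in> Kc" "X = mlincomb sV k c E"
      using K by (auto simp: fd_compact_def fd_span_def Kc_def)
    have "P (Y + mscale sV t (X - Y))" if t: "cmod t \<le> r" for t
    proof -
      have mem: "(c, t) \<in> Kc \<times> cball 0 r" using c t by auto
      have "norm (f n (Y + mscale sV t (X - Y)) i j) < M" if ij: "i < n" "j < n" for i j
      proof -
        have "norm (f n (Y + mscale sV t (X - Y)) i j) \<le> (\<Sum>j<n. norm (f n (Y + mscale sV t (X - Y)) i j))"
          by (rule member_le_sum) (use ij in auto)
        also have "\<dots> \<le> (\<Sum>i<n. \<Sum>j<n. norm (f n (Y + mscale sV t (X - Y)) i j))"
          by (rule member_le_sum[of _ _ "\<lambda>i. \<Sum>j<n. norm (f n (Y + mscale sV t (X - Y)) i j)"]) (use ij in \<open>auto intro: sum_nonneg\<close>)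
        also have "\<dots> \<le> B" using B[OF mem] by (simp add: S_def c)
        finally show ?thesis by (simp add: M_def)
      qed
      moreover have "Y + mscale sV t (X - Y) \<in> \<Omega> n" using subsetD[OF sub mem] by (simp add: c)
      ultimately show ?thesis by (simp add: P_def)
    qed
    then show "X \<in> UK" by (simp add: UK_def)
  qed
  have UKU: "UK \<subseteq> Upsilon sV \<Omega> n Y"
    using r by (auto simp: UK_def Upsilon_iff P_def)
  have circ: "complete_circular sV Y UK"
    by (rule complete_circularI[where r = r and B = "{X. P X}"]) (simp add: UK_def)
  have fopen: "fin_open_level sV n UK"
  proof (rule fin_open_levelI)
    \<comment> \<open>An arbitrary family, unrelated to the one whose span contains K.\<close>
    fix k and E :: "nat \<Rightarrow> 'v mat" assume "\<forall>i<k. E i \<in> mat_dim n n"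
    from open_forall_compact[OF open_circle_bounded[OF n Y this, of M], of r]
    show "open {c. mlincomb sV k c E \<in> UK}" by (simp add: UK_def P_def)
  qed
  define C where "C = entry_const n"
  have est: "nrm n (Delta n l Y (X - Y)) \<le> C * M * (1/r)^l"
    "nrm n (f n X - (\<Sum>l<N. Delta n l Y (X - Y))) \<le> C * M * (1/r)^N / (1 - 1/r)" if X: "X \<in> UK" for X l N
  proof -
    have "X \<in> \<Omega> n" using UKU X by (auto simp: Upsilon_def)
    then have Z: "X - Y \<in> mat_dim n n" by (intro mat_dim_diff Omega_mat_dim Y)
    have disc: "Y + mscale sV t (X - Y) \<in> \<Omega> n" if "cmod t \<le> r" for t
      using X that by (simp add: UK_def P_def)
    have M: "norm (f n (Y + mscale sV t (X - Y)) i j) \<le> M" if "i < n" "j < n" "cmod t \<le> r" for i j t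
      using X that by (simp add: UK_def P_def less_imp_le)
    have "Y + (X - Y) = X" by simp
    then show "nrm n (Delta n l Y (X - Y)) \<le> C * M * (1/r)^l"
      "nrm n (f n X - (\<Sum>l<N. Delta n l Y (X - Y))) \<le> C * M * (1/r)^N / (1 - 1/r)"
      unfolding C_def
      using disc_Delta_bound[OF n Y Z r disc M] disc_remainder_bound[OF n Y Z r disc M] by simp_all
  qed
  show ?unif
  proof (intro allI impI)
    fix \<epsilon> :: real assume "\<epsilon> > 0"
    have "(\<lambda>N. C * M * (1/r)^N / (1 - 1/r)) \<longlonglongrightarrow> C * M * 0 / (1 - 1/r)"
      by (intro tendsto_intros LIMSEQ_power_zero) (use r in auto)
    then have "\<forall>\<^sub>F N in sequentially. C * M * (1/r)^N / (1 - 1/r) < \<epsilon>"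
      using \<open>\<epsilon> > 0\<close> by (intro order_tendstoD(2)[of _ "C * M * 0 / (1 - 1/r)"]) auto
    then obtain N0 where "\<And>N. N \<ge> N0 \<Longrightarrow> C * M * (1/r)^N / (1 - 1/r) < \<epsilon>"
      unfolding eventually_sequentially by blast
    then show "\<exists>N0. \<forall>N\<ge>N0. \<forall>X\<in>K. nrm n (f n X - (\<Sum>l<N. Delta n l Y (X - Y))) < \<epsilon>"
      using est(2) KUK by (meson order.strict_trans1 subset_iff)
  qed
  have "(\<Sum>l. (SUP X\<in>UK. ennreal (nrm n (Delta n l Y (X - Y))))) < top"
  proof -
    \<comment> \<open>The suprema are taken in the extended nonnegative reals, where each is bounded
      by a geometric term; the absolute value makes that term nonnegative.\<close>
    have "(\<Sum>l. (SUP X\<in>UK. ennreal (nrm n (Delta n l Y (X - Y))))) \<le> (\<Sum>l. ennreal (\<bar>C * M\<bar> * (1/r)^l))"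
    proof (intro suminf_le summableI SUP_least ennreal_leI)
      fix l X assume "X \<in> UK"
      have "C * M * (1/r)^l \<le> \<bar>C * M\<bar> * (1/r)^l" using r by (intro mult_right_mono) auto
      then show "nrm n (Delta n l Y (X - Y)) \<le> \<bar>C * M\<bar> * (1/r)^l" using est(1)[OF \<open>X \<in> UK\<close>, of l] by linarith
    qed
    also have "\<dots> = ennreal (\<bar>C * M\<bar> * (1 / (1 - 1/r)))"
    proof (rule suminf_ennreal_eq)
      show "(\<lambda>l. \<bar>C * M\<bar> * (1/r)^l) sums (\<bar>C * M\<bar> * (1 / (1 - 1/r)))"
        by (intro sums_mult geometric_sums) (use r in simp)
    qed (use r in auto)
    finally show ?thesis by (rule le_less_trans) simp
  qed
  with fopen circ KUK UKU show ?nbhd by blast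
qed

end

theorem theorem7p2:
  fixes sV :: "complex \<Rightarrow> 'v::ab_group_add \<Rightarrow> 'v"
    and sW :: "complex \<Rightarrow> 'w::banach \<Rightarrow> 'w"
    and nrm :: "nat \<Rightarrow> 'w mat \<Rightarrow> real"
    and \<Omega> :: "nat \<Rightarrow> 'v mat set"
    and f :: "nat \<Rightarrow> 'v mat \<Rightarrow> 'w mat"
  assumes V: "vector_space sV"
    and W: "complex_banach sW"
    and adm: "admissible_norms sW nrm"
    and nc: "nc_set \<Omega>"
    and fo: "finitely_open sV \<Omega>"
    and ncf: "nc_function sV sW \<Omega> f"
    and lb: "locally_bounded_on_slices sV nrm \<Omega> f"
  shows "G_differentiable sV sW nrm \<Omega> f \<and>
    (\<forall>n>0. \<forall>Y\<in>\<Omega> n. \<forall>Z\<in>mat_dim n n. \<forall>N.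
           nth_deriv_at sW n (nrm n) (\<lambda>t. f n (Y + mscale sV t Z)) N
             (mscale sW (of_nat (fact N))
                (DeltaR sV sW \<Omega> f (replicate (Suc N) n) (replicate (Suc N) Y) (replicate N Z)))) \<and>
    (\<forall>n>0. \<forall>Y\<in>\<Omega> n.
           complete_circular sV Y (Upsilon sV \<Omega> n Y) \<and> Upsilon sV \<Omega> n Y \<subseteq> \<Omega> n \<and>
           (\<forall>A. A \<subseteq> \<Omega> n \<longrightarrow> complete_circular sV Y A \<longrightarrow> A \<subseteq> Upsilon sV \<Omega> n Y) \<and>
           fin_open_level sV n (Upsilon sV \<Omega> n Y) \<and>
           (\<forall>X\<in>Upsilon sV \<Omega> n Y.
              summable (\<lambda>l. nrm n (DeltaR sV sW \<Omega> f (replicate (Suc l) n) (replicate (Suc l) Y) (replicate l (X - Y)))) \<and>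
              (\<lambda>N. nrm n (f n X - (\<Sum>l<N. DeltaR sV sW \<Omega> f (replicate (Suc l) n) (replicate (Suc l) Y) (replicate l (X - Y)))))
                \<longlonglongrightarrow> 0)) \<and>
    (\<forall>n>0. \<forall>Y\<in>\<Omega> n. \<forall>k E K. fd_basis sV n k E \<longrightarrow> fd_compact sV k E K \<longrightarrow> K \<subseteq> Upsilon sV \<Omega> n Y \<longrightarrow>
           (\<forall>\<epsilon>>0. \<exists>N0. \<forall>N\<ge>N0. \<forall>X\<in>K.
              nrm n (f n X - (\<Sum>l<N. DeltaR sV sW \<Omega> f (replicate (Suc l) n) (replicate (Suc l) Y) (replicate l (X - Y)))) < \<epsilon>) \<and>
           (\<exists>\<Upsilon>K. fin_open_level sV n \<Upsilon>K \<and> complete_circular sV Y \<Upsilon>K \<and> K \<subseteq> \<Upsilon>K \<and> \<Upsilon>K \<subseteq> Upsilon sV \<Omega> n Y \<and>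
              (\<Sum>l. (SUP X\<in>\<Upsilon>K. ennreal (nrm n (DeltaR sV sW \<Omega> f (replicate (Suc l) n) (replicate (Suc l) Y) (replicate l (X - Y)))))) < top))"
proof -
  interpret nc_fun sW nrm sV \<Omega> f
    by (intro nc_fun.intro admissible.intro cbanach.intro admissible_axioms.intro nc_fun_axioms.intro assms)
  have third: "complete_circular sV Y (Upsilon sV \<Omega> n Y) \<and> Upsilon sV \<Omega> n Y \<subseteq> \<Omega> n \<and>
           (\<forall>A. A \<subseteq> \<Omega> n \<longrightarrow> complete_circular sV Y A \<longrightarrow> A \<subseteq> Upsilon sV \<Omega> n Y) \<and>
           fin_open_level sV n (Upsilon sV \<Omega> n Y) \<and>
           (\<forall>X\<in>Upsilon sV \<Omega> n Y. summable (\<lambda>l. nrm n (Delta n l Y (X - Y))) \<and>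
              (\<lambda>N. nrm n (f n X - (\<Sum>l<N. Delta n l Y (X - Y)))) \<longlonglongrightarrow> 0)"
    if "0 < n" "Y \<in> \<Omega> n" for n Y
    using complete_circularI[OF Upsilon_iff] Upsilon_maximal fin_open_Upsilon[OF that] Upsilon_series[OF that]
    by (auto simp: Upsilon_def)
  show ?thesis
    unfolding Delta_def[symmetric]
    by (rule conjI[OF nc_G_differentiable conjI[OF _ conjI]],
        (intro allI impI ballI, (rule nc_nth_deriv_at; assumption)),
        (intro allI impI ballI, (rule third; assumption)),
        (intro allI impI ballI, (rule conjI[OF compact_uniform]; assumption)))
qed

end
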